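(* Let $k$ be a commutative ring with $1$ and let $L$ be a $T$-Lie algebra over $k$ with strict gradation $L=\bigoplus_{\eta\in\mathbb{N}}L_\eta$. Let $L^{\otimes}$ be the tensor algebra of $L$ over $k$, $U(L)$ the universal enveloping algebra, $\mathcal{S}(L)$ the $q$-symmetric algebra, $G$ the graded algebra associated with $U(L)$, and $\varphi:L^{\otimes}\to G$ the canonical map, all as defined in the context. Let $I$ be the two-sided ideal of $L^{\otimes}$ generated by the elements $x\otimes y-S(x\otimes y)$, $x,y\in L$. Then $\varphi:L^{\otimes}\to G$ is a $k$-algebra morphism. Moreover $\varphi(I)=0$, so $\varphi$ induces a $k$-algebra epimorphism $\omega:\mathcal{S}(L)\to G$.
   Context: **$T$-Lie algebra.** A $k$-module $L$ with $k$-linear maps $[,]:L\otimes_k L\to L$ (bracket), $S:L\otimes_k L\to L\otimes_k L$ (presymmetry), $\langle,\rangle:L\otimes_k L\to L\otimes_k L$ (pseudobracket) such that: 1. Stability: (a) there is a $k$-module decomposition $L=\bigoplus_{\eta\in\mathbb{N}}L_\eta$ with $[L_{\eta_1},L_{\eta_2}]\subseteq L_{\eta_1+\eta_2-1}$ for all $\eta_1,\eta_2$ (a strict gradation related to $[,]$); (b) $\langle L_{\eta_1},L_{\eta_2}\rangle\subseteq(L\otimes_kL)_{\eta_1+\eta_2-1}$ for all $\eta_1,\eta_2$, where $(L\otimes_kL)_\eta=\sum_{\eta_1+\eta_2\le\eta}L_{\eta_1}\otimes_kL_{\eta_2}$. 2. Antisymmetry: $[,]\,S=-[,]$, $\ \langle,\rangle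 S=-\langle,\rangle$, $\ [,]\langle,\rangle=0$. 3. Jacobi identity: $[,](1\otimes[,])-[,]([,]\otimes1)-[,](1\otimes[,])(S\otimes1)=0$ on $L^{\otimes3}$. **Enveloping algebra and $q$-symmetric algebra.** $U(L)=L^{\otimes}/J$, where $J$ is the two-sided ideal generated by $x\otimes y-S(x\otimes y)-\langle x,y\rangle-[x,y]$, $x,y\in L$. $\mathcal{S}(L)=U(L^0)$, where $L^0$ is $L$ with the same presymmetry $S$ and with zero bracket and zero pseudobracket; that is, $\mathcal{S}(L)=L^{\otimes}/I$. **Graded algebra $G$ and the map $\varphi$.** For $m\ge0$ put $$T_m=\bigoplus_{r\ge0,\ \eta_1+\dots+\eta_r\le m}L_{\eta_1}\otimes\cdots\otimes L_{\eta_r},\qquad T^m=\bigoplus_{r\ge0,\ \eta_1+\dots+\eta_r=m}L_{\eta_1}\otimes\cdots\otimes L_{\eta_r}.$$ Let $\pi:L^{\otimes}\to U(L)$ be the natural morphism, $U_m=\pi(T_m)$, $U_{-1}=0$, $G^m=U_m/U_{m-1}$. The multiplication of $U(L)$ induces bilinear maps $G^m\times G^p\to G^{m+p}$, making $G=\bigoplus_{m\ge0}G^m$ a graded associative algebra with $1$. Let $\varphi_m:T^m\to U_m\to G^m$ be the composite of $\pi|_{T^m}$ with the quotient map. Since $L^{\otimes}=\bigoplus_{m\ge0}T^m$, the $\varphi_m$ define a $k$-linear map $\varphi:L^{\otimes}\to G$.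
   Formalization: The claims that φ(I)=0 and that ω exists are proved under the added assumption that S is homogeneous, i.e. S(L_i⊗L_j) lies in the sum of L_p⊗L_q with p+q=i+j; without it they fail (L_1=ka, L_2=kb, zero brackets, S(a⊗a)=b⊗b, S the identity on other basis tensors). *)

theory Defs
  imports "HOL-Algebra.Algebra"
begin

section \<open>Modules and algebras over a commutative ring\<close>

text \<open>The library locale \<^locale>\<open>algebra\<close> is about commutative algebras only.\<close>

locale assoc_algebra = module R A + A?: ring A for R (structure) and A (structure) +
  assumes smult_mult_left:
      "\<lbrakk>a \<in> carrier R; x \<in> carrier A; y \<in> carrier A\<rbrakk> \<Longrightarrow>
        (a \<odot>\<^bsub>A\<^esub> x) \<otimes>\<^bsub>A\<^esub> y = a \<odot>\<^bsub>A\<^esub> (x \<otimes>\<^bsub>A\<^esub> y)"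
    and smult_mult_right:
      "\<lbrakk>a \<in> carrier R; x \<in> carrier A; y \<in> carrier A\<rbrakk> \<Longrightarrow>
        x \<otimes>\<^bsub>A\<^esub> (a \<odot>\<^bsub>A\<^esub> y) = a \<odot>\<^bsub>A\<^esub> (x \<otimes>\<^bsub>A\<^esub> y)"

definition linear_map ::
  "('k, 'r) ring_scheme \<Rightarrow> ('k, 'a, 'm) module_scheme \<Rightarrow> ('k, 'b, 'n) module_scheme \<Rightarrow>
    ('a \<Rightarrow> 'b) \<Rightarrow> bool"
  where "linear_map R M N f \<longleftrightarrow>
    f \<in> carrier M \<rightarrow> carrier N \<and>
    (\<forall>x\<in>carrier M. \<forall>y\<in>carrier M. f (x \<oplus>\<^bsub>M\<^esub> y) = f x \<oplus>\<^bsub>N\<^esub> f y) \<and>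
    (\<forall>a\<in>carrier R. \<forall>x\<in>carrier M. f (a \<odot>\<^bsub>M\<^esub> x) = a \<odot>\<^bsub>N\<^esub> f x)"

definition algebra_hom ::
  "('k, 'r) ring_scheme \<Rightarrow> ('k, 'a, 'm) module_scheme \<Rightarrow> ('k, 'b, 'n) module_scheme \<Rightarrow>
    ('a \<Rightarrow> 'b) \<Rightarrow> bool"
  where "algebra_hom R A B h \<longleftrightarrow>
    assoc_algebra R A \<and> assoc_algebra R B \<and> h \<in> ring_hom A B \<and> linear_map R A B h"

definition lspan :: "('k, 'r) ring_scheme \<Rightarrow> ('k, 'a, 'm) module_scheme \<Rightarrow> 'a set \<Rightarrow> 'a set"
  where "lspan R M B = \<Inter>{N. submodule N R M \<and> B \<subseteq> N}"

text \<open>Quotient by a submodule \<open>N\<close>; the multiplication and the unit are only meaningful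
  if \<open>N\<close> is a two-sided ideal.\<close>

definition quotient ::
  "('k, 'a, 'm) module_scheme \<Rightarrow> 'a set \<Rightarrow> ('k, 'a set) module"
  where "quotient M N =
    \<lparr>carrier = carrier (M Quot N), monoid.mult = monoid.mult (M Quot N),
     monoid.one = monoid.one (M Quot N), ring.zero = ring.zero (M Quot N),
     ring.add = ring.add (M Quot N),
     smult = (\<lambda>a Y. \<Union>x\<in>Y. N +>\<^bsub>M\<^esub> (a \<odot>\<^bsub>M\<^esub> x))\<rparr>"

definition is_decomposition ::
  "('k, 'a, 'm) module_scheme \<Rightarrow> (nat \<Rightarrow> 'a set) \<Rightarrow> 'a \<Rightarrow> (nat \<Rightarrow> 'a) \<Rightarrow> bool"
  where "is_decomposition M F x f \<longleftrightarrow>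
    (\<forall>i. f i \<in> F i) \<and> finite {i. f i \<noteq> \<zero>\<^bsub>M\<^esub>} \<and> x = finsum M f {i. f i \<noteq> \<zero>\<^bsub>M\<^esub>}"

definition direct_decomposition ::
  "('k, 'r) ring_scheme \<Rightarrow> ('k, 'a, 'm) module_scheme \<Rightarrow> (nat \<Rightarrow> 'a set) \<Rightarrow> bool"
  where "direct_decomposition R M F \<longleftrightarrow>
    (\<forall>i. submodule (F i) R M) \<and> (\<forall>x\<in>carrier M. \<exists>!f. is_decomposition M F x f)"

definition components ::
  "('k, 'a, 'm) module_scheme \<Rightarrow> (nat \<Rightarrow> 'a set) \<Rightarrow> 'a \<Rightarrow> nat \<Rightarrow> 'a"
  where "components M F x = (THE f. is_decomposition M F x f)"

text \<open>\<open>F (n - 1)\<close>, with the convention that the piece of degree \<open>-1\<close> is zero.\<close>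

definition pred_piece ::
  "('k, 'a, 'm) module_scheme \<Rightarrow> (nat \<Rightarrow> 'a set) \<Rightarrow> nat \<Rightarrow> 'a set"
  where "pred_piece M F n = (case n of 0 \<Rightarrow> {\<zero>\<^bsub>M\<^esub>} | Suc m \<Rightarrow> F m)"


section \<open>The tensor algebra of a module\<close>

text \<open>The free associative algebra on a set \<open>Y\<close>: finitely supported functions on the words
  in \<open>Y\<close>, with the convolution along concatenation as multiplication.\<close>

definition free_algebra :: "('k, 'r) ring_scheme \<Rightarrow> 'a set \<Rightarrow> ('k, 'a list \<Rightarrow> 'k) module"
  where "free_algebra R Y =
    \<lparr>carrier = {f. (\<forall>w. f w \<in> carrier R) \<and> finite {w. f w \<noteq> \<zero>\<^bsub>R\<^esub>} \<and>
                   {w. f w \<noteq> \<zero>\<^bsub>R\<^esub>} \<subseteq> lists Y},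
     monoid.mult = (\<lambda>f g w. \<Oplus>\<^bsub>R\<^esub>i\<in>{..length w}. f (take i w) \<otimes>\<^bsub>R\<^esub> g (drop i w)),
     monoid.one = (\<lambda>w. if w = [] then \<one>\<^bsub>R\<^esub> else \<zero>\<^bsub>R\<^esub>),
     ring.zero = (\<lambda>w. \<zero>\<^bsub>R\<^esub>),
     ring.add = (\<lambda>f g w. f w \<oplus>\<^bsub>R\<^esub> g w),
     smult = (\<lambda>a f w. a \<otimes>\<^bsub>R\<^esub> f w)\<rparr>"

definition free_gen :: "('k, 'r) ring_scheme \<Rightarrow> 'a \<Rightarrow> 'a list \<Rightarrow> 'k"
  where "free_gen R x = (\<lambda>w. if w = [x] then \<one>\<^bsub>R\<^esub> else \<zero>\<^bsub>R\<^esub>)"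

definition linearity_ideal ::
  "('k, 'r) ring_scheme \<Rightarrow> ('k, 'a, 'm) module_scheme \<Rightarrow> ('a list \<Rightarrow> 'k) set"
  where "linearity_ideal R L = (let F = free_algebra R (carrier L) in
    Idl\<^bsub>F\<^esub>
      ({free_gen R (x \<oplus>\<^bsub>L\<^esub> y) \<ominus>\<^bsub>F\<^esub> (free_gen R x \<oplus>\<^bsub>F\<^esub> free_gen R y) |
          x y. x \<in> carrier L \<and> y \<in> carrier L} \<union>
       {free_gen R (a \<odot>\<^bsub>L\<^esub> x) \<ominus>\<^bsub>F\<^esub> a \<odot>\<^bsub>F\<^esub> free_gen R x |
          a x. a \<in> carrier R \<and> x \<in> carrier L}))"

text \<open>The tensor algebra is the free algebra on the underlying set of \<open>L\<close> modulo the relations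
  making the inclusion of \<open>L\<close> linear. Its multiplication is the tensor multiplication, and
  the tensor power of order \<open>n\<close> is its submodule spanned by the products of \<open>n\<close> elements of
  \<open>L\<close>; in particular \<open>tensor_power R L 2\<close> is the tensor product of \<open>L\<close> with itself.\<close>

type_synonym ('k, 'a) tensor = "('a list \<Rightarrow> 'k) set"

definition tensor_algebra ::
  "('k, 'r) ring_scheme \<Rightarrow> ('k, 'a, 'm) module_scheme \<Rightarrow> ('k, ('k, 'a) tensor) module"
  where "tensor_algebra R L = quotient (free_algebra R (carrier L)) (linearity_ideal R L)"

definition tensor_incl ::
  "('k, 'r) ring_scheme \<Rightarrow> ('k, 'a, 'm) module_scheme \<Rightarrow> 'a \<Rightarrow> ('k, 'a) tensor"
  where "tensor_incl R L x =
    linearity_ideal R L +>\<^bsub>free_algebra R (carrier L)\<^esub> free_gen R x"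

definition tensor_prod ::
  "('k, 'r) ring_scheme \<Rightarrow> ('k, 'a, 'm) module_scheme \<Rightarrow> 'a list \<Rightarrow> ('k, 'a) tensor"
  where "tensor_prod R L xs =
    foldr (\<lambda>x t. tensor_incl R L x \<otimes>\<^bsub>tensor_algebra R L\<^esub> t) xs \<one>\<^bsub>tensor_algebra R L\<^esub>"

definition tensor_power ::
  "('k, 'r) ring_scheme \<Rightarrow> ('k, 'a, 'm) module_scheme \<Rightarrow> nat \<Rightarrow> ('k, 'a) tensor set"
  where "tensor_power R L n = lspan R (tensor_algebra R L)
    {tensor_prod R L xs | xs. xs \<in> lists (carrier L) \<and> length xs = n}"

definition tensor_power_module ::
  "('k, 'r) ring_scheme \<Rightarrow> ('k, 'a, 'm) module_scheme \<Rightarrow> nat \<Rightarrow> ('k, ('k, 'a) tensor) module"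
  where "tensor_power_module R L n = (tensor_algebra R L)\<lparr>carrier := tensor_power R L n\<rparr>"

text \<open>The tensor product of two linear maps that are defined on the tensor powers of order \<open>p\<close>
  and \<open>q\<close> and have values in tensor powers.\<close>

definition tensor_map ::
  "('k, 'r) ring_scheme \<Rightarrow> ('k, 'a, 'm) module_scheme \<Rightarrow> nat \<Rightarrow> nat \<Rightarrow>
    (('k, 'a) tensor \<Rightarrow> ('k, 'a) tensor) \<Rightarrow> (('k, 'a) tensor \<Rightarrow> ('k, 'a) tensor) \<Rightarrow>
    ('k, 'a) tensor \<Rightarrow> ('k, 'a) tensor"
  where "tensor_map R L p q f g = (THE h.
    h \<in> extensional (tensor_power R L (p + q)) \<and>
    linear_map R (tensor_power_module R L (p + q)) (tensor_algebra R L) h \<and>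
    (\<forall>u\<in>tensor_power R L p. \<forall>v\<in>tensor_power R L q.
      h (u \<otimes>\<^bsub>tensor_algebra R L\<^esub> v) = f u \<otimes>\<^bsub>tensor_algebra R L\<^esub> g v))"

text \<open>For a family \<open>Lg\<close> of submodules of \<open>L\<close>: the span of the \<open>L\<^bsub>i\<^esub> \<otimes> L\<^bsub>j\<^esub>\<close> with
  \<open>i + j \<le> n\<close>, respectively \<open>i + j = n\<close>.\<close>

definition tensor2_le ::
  "('k, 'r) ring_scheme \<Rightarrow> ('k, 'a, 'm) module_scheme \<Rightarrow> (nat \<Rightarrow> 'a set) \<Rightarrow> nat \<Rightarrow>
    ('k, 'a) tensor set"
  where "tensor2_le R L Lg n = lspan R (tensor_algebra R L)
    {tensor_prod R L [x, y] | x y. \<exists>i j. x \<in> Lg i \<and> y \<in> Lg j \<and> i + j \<le> n}"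

definition tensor2_eq ::
  "('k, 'r) ring_scheme \<Rightarrow> ('k, 'a, 'm) module_scheme \<Rightarrow> (nat \<Rightarrow> 'a set) \<Rightarrow> nat \<Rightarrow>
    ('k, 'a) tensor set"
  where "tensor2_eq R L Lg n = lspan R (tensor_algebra R L)
    {tensor_prod R L [x, y] | x y. \<exists>i j. x \<in> Lg i \<and> y \<in> Lg j \<and> i + j = n}"

text \<open>The submodules \<open>T\<^bsub>m\<^esub>\<close> and \<open>T\<^bsup>m\<^esup>\<close> of the tensor algebra.\<close>

definition tensor_le ::
  "('k, 'r) ring_scheme \<Rightarrow> ('k, 'a, 'm) module_scheme \<Rightarrow> (nat \<Rightarrow> 'a set) \<Rightarrow> nat \<Rightarrow>
    ('k, 'a) tensor set"
  where "tensor_le R L Lg m = lspan R (tensor_algebra R L)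
    {tensor_prod R L xs | xs. \<exists>ns. list_all2 (\<lambda>x n. x \<in> Lg n) xs ns \<and> sum_list ns \<le> m}"

definition tensor_eq ::
  "('k, 'r) ring_scheme \<Rightarrow> ('k, 'a, 'm) module_scheme \<Rightarrow> (nat \<Rightarrow> 'a set) \<Rightarrow> nat \<Rightarrow>
    ('k, 'a) tensor set"
  where "tensor_eq R L Lg m = lspan R (tensor_algebra R L)
    {tensor_prod R L xs | xs. \<exists>ns. list_all2 (\<lambda>x n. x \<in> Lg n) xs ns \<and> sum_list ns = m}"


section \<open>T-Lie algebras\<close>

text \<open>The bracket \<open>br\<close>, the presymmetry \<open>S\<close> and the pseudobracket \<open>pb\<close> are maps on the tensor
  product; their values outside \<open>tensor_power R L 2\<close> are irrelevant.\<close>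

locale t_lie_algebra = module R L for R (structure) and L (structure) +
  fixes Lg :: "nat \<Rightarrow> 'c set"
    and br :: "('a, 'c) tensor \<Rightarrow> 'c"
    and S pb :: "('a, 'c) tensor \<Rightarrow> ('a, 'c) tensor"
  assumes bracket_linear: "linear_map R (tensor_power_module R L 2) L br"
    and presymmetry_linear:
      "linear_map R (tensor_power_module R L 2) (tensor_power_module R L 2) S"
    and pseudobracket_linear:
      "linear_map R (tensor_power_module R L 2) (tensor_power_module R L 2) pb"
    and gradation: "direct_decomposition R L Lg"
    and bracket_degree:
      "\<lbrakk>x \<in> Lg i; y \<in> Lg j\<rbrakk> \<Longrightarrow> br (tensor_prod R L [x, y]) \<in> pred_piece L Lg (i + j)"
    and pseudobracket_degree:
      "\<lbrakk>x \<in> Lg i; y \<in> Lg j\<rbrakk> \<Longrightarrow>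
        pb (tensor_prod R L [x, y]) \<in>
          pred_piece (tensor_algebra R L) (tensor2_le R L Lg) (i + j)"
    and bracket_antisym: "t \<in> tensor_power R L 2 \<Longrightarrow> br (S t) = \<ominus>\<^bsub>L\<^esub> br t"
    and pseudobracket_antisym:
      "t \<in> tensor_power R L 2 \<Longrightarrow> pb (S t) = \<ominus>\<^bsub>tensor_algebra R L\<^esub> pb t"
    and bracket_pseudobracket: "t \<in> tensor_power R L 2 \<Longrightarrow> br (pb t) = \<zero>\<^bsub>L\<^esub>"
    and jacobi:
      "t \<in> tensor_power R L 3 \<Longrightarrow>
        br (tensor_map R L 1 2 id (tensor_incl R L \<circ> br) t)
          \<ominus>\<^bsub>L\<^esub> br (tensor_map R L 2 1 (tensor_incl R L \<circ> br) id t)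
          \<ominus>\<^bsub>L\<^esub> br (tensor_map R L 1 2 id (tensor_incl R L \<circ> br) (tensor_map R L 2 1 S id t))
        = \<zero>\<^bsub>L\<^esub>"

text \<open>Homogeneity of the presymmetry does not follow from the axioms of a T-Lie algebra: over a
  field, let \<open>L\<^bsub>1\<^esub>\<close> and \<open>L\<^bsub>2\<^esub>\<close> have bases \<open>a\<close> and \<open>b\<close>, let bracket and pseudobracket vanish,
  and let \<open>S\<close> send \<open>a \<otimes> a\<close> to \<open>b \<otimes> b\<close> and fix the other basis tensors. Then the
  canonical map \<open>graded_map\<close> below does not vanish on the ideal generated by the
  \<open>x \<otimes> y - S (x \<otimes> y)\<close>: in the example \<open>b\<^sup>2 = a\<^sup>2\<close> in the enveloping algebra has filtration degree
  \<open>2\<close>, so \<open>b \<otimes> b\<close> is sent to zero in degree \<open>4\<close>, while \<open>a \<otimes> a\<close> is sent to the class of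
  \<open>a\<^sup>2\<close> in degree \<open>2\<close>, which is nonzero.\<close>

definition homogeneous_presymmetry ::
  "('k, 'r) ring_scheme \<Rightarrow> ('k, 'a, 'm) module_scheme \<Rightarrow> (nat \<Rightarrow> 'a set) \<Rightarrow>
    (('k, 'a) tensor \<Rightarrow> ('k, 'a) tensor) \<Rightarrow> bool"
  where "homogeneous_presymmetry R L Lg S \<longleftrightarrow>
    (\<forall>i j. \<forall>x\<in>Lg i. \<forall>y\<in>Lg j. S (tensor_prod R L [x, y]) \<in> tensor2_eq R L Lg (i + j))"


section \<open>Enveloping algebra and q-symmetric algebra\<close>

definition envelope_ideal ::
  "('k, 'r) ring_scheme \<Rightarrow> ('k, 'a, 'm) module_scheme \<Rightarrow> (('k, 'a) tensor \<Rightarrow> 'a) \<Rightarrow>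
    (('k, 'a) tensor \<Rightarrow> ('k, 'a) tensor) \<Rightarrow> (('k, 'a) tensor \<Rightarrow> ('k, 'a) tensor) \<Rightarrow>
    ('k, 'a) tensor set"
  where "envelope_ideal R L br S pb = (let T = tensor_algebra R L in
    Idl\<^bsub>T\<^esub> {tensor_prod R L [x, y] \<ominus>\<^bsub>T\<^esub> S (tensor_prod R L [x, y])
              \<ominus>\<^bsub>T\<^esub> pb (tensor_prod R L [x, y])
              \<ominus>\<^bsub>T\<^esub> tensor_incl R L (br (tensor_prod R L [x, y])) |
            x y. x \<in> carrier L \<and> y \<in> carrier L})"

definition envelope ::
  "('k, 'r) ring_scheme \<Rightarrow> ('k, 'a, 'm) module_scheme \<Rightarrow> (('k, 'a) tensor \<Rightarrow> 'a) \<Rightarrow>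
    (('k, 'a) tensor \<Rightarrow> ('k, 'a) tensor) \<Rightarrow> (('k, 'a) tensor \<Rightarrow> ('k, 'a) tensor) \<Rightarrow>
    ('k, ('k, 'a) tensor set) module"
  where "envelope R L br S pb = quotient (tensor_algebra R L) (envelope_ideal R L br S pb)"

definition envelope_proj ::
  "('k, 'r) ring_scheme \<Rightarrow> ('k, 'a, 'm) module_scheme \<Rightarrow> (('k, 'a) tensor \<Rightarrow> 'a) \<Rightarrow>
    (('k, 'a) tensor \<Rightarrow> ('k, 'a) tensor) \<Rightarrow> (('k, 'a) tensor \<Rightarrow> ('k, 'a) tensor) \<Rightarrow>
    ('k, 'a) tensor \<Rightarrow> ('k, 'a) tensor set"
  where "envelope_proj R L br S pb t = envelope_ideal R L br S pb +>\<^bsub>tensor_algebra R L\<^esub> t"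

definition presymmetry_ideal ::
  "('k, 'r) ring_scheme \<Rightarrow> ('k, 'a, 'm) module_scheme \<Rightarrow>
    (('k, 'a) tensor \<Rightarrow> ('k, 'a) tensor) \<Rightarrow> ('k, 'a) tensor set"
  where "presymmetry_ideal R L S = (let T = tensor_algebra R L in
    Idl\<^bsub>T\<^esub> {tensor_prod R L [x, y] \<ominus>\<^bsub>T\<^esub> S (tensor_prod R L [x, y]) |
            x y. x \<in> carrier L \<and> y \<in> carrier L})"

definition q_symmetric_algebra ::
  "('k, 'r) ring_scheme \<Rightarrow> ('k, 'a, 'm) module_scheme \<Rightarrow>
    (('k, 'a) tensor \<Rightarrow> ('k, 'a) tensor) \<Rightarrow> ('k, ('k, 'a) tensor set) module"
  where "q_symmetric_algebra R L S =
    envelope R L (\<lambda>_. \<zero>\<^bsub>L\<^esub>) S (\<lambda>_. \<zero>\<^bsub>tensor_algebra R L\<^esub>)"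

definition q_symmetric_proj ::
  "('k, 'r) ring_scheme \<Rightarrow> ('k, 'a, 'm) module_scheme \<Rightarrow>
    (('k, 'a) tensor \<Rightarrow> ('k, 'a) tensor) \<Rightarrow> ('k, 'a) tensor \<Rightarrow> ('k, 'a) tensor set"
  where "q_symmetric_proj R L S =
    envelope_proj R L (\<lambda>_. \<zero>\<^bsub>L\<^esub>) S (\<lambda>_. \<zero>\<^bsub>tensor_algebra R L\<^esub>)"


section \<open>The associated graded algebra\<close>

definition envelope_filtration ::
  "('k, 'r) ring_scheme \<Rightarrow> ('k, 'a, 'm) module_scheme \<Rightarrow> (nat \<Rightarrow> 'a set) \<Rightarrow>
    (('k, 'a) tensor \<Rightarrow> 'a) \<Rightarrow>
    (('k, 'a) tensor \<Rightarrow> ('k, 'a) tensor) \<Rightarrow> (('k, 'a) tensor \<Rightarrow> ('k, 'a) tensor) \<Rightarrow>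
    nat \<Rightarrow> ('k, 'a) tensor set set"
  where "envelope_filtration R L Lg br S pb m = envelope_proj R L br S pb ` tensor_le R L Lg m"

definition filtration_pred ::
  "('k, 'r) ring_scheme \<Rightarrow> ('k, 'a, 'm) module_scheme \<Rightarrow> (nat \<Rightarrow> 'a set) \<Rightarrow>
    (('k, 'a) tensor \<Rightarrow> 'a) \<Rightarrow>
    (('k, 'a) tensor \<Rightarrow> ('k, 'a) tensor) \<Rightarrow> (('k, 'a) tensor \<Rightarrow> ('k, 'a) tensor) \<Rightarrow>
    nat \<Rightarrow> ('k, 'a) tensor set set"
  where "filtration_pred R L Lg br S pb =
    pred_piece (envelope R L br S pb) (envelope_filtration R L Lg br S pb)"

definition graded_piece ::
  "('k, 'r) ring_scheme \<Rightarrow> ('k, 'a, 'm) module_scheme \<Rightarrow> (nat \<Rightarrow> 'a set) \<Rightarrow>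
    (('k, 'a) tensor \<Rightarrow> 'a) \<Rightarrow>
    (('k, 'a) tensor \<Rightarrow> ('k, 'a) tensor) \<Rightarrow> (('k, 'a) tensor \<Rightarrow> ('k, 'a) tensor) \<Rightarrow>
    nat \<Rightarrow> ('k, ('k, 'a) tensor set set) module"
  where "graded_piece R L Lg br S pb m =
    quotient ((envelope R L br S pb)\<lparr>carrier := envelope_filtration R L Lg br S pb m\<rparr>)
      (filtration_pred R L Lg br S pb m)"

text \<open>The external direct sum of the graded pieces. The product of the class of \<open>u\<close> in degree \<open>i\<close>
  and the class of \<open>v\<close> in degree \<open>j\<close> is the class of \<open>u v\<close> in degree \<open>i + j\<close>.\<close>

definition graded_algebra ::
  "('k, 'r) ring_scheme \<Rightarrow> ('k, 'a, 'm) module_scheme \<Rightarrow> (nat \<Rightarrow> 'a set) \<Rightarrow>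
    (('k, 'a) tensor \<Rightarrow> 'a) \<Rightarrow>
    (('k, 'a) tensor \<Rightarrow> ('k, 'a) tensor) \<Rightarrow> (('k, 'a) tensor \<Rightarrow> ('k, 'a) tensor) \<Rightarrow>
    ('k, nat \<Rightarrow> ('k, 'a) tensor set set) module"
  where "graded_algebra R L Lg br S pb =
    (let U = envelope R L br S pb; P = filtration_pred R L Lg br S pb;
         Gr = graded_piece R L Lg br S pb in
    \<lparr>carrier = {g. (\<forall>m. g m \<in> carrier (Gr m)) \<and> finite {m. g m \<noteq> \<zero>\<^bsub>Gr m\<^esub>}},
     monoid.mult = (\<lambda>g h m. \<Oplus>\<^bsub>Gr m\<^esub>i\<in>{..m}. rcoset_mult U (P m) (g i) (h (m - i))),
     monoid.one = (\<lambda>m. if m = 0 then P 0 +>\<^bsub>U\<^esub> \<one>\<^bsub>U\<^esub> else \<zero>\<^bsub>Gr m\<^esub>),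
     ring.zero = (\<lambda>m. \<zero>\<^bsub>Gr m\<^esub>),
     ring.add = (\<lambda>g h m. g m \<oplus>\<^bsub>Gr m\<^esub> h m),
     smult = (\<lambda>a g m. a \<odot>\<^bsub>Gr m\<^esub> g m)\<rparr>)"

definition graded_map ::
  "('k, 'r) ring_scheme \<Rightarrow> ('k, 'a, 'm) module_scheme \<Rightarrow> (nat \<Rightarrow> 'a set) \<Rightarrow>
    (('k, 'a) tensor \<Rightarrow> 'a) \<Rightarrow>
    (('k, 'a) tensor \<Rightarrow> ('k, 'a) tensor) \<Rightarrow> (('k, 'a) tensor \<Rightarrow> ('k, 'a) tensor) \<Rightarrow>
    ('k, 'a) tensor \<Rightarrow> nat \<Rightarrow> ('k, 'a) tensor set set"
  where "graded_map R L Lg br S pb t = (\<lambda>m.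
    filtration_pred R L Lg br S pb m +>\<^bsub>envelope R L br S pb\<^esub>
      envelope_proj R L br S pb (components (tensor_algebra R L) (tensor_eq R L Lg) t m))"

end

theory Submission
  imports Defs
begin

text \<open>Sending \<open>x\<close> to the power series of its homogeneous components extends to an algebra morphism
  from the tensor algebra \<open>T\<close> to \<open>T[[X]]\<close>. This morphism provides the direct decomposition of \<open>T\<close>
  and shows that taking components turns products into convolutions. The associated graded
  algebra of a filtered algebra \<open>A\<close> is the image of the Rees subalgebra of \<open>A[[X]]\<close>, and the
  canonical map is the composite of the component morphism, the projection onto the enveloping
  algebra, and the passage to classes; hence it is a morphism. It is onto because a tensor of
  filtration degree at most \<open>m\<close> is a homogeneous one of degree \<open>m\<close> modulo lower degree. If \<open>S\<close> is
  homogeneous, then for homogeneous \<open>x\<close>, \<open>y\<close> the homogeneous tensor \<open>x \<otimes> y - S (x \<otimes> y)\<close> equals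
  \<open>\<langle>x, y\<rangle> + [x, y]\<close> in the enveloping algebra, which has smaller filtration degree, so its class
  vanishes; bilinearity gives this for all \<open>x\<close>, \<open>y\<close>.\<close>

section \<open>Modules, algebras and their images\<close>

text \<open>Over a general commutative ring the pieces \<open>Lg i\<close> need not have bases, and
  the tensor algebra is given only as a quotient of a free algebra by linearity relations. So
  neither the directness of the sum of the \<open>T^m\<close> nor the behaviour of components under
  products can be read off from a normal form. What is available is the universal property, and the
  target \<open>T[[X]]\<close> is chosen for it: a homogeneous tensor of degree \<open>m\<close>
  goes to itself times \<open>X^m\<close>, so the coefficients of the image recover the components.
  Series are taken rather than polynomials so that no finiteness has to be checked while the
  morphism is built; finite support follows afterwards by induction over the span. Word-indexed
  series serve twice: with coefficients in \<open>R\<close> and any alphabet they make the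
  convolution of the free algebra associative, and over one letter they are power series. Passing
  through the Rees algebra keeps iterated sums of products of cosets out of the verification of the
  axioms for \<open>G\<close>: each axiom is the image of one for series, and the main point left is
  that a product of classes does not depend on the representatives.\<close>

lemma linear_mapD:
  assumes "linear_map R M N f"
  shows "x \<in> carrier M \<Longrightarrow> f x \<in> carrier N"
    and "x \<in> carrier M \<Longrightarrow> y \<in> carrier M \<Longrightarrow> f (x \<oplus>\<^bsub>M\<^esub> y) = f x \<oplus>\<^bsub>N\<^esub> f y"
    and "a \<in> carrier R \<Longrightarrow> x \<in> carrier M \<Longrightarrow> f (a \<odot>\<^bsub>M\<^esub> x) = a \<odot>\<^bsub>N\<^esub> f x"
  using assms by (auto simp: linear_map_def)

lemma linear_mapI:
  assumes "\<And>x. x \<in> carrier M \<Longrightarrow> f x \<in> carrier N"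
    and "\<And>x y. x \<in> carrier M \<Longrightarrow> y \<in> carrier M \<Longrightarrow> f (x \<oplus>\<^bsub>M\<^esub> y) = f x \<oplus>\<^bsub>N\<^esub> f y"
    and "\<And>a x. a \<in> carrier R \<Longrightarrow> x \<in> carrier M \<Longrightarrow> f (a \<odot>\<^bsub>M\<^esub> x) = a \<odot>\<^bsub>N\<^esub> f x"
  shows "linear_map R M N f"
  using assms by (auto simp: linear_map_def)

lemma linear_map_zero:
  assumes "module R M" "module R N" "linear_map R M N f"
  shows "f \<zero>\<^bsub>M\<^esub> = \<zero>\<^bsub>N\<^esub>"
proof -
  interpret M: module R M by fact
  interpret N: module R N by fact
  have "f (\<zero>\<^bsub>R\<^esub> \<odot>\<^bsub>M\<^esub> \<zero>\<^bsub>M\<^esub>) = \<zero>\<^bsub>R\<^esub> \<odot>\<^bsub>N\<^esub> f \<zero>\<^bsub>M\<^esub>"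
    by (rule linear_mapD(3)[OF assms(3)]) auto
  then show ?thesis
    using linear_mapD(1)[OF assms(3) M.M.zero_closed] by simp
qed

lemma linear_map_uminus:
  assumes "module R M" "module R N" "linear_map R M N f" "x \<in> carrier M"
  shows "f (\<ominus>\<^bsub>M\<^esub> x) = \<ominus>\<^bsub>N\<^esub> f x"
proof -
  interpret M: module R M by fact
  interpret N: module R N by fact
  have "f (\<ominus>\<^bsub>M\<^esub> x) \<oplus>\<^bsub>N\<^esub> f x = \<zero>\<^bsub>N\<^esub>"
    using linear_mapD(2)[OF assms(3), of "\<ominus>\<^bsub>M\<^esub> x" x] assms(4) linear_map_zero[OF assms(1-3)]
    by (simp add: M.M.l_neg)
  then show ?thesis
    using N.M.minus_equality linear_mapD(1)[OF assms(3)] assms(4) by (metis M.M.a_inv_closed)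
qed

lemma linear_map_minus:
  assumes "module R M" "module R N" "linear_map R M N f" "x \<in> carrier M" "y \<in> carrier M"
  shows "f (x \<ominus>\<^bsub>M\<^esub> y) = f x \<ominus>\<^bsub>N\<^esub> f y"
proof -
  interpret M: module R M by fact
  show ?thesis
    using linear_mapD(2)[OF assms(3), of x "\<ominus>\<^bsub>M\<^esub> y"] linear_map_uminus[OF assms(1-3)] assms(4,5)
    by (simp add: a_minus_def)
qed

text \<open>The index set may be infinite: both sums are then zero by the convention for
  \<open>finsum\<close>, and a linear map preserves zero.\<close>

lemma linear_map_finsum:
  assumes "module R M" "module R N" "linear_map R M N f" "g \<in> A \<rightarrow> carrier M"
  shows "f (finsum M g A) = (\<Oplus>\<^bsub>N\<^esub>i\<in>A. f (g i))"
proof -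
  interpret M: module R M by fact
  interpret N: module R N by fact
  show ?thesis using assms(4)
  proof (induction A rule: infinite_finite_induct)
    case (infinite A)
    then show ?case
      by (simp add: linear_map_zero[OF assms(1-3)] M.M.add.finprod_infinite N.M.add.finprod_infinite)
  next
    case empty
    then show ?case by (simp add: linear_map_zero[OF assms(1-3)])
  next
    case (insert a A)
    then have g: "g a \<in> carrier M" "g \<in> A \<rightarrow> carrier M" by auto
    then have "(\<lambda>x. f (g x)) \<in> A \<rightarrow> carrier N" "f (g a) \<in> carrier N"
      using linear_mapD(1)[OF assms(3)] by auto
    then show ?case
      using insert g linear_mapD(2)[OF assms(3) g(1) M.M.finsum_closed[OF g(2)]]
      by (simp add: M.M.finsum_insert N.M.finsum_insert)
  qed
qed

lemma linear_map_comp: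
  assumes "linear_map R M N f" "linear_map R N K g"
  shows "linear_map R M K (g \<circ> f)"
  using assms by (auto simp: linear_map_def Pi_def)

lemma linear_map_restrict:
  assumes "linear_map R M N f" "C \<subseteq> carrier M"
  shows "linear_map R (M\<lparr>carrier := C\<rparr>) N f"
  using assms by (auto simp: linear_map_def Pi_def subset_iff)

lemma submodule_zero:
  assumes "submodule C R M"
  shows "\<zero>\<^bsub>M\<^esub> \<in> C"
proof -
  interpret submodule C R M by fact
  show ?thesis using one_closed by simp
qed

lemma submodule_finsum_closed:
  assumes "module R M" "submodule C R M" "g \<in> A \<rightarrow> C"
  shows "finsum M g A \<in> C"
proof -
  interpret M: module R M by fact
  interpret C: submodule C R M by fact
  note sub = M.submoduleE[OF assms(2)]
  have z: "\<zero>\<^bsub>M\<^esub> \<in> C" using C.one_closed by simp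
  show ?thesis using assms(3)
  proof (induction A rule: infinite_finite_induct)
    case (insert a A)
    then have "g a \<in> carrier M" "g \<in> A \<rightarrow> carrier M" using sub(1) by auto
    then show ?case using insert sub(5) by (simp add: M.M.finsum_insert)
  qed (auto simp: z M.M.add.finprod_infinite)
qed

lemma submodule_restrict_module:
  assumes "module R M" "submodule C R M"
  shows "module R (M\<lparr>carrier := C\<rparr>)"
  using submodule.submodule_is_module[OF assms(2,1)] .

text \<open>The value of \<open>finsum\<close> formally depends on the carrier, so the two sums are
  different terms. The inclusion of \<open>C\<close> is linear and carries one to the other.\<close>

lemma finsum_restrict:
  assumes "module R M" "submodule C R M" "g \<in> A \<rightarrow> C"
  shows "finsum (M\<lparr>carrier := C\<rparr>) g A = finsum M g A"
proof -
  interpret M: module R M by fact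
  have "linear_map R (M\<lparr>carrier := C\<rparr>) M (\<lambda>x. x)"
    using M.submoduleE(1)[OF assms(2)] by (auto simp: linear_map_def)
  from linear_map_finsum[OF submodule_restrict_module[OF assms(1,2)] assms(1) this] assms(3)
  show ?thesis by simp
qed

text \<open>Transport of structure: every module axiom for \<open>N\<close> is the image under
  \<open>f\<close> of the same axiom for \<open>M\<close>. Neither injectivity of \<open>f\<close>
  nor any structure on \<open>N\<close> is presupposed, so this can establish that a quotient is a
  module in the first place.\<close>

lemma module_image:
  assumes "module R M" "submodule C R M"
    and carr: "carrier N = f ` C"
    and zero: "\<zero>\<^bsub>N\<^esub> = f \<zero>\<^bsub>M\<^esub>"
    and add: "\<And>x y. x \<in> C \<Longrightarrow> y \<in> C \<Longrightarrow> f x \<oplus>\<^bsub>N\<^esub> f y = f (x \<oplus>\<^bsub>M\<^esub> y)"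
    and smult: "\<And>a x. a \<in> carrier R \<Longrightarrow> x \<in> C \<Longrightarrow> a \<odot>\<^bsub>N\<^esub> f x = f (a \<odot>\<^bsub>M\<^esub> x)"
  shows "module R N"
proof -
  interpret M: module R M by fact
  interpret C: submodule C R M by fact
  note sub = M.submoduleE[OF assms(2)]
  have z: "\<zero>\<^bsub>M\<^esub> \<in> C" using C.one_closed by simp
  have c: "x \<in> carrier M" if "x \<in> C" for x using that sub(1) by auto
  have "abelian_group N"
  proof (rule abelian_groupI)
    fix x assume "x \<in> carrier N"
    then obtain u where u: "x = f u" "u \<in> C" using carr by auto
    have "f (\<ominus>\<^bsub>M\<^esub> u) \<oplus>\<^bsub>N\<^esub> x = \<zero>\<^bsub>N\<^esub>"
      using u sub(3) c by (simp add: add zero M.M.l_neg)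
    then show "\<exists>y\<in>carrier N. y \<oplus>\<^bsub>N\<^esub> x = \<zero>\<^bsub>N\<^esub>" using u sub(3) carr by auto
  next
    show "x \<oplus>\<^bsub>N\<^esub> y = y \<oplus>\<^bsub>N\<^esub> x" if "x \<in> carrier N" "y \<in> carrier N" for x y
      using that by (auto simp: carr add c M.M.a_comm)
  qed (auto simp: carr zero z add sub c M.M.a_assoc)
  then show ?thesis
    by (rule moduleI[OF M.R.is_cring])
      (auto simp: carr add smult sub c M.smult_l_distr M.smult_r_distr M.smult_assoc1)
qed

text \<open>Used in three ways: with \<open>f\<close> the identity for a subalgebra (the free
  algebra inside the series), with \<open>f\<close> the coset map for a quotient, and with
  \<open>f\<close> the passage to classes for the associated graded algebra.\<close>

lemma assoc_algebra_image:
  assumes "assoc_algebra R A" "submodule C R A"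
    and one_mem: "\<one>\<^bsub>A\<^esub> \<in> C"
    and mult_mem: "\<And>x y. x \<in> C \<Longrightarrow> y \<in> C \<Longrightarrow> x \<otimes>\<^bsub>A\<^esub> y \<in> C"
    and carr: "carrier B = f ` C"
    and zero: "\<zero>\<^bsub>B\<^esub> = f \<zero>\<^bsub>A\<^esub>"
    and one: "\<one>\<^bsub>B\<^esub> = f \<one>\<^bsub>A\<^esub>"
    and add: "\<And>x y. x \<in> C \<Longrightarrow> y \<in> C \<Longrightarrow> f x \<oplus>\<^bsub>B\<^esub> f y = f (x \<oplus>\<^bsub>A\<^esub> y)"
    and mult: "\<And>x y. x \<in> C \<Longrightarrow> y \<in> C \<Longrightarrow> f x \<otimes>\<^bsub>B\<^esub> f y = f (x \<otimes>\<^bsub>A\<^esub> y)"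
    and smult: "\<And>a x. a \<in> carrier R \<Longrightarrow> x \<in> C \<Longrightarrow> a \<odot>\<^bsub>B\<^esub> f x = f (a \<odot>\<^bsub>A\<^esub> x)"
  shows "assoc_algebra R B"
proof -
  interpret A: assoc_algebra R A by fact
  interpret C: submodule C R A by fact
  note sub = A.submoduleE[OF assms(2)]
  have c: "x \<in> carrier A" if "x \<in> C" for x using that sub(1) by auto
  interpret B: module R B
    by (rule module_image[OF A.module_axioms assms(2) carr zero add smult])
  have "ring B"
  proof (rule ringI)
    show "abelian_group B" by (rule B.abelian_group_axioms)
    show "Group.monoid B"
      by (rule monoidI) (auto simp: carr one one_mem mult mult_mem c A.A.m_assoc)
  qed (auto simp: carr mult mult_mem add sub c A.A.l_distr A.A.r_distr)
  then show ?thesis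
    unfolding assoc_algebra_def assoc_algebra_axioms_def
    by (auto simp: B.module_axioms carr smult mult mult_mem sub c A.smult_mult_left
        A.smult_mult_right)
qed

section \<open>Linear spans and linear maps on them\<close>

lemma lspan_submodule:
  assumes "module R M" "B \<subseteq> carrier M"
  shows "submodule (lspan R M B) R M"
proof -
  interpret M: module R M by fact
  show ?thesis
  proof (rule M.submoduleI)
    show "lspan R M B \<subseteq> carrier M"
      using assms(2) M.carrier_is_submodule by (auto simp: lspan_def)
    show "\<zero>\<^bsub>M\<^esub> \<in> lspan R M B"
      by (auto simp: lspan_def intro: submodule_zero)
  qed (auto simp: lspan_def dest: M.submoduleE)
qed

lemma lspan_minimal: "submodule N R M \<Longrightarrow> B \<subseteq> N \<Longrightarrow> lspan R M B \<subseteq> N"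
  by (auto simp: lspan_def)

lemma lspan_superset: "B \<subseteq> lspan R M B"
  by (auto simp: lspan_def)

text \<open>The elements of the span that satisfy \<open>P\<close> form a submodule containing
  \<open>B\<close>. Negation needs no case of its own, being multiplication by the scalar
  \<open>-1\<close>.\<close>

lemma lspan_induct [consumes 3, case_names base zero add smult]:
  assumes "module R M" "B \<subseteq> carrier M" and x: "x \<in> lspan R M B"
    and base: "\<And>x. x \<in> B \<Longrightarrow> P x"
    and zero: "P \<zero>\<^bsub>M\<^esub>"
    and add: "\<And>x y. x \<in> lspan R M B \<Longrightarrow> y \<in> lspan R M B \<Longrightarrow> P x \<Longrightarrow> P y \<Longrightarrow> P (x \<oplus>\<^bsub>M\<^esub> y)"
    and smult: "\<And>a x. a \<in> carrier R \<Longrightarrow> x \<in> lspan R M B \<Longrightarrow> P x \<Longrightarrow> P (a \<odot>\<^bsub>M\<^esub> x)"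
  shows "P x"
proof -
  interpret M: module R M by fact
  have sub: "submodule (lspan R M B) R M" by (rule lspan_submodule[OF assms(1,2)])
  note subE = M.submoduleE[OF sub]
  have z: "\<zero>\<^bsub>M\<^esub> \<in> lspan R M B"
    using sub by (auto intro: submodule_zero)
  have "submodule {x \<in> lspan R M B. P x} R M"
  proof (rule M.submoduleI)
    fix x assume x: "x \<in> {x \<in> lspan R M B. P x}"
    then have "\<ominus>\<^bsub>M\<^esub> x = (\<ominus>\<^bsub>R\<^esub> \<one>\<^bsub>R\<^esub>) \<odot>\<^bsub>M\<^esub> x"
      using subE(1) by (subst M.smult_l_minus) auto
    then show "\<ominus>\<^bsub>M\<^esub> x \<in> {x \<in> lspan R M B. P x}"
      using x subE(4)[of "\<ominus>\<^bsub>R\<^esub> \<one>\<^bsub>R\<^esub>" x] smult[of "\<ominus>\<^bsub>R\<^esub> \<one>\<^bsub>R\<^esub>" x] by auto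
  qed (use subE z zero add smult in auto)
  then have "lspan R M B \<subseteq> {x \<in> lspan R M B. P x}"
    by (rule lspan_minimal) (use base lspan_superset[of B R M] in auto)
  then show ?thesis using x by auto
qed

lemma linear_map_lspan_subset:
  assumes "module R M" "module R N" "linear_map R M N f" "B \<subseteq> carrier M"
    and "submodule C R N" "f ` B \<subseteq> C"
  shows "f ` lspan R M B \<subseteq> C"
proof
  fix y assume "y \<in> f ` lspan R M B"
  then obtain x where x: "y = f x" "x \<in> lspan R M B" by auto
  interpret M: module R M by fact
  interpret N: module R N by fact
  note C = N.submoduleE[OF assms(5)]
  note lsp = M.submoduleE(1)[OF lspan_submodule[OF assms(1,4)]]
  from assms(1,4) x(2) have "f x \<in> C"
  proof (induction rule: lspan_induct)
    case zero
    then show ?case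
      using assms(5) linear_map_zero[OF assms(1-3)] by (auto intro: submodule_zero)
  next
    case (add x y)
    then show ?case using C(5) lsp linear_mapD(2)[OF assms(3), of x y] by (auto simp: subset_iff)
  next
    case (smult a x)
    then show ?case using C(4) lsp linear_mapD(3)[OF assms(3), of a x] by (auto simp: subset_iff)
  qed (use assms(6) in auto)
  then show "y \<in> C" using x by simp
qed

lemma submodule_image:
  assumes "module R M" "module R N" "linear_map R M N f" "submodule C R M"
  shows "submodule (f ` C) R N"
proof -
  interpret M: module R M by fact
  interpret N: module R N by fact
  note C = M.submoduleE[OF assms(4)]
  have z: "\<zero>\<^bsub>M\<^esub> \<in> C"
    using assms(4) by (auto intro: submodule_zero)
  show ?thesis
  proof (rule N.submoduleI)
    show "f ` C \<subseteq> carrier N" using C(1) linear_mapD(1)[OF assms(3)] by auto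
    show "\<zero>\<^bsub>N\<^esub> \<in> f ` C" using z linear_map_zero[OF assms(1-3)] by (metis imageI)
    show "\<ominus>\<^bsub>N\<^esub> a \<in> f ` C" if "a \<in> f ` C" for a
      using that C(1,3) linear_map_uminus[OF assms(1-3)] by (auto simp: image_iff) (metis subsetD)
    show "a \<oplus>\<^bsub>N\<^esub> b \<in> f ` C" if ab: "a \<in> f ` C" "b \<in> f ` C" for a b
    proof -
      obtain u v where "a = f u" "b = f v" "u \<in> C" "v \<in> C" using ab by auto
      then have "a \<oplus>\<^bsub>N\<^esub> b = f (u \<oplus>\<^bsub>M\<^esub> v)" "u \<oplus>\<^bsub>M\<^esub> v \<in> C"
        using C(1,5) linear_mapD(2)[OF assms(3), of u v] by (auto simp: subset_iff)
      then show ?thesis by auto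
    qed
    show "a \<odot>\<^bsub>N\<^esub> x \<in> f ` C" if ax: "a \<in> carrier R" "x \<in> f ` C" for a x
    proof -
      obtain u where "x = f u" "u \<in> C" using ax by auto
      then have "a \<odot>\<^bsub>N\<^esub> x = f (a \<odot>\<^bsub>M\<^esub> u)" "a \<odot>\<^bsub>M\<^esub> u \<in> C"
        using ax C(1,4) linear_mapD(3)[OF assms(3), of a u] by (auto simp: subset_iff)
      then show ?thesis by auto
    qed
  qed
qed

lemma submodule_equalizer:
  assumes "module R M" "module R N" "linear_map R M N f" "linear_map R M N g"
  shows "submodule {x \<in> carrier M. f x = g x} R M"
proof -
  interpret M: module R M by fact
  note f = linear_mapD[OF assms(3)] linear_map_zero[OF assms(1,2,3)] linear_map_uminus[OF assms(1,2,3)]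
  note g = linear_mapD[OF assms(4)] linear_map_zero[OF assms(1,2,4)] linear_map_uminus[OF assms(1,2,4)]
  show ?thesis
  proof (rule M.submoduleI)
    show "\<ominus>\<^bsub>M\<^esub> a \<in> {x \<in> carrier M. f x = g x}" if "a \<in> {x \<in> carrier M. f x = g x}" for a
      using that f(5)[of a] g(5)[of a] by simp
    show "a \<oplus>\<^bsub>M\<^esub> b \<in> {x \<in> carrier M. f x = g x}"
      if "a \<in> {x \<in> carrier M. f x = g x}" "b \<in> {x \<in> carrier M. f x = g x}" for a b
      using that f(2)[of a b] g(2)[of a b] by simp
    show "a \<odot>\<^bsub>M\<^esub> x \<in> {x \<in> carrier M. f x = g x}"
      if "a \<in> carrier R" "x \<in> {x \<in> carrier M. f x = g x}" for a x
      using that f(3)[of a x] g(3)[of a x] by simp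
  qed (auto simp: f(4) g(4))
qed

lemma linear_map_eq_on_lspan:
  assumes "module R M" "module R N" "linear_map R M N f" "linear_map R M N g"
    and "B \<subseteq> carrier M" "\<And>x. x \<in> B \<Longrightarrow> f x = g x" "x \<in> lspan R M B"
  shows "f x = g x"
  using lspan_minimal[OF submodule_equalizer[OF assms(1-4)], of B] assms(5-7) by auto


subsection \<open>Quotients\<close>

locale quotient_module = module R M + submodule N R M for R and M (structure) and N
begin

lemma additive: "abelian_subgroup N M"
  by (rule abelian_subgroupI3[OF additive_subgroupI[OF subgroup_axioms] M.abelian_group_axioms])

sublocale N: abelian_subgroup N M
  by (rule additive)

lemma quotient_carrier: "carrier (quotient M N) = (\<lambda>x. N +>\<^bsub>M\<^esub> x) ` carrier M"
  by (auto simp: quotient_def FactRing_def A_RCOSETS_def')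

lemma quotient_zero: "\<zero>\<^bsub>quotient M N\<^esub> = N"
  by (simp add: quotient_def FactRing_def)

lemma quotient_add:
  "x \<in> carrier M \<Longrightarrow> y \<in> carrier M \<Longrightarrow>
    (N +>\<^bsub>M\<^esub> x) \<oplus>\<^bsub>quotient M N\<^esub> (N +>\<^bsub>M\<^esub> y) = N +>\<^bsub>M\<^esub> (x \<oplus>\<^bsub>M\<^esub> y)"
  by (simp add: quotient_def FactRing_def N.a_rcos_sum)

lemma coset_eq_iff:
  assumes "x \<in> carrier M" "y \<in> carrier M"
  shows "N +>\<^bsub>M\<^esub> x = N +>\<^bsub>M\<^esub> y \<longleftrightarrow> x \<ominus>\<^bsub>M\<^esub> y \<in> N"
proof -
  have "N +>\<^bsub>M\<^esub> x = N +>\<^bsub>M\<^esub> y \<longleftrightarrow> x \<in> N +>\<^bsub>M\<^esub> y"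
    using N.a_repr_independence' N.a_repr_independenceD assms by metis
  then show ?thesis
    using N.a_rcos_module[of y x] assms by (simp add: a_minus_def)
qed

lemma coset_eq_zero_iff:
  assumes "x \<in> carrier M"
  shows "N +>\<^bsub>M\<^esub> x = N \<longleftrightarrow> x \<in> N"
  using N.a_rcos_const N.a_rcos_self[OF assms] by auto

text \<open>Scalar multiplication in \<open>quotient\<close> is a union over all representatives.
  Two representatives differ by an element of \<open>N\<close>, and \<open>N\<close> is stable under
  scalars, so the union is over copies of a single coset.\<close>

lemma quotient_smult:
  assumes "a \<in> carrier R" "x \<in> carrier M"
  shows "a \<odot>\<^bsub>quotient M N\<^esub> (N +>\<^bsub>M\<^esub> x) = N +>\<^bsub>M\<^esub> (a \<odot>\<^bsub>M\<^esub> x)"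
proof -
  have "N +>\<^bsub>M\<^esub> (a \<odot>\<^bsub>M\<^esub> y) = N +>\<^bsub>M\<^esub> (a \<odot>\<^bsub>M\<^esub> x)" if "y \<in> N +>\<^bsub>M\<^esub> x" for y
  proof -
    have y: "y \<in> carrier M" "y \<ominus>\<^bsub>M\<^esub> x \<in> N"
      using N.a_elemrcos_carrier[OF assms(2) that] N.a_rcos_module_imp[OF assms(2) that]
      by (auto simp: a_minus_def)
    then have "a \<odot>\<^bsub>M\<^esub> y \<ominus>\<^bsub>M\<^esub> a \<odot>\<^bsub>M\<^esub> x = a \<odot>\<^bsub>M\<^esub> (y \<ominus>\<^bsub>M\<^esub> x)"
      using assms by (simp add: a_minus_def smult_r_distr smult_r_minus)
    then show ?thesis using y assms by (subst coset_eq_iff) auto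
  qed
  \<comment> \<open>The union is not empty; otherwise equality of its members would not determine
    it.\<close>
  moreover have "x \<in> N +>\<^bsub>M\<^esub> x" by (rule N.a_rcos_self[OF assms(2)])
  ultimately have "(\<Union>y\<in>N +>\<^bsub>M\<^esub> x. N +>\<^bsub>M\<^esub> (a \<odot>\<^bsub>M\<^esub> y)) = N +>\<^bsub>M\<^esub> (a \<odot>\<^bsub>M\<^esub> x)"
    by blast
  then show ?thesis by (simp add: quotient_def)
qed

lemma coset_zero: "N +>\<^bsub>M\<^esub> \<zero>\<^bsub>M\<^esub> = N"
  using coset_eq_zero_iff[of "\<zero>\<^bsub>M\<^esub>"] one_closed by simp

lemma quotient_module: "module R (quotient M N)"
  by (rule module_image[where f = "\<lambda>x. N +>\<^bsub>M\<^esub> x", OF module_axioms carrier_is_submodule])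
    (auto simp: quotient_carrier quotient_zero quotient_add quotient_smult coset_zero)

lemma coset_linear: "linear_map R M (quotient M N) (\<lambda>x. N +>\<^bsub>M\<^esub> x)"
  by (rule linear_mapI) (auto simp: quotient_carrier quotient_add quotient_smult)

end

text \<open>A scalar \<open>a\<close> acts as left multiplication by the algebra element
  \<open>a\<close> times \<open>1\<close>, which an ideal absorbs.\<close>

lemma (in assoc_algebra) ideal_submodule:
  assumes "ideal I A"
  shows "submodule I R A"
proof -
  interpret I: ideal I A by fact
  have "a \<odot>\<^bsub>A\<^esub> x \<in> I" if "a \<in> carrier R" "x \<in> I" for a x
  proof -
    have "a \<odot>\<^bsub>A\<^esub> x = (a \<odot>\<^bsub>A\<^esub> \<one>\<^bsub>A\<^esub>) \<otimes>\<^bsub>A\<^esub> x"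
      using that smult_mult_left[of a "\<one>\<^bsub>A\<^esub>" x] by simp
    then show ?thesis using I.I_l_closed that by auto
  qed
  then show ?thesis
    by (intro submodule.intro I.a_subgroup) (simp add: submodule_axioms_def)
qed

locale quotient_algebra = assoc_algebra R A + ideal I A for R and A (structure) and I
begin

sublocale quotient_module R A I
  by (intro quotient_module.intro module_axioms ideal_submodule is_ideal)

lemma quotient_one: "\<one>\<^bsub>quotient A I\<^esub> = I +>\<^bsub>A\<^esub> \<one>\<^bsub>A\<^esub>"
  by (simp add: quotient_def FactRing_def)

lemma quotient_mult:
  "x \<in> carrier A \<Longrightarrow> y \<in> carrier A \<Longrightarrow>
    (I +>\<^bsub>A\<^esub> x) \<otimes>\<^bsub>quotient A I\<^esub> (I +>\<^bsub>A\<^esub> y) = I +>\<^bsub>A\<^esub> (x \<otimes>\<^bsub>A\<^esub> y)"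
  by (simp add: quotient_def FactRing_def rcoset_mult_add)

lemma quotient_assoc_algebra: "assoc_algebra R (quotient A I)"
  by (rule assoc_algebra_image[where f = "\<lambda>x. I +>\<^bsub>A\<^esub> x", OF assoc_algebra_axioms carrier_is_submodule])
    (auto simp: quotient_carrier quotient_zero quotient_add quotient_smult quotient_one
      quotient_mult coset_zero)

lemma coset_algebra_hom: "algebra_hom R A (quotient A I) (\<lambda>x. I +>\<^bsub>A\<^esub> x)"
  by (auto simp: algebra_hom_def assoc_algebra_axioms quotient_assoc_algebra coset_linear
      ring_hom_def quotient_carrier quotient_add quotient_mult quotient_one)

lemma quotient_lift:
  assumes hom: "algebra_hom R A B h" and ker: "\<And>x. x \<in> I \<Longrightarrow> h x = \<zero>\<^bsub>B\<^esub>"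
  obtains h' where "algebra_hom R (quotient A I) B h'"
    "\<And>x. x \<in> carrier A \<Longrightarrow> h' (I +>\<^bsub>A\<^esub> x) = h x"
proof -
  \<comment> \<open>An arbitrary representative is chosen; two of them differ by an element of
    \<open>I\<close>, on which \<open>h\<close> vanishes.\<close>
  define h' where "h' Y = h (SOME x. x \<in> carrier A \<and> Y = I +>\<^bsub>A\<^esub> x)" for Y
  interpret B: assoc_algebra R B using hom by (simp add: algebra_hom_def)
  have lin: "linear_map R A B h" and rh: "h \<in> ring_hom A B" using hom by (auto simp: algebra_hom_def)
  have h': "h' (I +>\<^bsub>A\<^esub> x) = h x" if x: "x \<in> carrier A" for x
  proof -
    let ?y = "SOME y. y \<in> carrier A \<and> I +>\<^bsub>A\<^esub> x = I +>\<^bsub>A\<^esub> y"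
    have y: "?y \<in> carrier A \<and> I +>\<^bsub>A\<^esub> x = I +>\<^bsub>A\<^esub> ?y"
      by (rule someI[of _ x]) (use x in auto)
    then have "x \<ominus>\<^bsub>A\<^esub> ?y \<in> I" using coset_eq_iff x by blast
    then have "h x \<ominus>\<^bsub>B\<^esub> h ?y = \<zero>\<^bsub>B\<^esub>"
      using ker linear_map_minus[OF module_axioms B.module_axioms lin, of x ?y] x y by metis
    then have "h x = h ?y" using x y linear_mapD(1)[OF lin] by simp
    then show ?thesis by (simp add: h'_def)
  qed
  have "algebra_hom R (quotient A I) B h'"
    unfolding algebra_hom_def
  proof (intro conjI)
    show "h' \<in> ring_hom (quotient A I) B"
      using rh by (auto simp: ring_hom_def quotient_carrier quotient_add quotient_mult quotient_one h')
    show "linear_map R (quotient A I) B h'"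
      using lin by (auto simp: linear_map_def quotient_carrier quotient_add quotient_smult h' Pi_def)
  qed (use quotient_assoc_algebra B.assoc_algebra_axioms in auto)
  then show thesis using h' that by blast
qed

end


text \<open>For one factor fixed, both sides of the product rule are linear in the other. The rule
  is therefore extended from the spanning set first in the right factor, with the left one still in
  \<open>W\<close>, and then in the left factor.\<close>

lemma algebra_hom_multI:
  assumes "assoc_algebra R A" "assoc_algebra R B" "linear_map R A B h"
    and one: "h \<one>\<^bsub>A\<^esub> = \<one>\<^bsub>B\<^esub>"
    and W: "W \<subseteq> carrier A" "carrier A = lspan R A W"
    and mult: "\<And>x y. x \<in> W \<Longrightarrow> y \<in> W \<Longrightarrow> h (x \<otimes>\<^bsub>A\<^esub> y) = h x \<otimes>\<^bsub>B\<^esub> h y"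
  shows "algebra_hom R A B h"
proof -
  interpret A: assoc_algebra R A by fact
  interpret B: assoc_algebra R B by fact
  note h = linear_mapD[OF assms(3)]
  have left: "linear_map R A B (\<lambda>x. h (x \<otimes>\<^bsub>A\<^esub> y))" "linear_map R A B (\<lambda>x. h x \<otimes>\<^bsub>B\<^esub> h y)"
    if "y \<in> carrier A" for y
    using that
    by (auto intro!: linear_mapI simp: h A.A.l_distr B.A.l_distr A.smult_mult_left B.smult_mult_left)
  have right: "linear_map R A B (\<lambda>y. h (x \<otimes>\<^bsub>A\<^esub> y))" "linear_map R A B (\<lambda>y. h x \<otimes>\<^bsub>B\<^esub> h y)"
    if "x \<in> carrier A" for x
    using that
    by (auto intro!: linear_mapI simp: h A.A.r_distr B.A.r_distr A.smult_mult_right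
        B.smult_mult_right)
  note eq = linear_map_eq_on_lspan[OF A.module_axioms B.module_axioms]
  have base: "h (x \<otimes>\<^bsub>A\<^esub> y) = h x \<otimes>\<^bsub>B\<^esub> h y" if "x \<in> W" "y \<in> carrier A" for x y
  proof (rule eq[OF right W(1)])
    show "y \<in> lspan R A W" using that(2) W(2) by simp
  qed (use that W mult in auto)
  have "h (x \<otimes>\<^bsub>A\<^esub> y) = h x \<otimes>\<^bsub>B\<^esub> h y" if "x \<in> carrier A" "y \<in> carrier A" for x y
  proof (rule eq[OF left W(1)])
    show "x \<in> lspan R A W" using that(1) W(2) by simp
  qed (use that base in auto)
  then show ?thesis
    using assms(1-3) one h by (auto simp: algebra_hom_def ring_hom_def)
qed

lemma algebra_hom_comp:
  assumes "algebra_hom R A B f" "algebra_hom R B C g"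
  shows "algebra_hom R A C (g \<circ> f)"
  using assms linear_map_comp[of R A B f C g] by (auto simp: algebra_hom_def ring_hom_def Pi_def)

lemma algebra_hom_cong:
  assumes "algebra_hom R A B f" "\<And>x. x \<in> carrier A \<Longrightarrow> g x = f x"
  shows "algebra_hom R A B g"
proof -
  interpret A: assoc_algebra R A using assms(1) by (simp add: algebra_hom_def)
  show ?thesis
    using assms by (auto simp: algebra_hom_def ring_hom_def linear_map_def Pi_def)
qed

lemma algebra_hom_kernel:
  assumes "algebra_hom R A B h"
  shows "ideal {x \<in> carrier A. h x = \<zero>\<^bsub>B\<^esub>} A"
proof -
  interpret A: assoc_algebra R A using assms by (simp add: algebra_hom_def)
  interpret B: assoc_algebra R B using assms by (simp add: algebra_hom_def)
  have "ring_hom_ring A B h"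
    using assms
    by (intro ring_hom_ringI2) (auto simp: algebra_hom_def A.A.ring_axioms B.A.ring_axioms)
  then show ?thesis using ring_hom_ring.kernel_is_ideal[of A B h] by (simp add: a_kernel_def')
qed

text \<open>The value that a multiplicative unital extension of \<open>g\<close> must take at a
  word. It describes morphisms out of the free algebra, and \<open>tensor_prod\<close> is the
  instance with \<open>g\<close> the inclusion of the module.\<close>

definition word_prod :: "('a, 'm) ring_scheme \<Rightarrow> ('x \<Rightarrow> 'a) \<Rightarrow> 'x list \<Rightarrow> 'a"
  where "word_prod A g xs = foldr (\<lambda>x t. g x \<otimes>\<^bsub>A\<^esub> t) xs \<one>\<^bsub>A\<^esub>"

lemma word_prod_simps [simp]:
  "word_prod A g [] = \<one>\<^bsub>A\<^esub>" "word_prod A g (x # xs) = g x \<otimes>\<^bsub>A\<^esub> word_prod A g xs"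
  by (simp_all add: word_prod_def)

lemma (in ring) word_prod_closed:
  "(\<And>x. x \<in> set xs \<Longrightarrow> g x \<in> carrier R) \<Longrightarrow> word_prod R g xs \<in> carrier R"
  by (induction xs) auto

lemma (in ring) word_prod_append:
  "(\<And>x. x \<in> set xs \<union> set ys \<Longrightarrow> g x \<in> carrier R) \<Longrightarrow>
    word_prod R g (xs @ ys) = word_prod R g xs \<otimes> word_prod R g ys"
  by (induction xs) (auto simp: m_assoc word_prod_closed)


section \<open>Series indexed by words\<close>

text \<open>With a one-letter alphabet (type \<open>unit\<close>) these are the power series over \<open>A\<close>, and with
  \<open>A = R\<close> they contain the free algebra.\<close>

definition word_series :: "('k, 'a, 'm) module_scheme \<Rightarrow> ('k, 'x list \<Rightarrow> 'a) module"
  where "word_series A =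
    \<lparr>carrier = {f. \<forall>w. f w \<in> carrier A},
     monoid.mult = (\<lambda>f g w. \<Oplus>\<^bsub>A\<^esub>i\<in>{..length w}. f (take i w) \<otimes>\<^bsub>A\<^esub> g (drop i w)),
     monoid.one = (\<lambda>w. if w = [] then \<one>\<^bsub>A\<^esub> else \<zero>\<^bsub>A\<^esub>),
     ring.zero = (\<lambda>w. \<zero>\<^bsub>A\<^esub>),
     ring.add = (\<lambda>f g w. f w \<oplus>\<^bsub>A\<^esub> g w),
     smult = (\<lambda>a f w. a \<odot>\<^bsub>A\<^esub> f w)\<rparr>"

text \<open>Both sides run over the pairs \<open>j \<le> i \<le> n\<close>, with
  \<open>i = j + l\<close> on the right. In the associativity of convolution, \<open>i\<close> and
  \<open>j\<close> are the two places where a word is cut.\<close>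

lemma (in abelian_monoid) finsum_triangle:
  fixes n :: nat
  assumes "\<And>i j. F i j \<in> carrier G"
  shows "(\<Oplus>i\<in>{..n}. \<Oplus>j\<in>{..i}. F i j) = (\<Oplus>j\<in>{..n}. \<Oplus>l\<in>{..n - j}. F (j + l) j)"
proof (induction n)
  case 0
  show ?case using assms by simp
next
  case (Suc n)
  \<comment> \<open>Raising \<open>n\<close> by one lengthens each inner sum by the term with
    \<open>l = Suc n - j\<close>, which is \<open>F (Suc n) j\<close>: the new row of the
    triangle.\<close>
  have "(\<Oplus>j\<in>{..n}. \<Oplus>l\<in>{..Suc n - j}. F (j + l) j) =
      (\<Oplus>j\<in>{..n}. (\<Oplus>l\<in>{..n - j}. F (j + l) j) \<oplus> F (Suc n) j)"
    by (rule finsum_cong') (auto simp: assms Suc_diff_le a_comm Pi_def)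
  also have "\<dots> = (\<Oplus>j\<in>{..n}. \<Oplus>l\<in>{..n - j}. F (j + l) j) \<oplus> (\<Oplus>j\<in>{..n}. F (Suc n) j)"
    by (rule finsum_addf) (auto simp: assms)
  finally have 1: "(\<Oplus>j\<in>{..n}. \<Oplus>l\<in>{..Suc n - j}. F (j + l) j) =
      (\<Oplus>j\<in>{..n}. \<Oplus>l\<in>{..n - j}. F (j + l) j) \<oplus> (\<Oplus>j\<in>{..n}. F (Suc n) j)" .
  have "(\<Oplus>j\<in>{..Suc n}. \<Oplus>l\<in>{..Suc n - j}. F (j + l) j) =
      F (Suc n) (Suc n) \<oplus> (\<Oplus>j\<in>{..n}. \<Oplus>l\<in>{..Suc n - j}. F (j + l) j)"
    by (subst finsum_Suc) (auto simp: assms)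
  also have "\<dots> = (F (Suc n) (Suc n) \<oplus> (\<Oplus>j\<in>{..n}. F (Suc n) j)) \<oplus>
      (\<Oplus>j\<in>{..n}. \<Oplus>l\<in>{..n - j}. F (j + l) j)"
    unfolding 1 by (subst a_assoc) (auto simp: assms a_comm)
  also have "\<dots> = (\<Oplus>j\<in>{..Suc n}. F (Suc n) j) \<oplus> (\<Oplus>i\<in>{..n}. \<Oplus>j\<in>{..i}. F i j)"
    unfolding Suc by (subst finsum_Suc) (auto simp: assms)
  also have "\<dots> = (\<Oplus>i\<in>{..Suc n}. \<Oplus>j\<in>{..i}. F i j)"
    by (subst (2) finsum_Suc) (auto simp: assms)
  finally show ?case by simp
qed

lemma (in abelian_monoid) finsum_single:
  assumes "i \<in> A" "finite A" "f i \<in> carrier G" "\<And>j. j \<in> A \<Longrightarrow> j \<noteq> i \<Longrightarrow> f j = \<zero>"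
  shows "finsum G f A = f i"
proof -
  have "finsum G f A = (\<Oplus>j\<in>A. if i = j then f j else \<zero>)"
    using assms by (intro finsum_cong') auto
  also have "\<dots> = f i"
    using assms(1-3) by (subst add.finprod_mono_neutral_cong_right[of A "{i}" _ f]) auto
  finally show ?thesis .
qed

lemma word_series_closed:
  assumes "ring A" "f \<in> carrier (word_series A)" "g \<in> carrier (word_series A)"
  shows "f \<otimes>\<^bsub>word_series A\<^esub> g \<in> carrier (word_series A)"
proof -
  interpret ring A by fact
  show ?thesis using assms(2,3) by (auto simp: word_series_def intro!: finsum_closed)
qed

lemma word_series_assoc:
  assumes "ring A" "f \<in> carrier (word_series A)" "g \<in> carrier (word_series A)"
    "h \<in> carrier (word_series A)"
  shows "(f \<otimes>\<^bsub>word_series A\<^esub> g) \<otimes>\<^bsub>word_series A\<^esub> h = f \<otimes>\<^bsub>word_series A\<^esub> (g \<otimes>\<^bsub>word_series A\<^esub> h)"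
proof
  fix w
  interpret A: ring A by fact
  have c: "f u \<in> carrier A" "g u \<in> carrier A" "h u \<in> carrier A" for u
    using assms(2-4) by (auto simp: word_series_def)
  \<comment> \<open>The contribution of cutting \<open>w\<close> at positions
    \<open>j \<le> i\<close> into three pieces. Left bracketing cuts at \<open>i\<close> and then
    cuts the prefix; right bracketing cuts at \<open>j\<close> and then cuts the suffix at
    \<open>l = i - j\<close>.\<close>
  let ?F = "\<lambda>i j. f (take j w) \<otimes>\<^bsub>A\<^esub> g (take (i - j) (drop j w)) \<otimes>\<^bsub>A\<^esub> h (drop i w)"
  have "((f \<otimes>\<^bsub>word_series A\<^esub> g) \<otimes>\<^bsub>word_series A\<^esub> h) w =
      (\<Oplus>\<^bsub>A\<^esub>i\<in>{..length w}. (\<Oplus>\<^bsub>A\<^esub>j\<in>{..i}. f (take j w) \<otimes>\<^bsub>A\<^esub> g (take (i - j) (drop j w))) \<otimes>\<^bsub>A\<^esub> h (drop i w))"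
    unfolding word_series_def
    by (auto intro!: A.finsum_cong' A.finsum_closed A.m_closed arg_cong2[of _ _ _ _ "monoid.mult A"]
        simp: c min_def drop_take)
  also have "\<dots> = (\<Oplus>\<^bsub>A\<^esub>i\<in>{..length w}. \<Oplus>\<^bsub>A\<^esub>j\<in>{..i}. ?F i j)"
    by (intro A.finsum_cong' A.finsum_ldistr) (auto simp: c intro!: A.finsum_closed)
  also have "\<dots> = (\<Oplus>\<^bsub>A\<^esub>j\<in>{..length w}. \<Oplus>\<^bsub>A\<^esub>l\<in>{..length w - j}. ?F (j + l) j)"
    by (rule A.finsum_triangle) (simp add: c)
  also have "\<dots> = (\<Oplus>\<^bsub>A\<^esub>j\<in>{..length w}. \<Oplus>\<^bsub>A\<^esub>l\<in>{..length w - j}.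
      f (take j w) \<otimes>\<^bsub>A\<^esub> (g (take l (drop j w)) \<otimes>\<^bsub>A\<^esub> h (drop l (drop j w))))"
    by (intro A.finsum_cong') (auto simp: c A.m_assoc add.commute intro!: A.finsum_closed)
  also have "\<dots> = (\<Oplus>\<^bsub>A\<^esub>j\<in>{..length w}. f (take j w) \<otimes>\<^bsub>A\<^esub>
      (\<Oplus>\<^bsub>A\<^esub>l\<in>{..length w - j}. g (take l (drop j w)) \<otimes>\<^bsub>A\<^esub> h (drop l (drop j w))))"
    by (intro A.finsum_cong' A.finsum_rdistr[symmetric]) (auto simp: c intro!: A.finsum_closed)
  also have "\<dots> = (f \<otimes>\<^bsub>word_series A\<^esub> (g \<otimes>\<^bsub>word_series A\<^esub> h)) w"
    by (simp add: word_series_def)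
  finally show "((f \<otimes>\<^bsub>word_series A\<^esub> g) \<otimes>\<^bsub>word_series A\<^esub> h) w =
      (f \<otimes>\<^bsub>word_series A\<^esub> (g \<otimes>\<^bsub>word_series A\<^esub> h)) w" .
qed

lemma word_series_assoc_algebra:
  fixes A :: "('k, 'a, 'm) module_scheme"
  assumes "assoc_algebra R A"
  shows "assoc_algebra R (word_series A :: ('k, 'x list \<Rightarrow> 'a) module)"
proof -
  interpret A: assoc_algebra R A by fact
  let ?W = "word_series A :: ('k, 'x list \<Rightarrow> 'a) module"
  have simps: "carrier ?W = {f. \<forall>w. f w \<in> carrier A}"
    "\<And>f g. f \<oplus>\<^bsub>?W\<^esub> g = (\<lambda>w. f w \<oplus>\<^bsub>A\<^esub> g w)" "\<zero>\<^bsub>?W\<^esub> = (\<lambda>w. \<zero>\<^bsub>A\<^esub>)"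
    "\<And>a f. a \<odot>\<^bsub>?W\<^esub> f = (\<lambda>w. a \<odot>\<^bsub>A\<^esub> f w)"
    "\<And>f g. f \<otimes>\<^bsub>?W\<^esub> g = (\<lambda>w. \<Oplus>\<^bsub>A\<^esub>i\<in>{..length w}. f (take i w) \<otimes>\<^bsub>A\<^esub> g (drop i w))"
    by (simp_all add: word_series_def)
  have ab: "abelian_group ?W"
  proof (rule abelian_groupI)
    fix f assume f: "f \<in> carrier ?W"
    have "(\<lambda>w. \<ominus>\<^bsub>A\<^esub> f w) \<oplus>\<^bsub>?W\<^esub> f = \<zero>\<^bsub>?W\<^esub>"
      using f by (auto simp: simps A.M.l_neg)
    moreover have "(\<lambda>w. \<ominus>\<^bsub>A\<^esub> f w) \<in> carrier ?W" using f by (auto simp: simps)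
    ultimately show "\<exists>g\<in>carrier ?W. g \<oplus>\<^bsub>?W\<^esub> f = \<zero>\<^bsub>?W\<^esub>" by blast
  qed (auto simp: simps A.M.a_ac)
  have "module R ?W"
    by (rule moduleI[OF A.R.is_cring ab])
      (auto simp: simps A.smult_l_distr A.smult_r_distr A.smult_assoc1)
  moreover have "ring ?W"
  proof (rule ringI[OF ab])
    show "Group.monoid ?W"
    proof (rule monoidI)
      show "\<one>\<^bsub>?W\<^esub> \<in> carrier ?W" by (simp add: word_series_def)
      fix f assume f: "f \<in> carrier ?W"
      \<comment> \<open>The unit is supported on the empty word, so only the cut at position
        \<open>0\<close> survives here, and only the cut at the end of \<open>w\<close> in the
        mirror statement.\<close>
      have "(\<one>\<^bsub>?W\<^esub> \<otimes>\<^bsub>?W\<^esub> f) w = f w" for w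
        unfolding word_series_def using f
        by (simp, subst A.M.finsum_single[of 0]) (auto simp: simps)
      then show "\<one>\<^bsub>?W\<^esub> \<otimes>\<^bsub>?W\<^esub> f = f" by auto
      have "(f \<otimes>\<^bsub>?W\<^esub> \<one>\<^bsub>?W\<^esub>) w = f w" for w
        unfolding word_series_def using f
        by (simp, subst A.M.finsum_single[of "length w"]) (auto simp: simps)
      then show "f \<otimes>\<^bsub>?W\<^esub> \<one>\<^bsub>?W\<^esub> = f" by auto
    qed (auto simp: word_series_closed word_series_assoc A.A.ring_axioms)
    fix f g h assume "f \<in> carrier ?W" "g \<in> carrier ?W" "h \<in> carrier ?W"
    then have c: "f w \<in> carrier A" "g w \<in> carrier A" "h w \<in> carrier A" for w
      by (auto simp: simps)
    show "(f \<oplus>\<^bsub>?W\<^esub> g) \<otimes>\<^bsub>?W\<^esub> h = f \<otimes>\<^bsub>?W\<^esub> h \<oplus>\<^bsub>?W\<^esub> g \<otimes>\<^bsub>?W\<^esub> h"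
      "h \<otimes>\<^bsub>?W\<^esub> (f \<oplus>\<^bsub>?W\<^esub> g) = h \<otimes>\<^bsub>?W\<^esub> f \<oplus>\<^bsub>?W\<^esub> h \<otimes>\<^bsub>?W\<^esub> g"
      by (simp_all add: simps c A.A.l_distr A.A.r_distr A.M.finsum_addf Pi_def)
  qed
  moreover have "(a \<odot>\<^bsub>?W\<^esub> f) \<otimes>\<^bsub>?W\<^esub> g = a \<odot>\<^bsub>?W\<^esub> (f \<otimes>\<^bsub>?W\<^esub> g)"
    "f \<otimes>\<^bsub>?W\<^esub> (a \<odot>\<^bsub>?W\<^esub> g) = a \<odot>\<^bsub>?W\<^esub> (f \<otimes>\<^bsub>?W\<^esub> g)"
    if "a \<in> carrier R" "f \<in> carrier ?W" "g \<in> carrier ?W" for a f g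
    using that
    by (simp_all add: simps A.smult_mult_left A.smult_mult_right A.finsum_smult_ldistr Pi_def)
  ultimately show ?thesis
    by (simp add: assoc_algebra_def assoc_algebra_axioms_def)
qed


section \<open>The free algebra\<close>

text \<open>The ring \<open>R\<close> as an algebra over itself, packaged with a scalar
  multiplication so that it can serve as coefficient algebra of \<open>word_series\<close>.\<close>

definition regular_algebra :: "('k, 'r) ring_scheme \<Rightarrow> ('k, 'k) module"
  where "regular_algebra R =
    \<lparr>carrier = carrier R, monoid.mult = monoid.mult R, monoid.one = monoid.one R,
     ring.zero = ring.zero R, ring.add = ring.add R, smult = monoid.mult R\<rparr>"

lemma regular_algebra_simps [simp]:
  "carrier (regular_algebra R) = carrier R" "monoid.mult (regular_algebra R) = monoid.mult R"
  "\<one>\<^bsub>regular_algebra R\<^esub> = \<one>\<^bsub>R\<^esub>" "\<zero>\<^bsub>regular_algebra R\<^esub> = \<zero>\<^bsub>R\<^esub>"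
  "ring.add (regular_algebra R) = ring.add R" "smult (regular_algebra R) = monoid.mult R"
  by (simp_all add: regular_algebra_def)

lemma regular_algebra_finsum: "finsum (regular_algebra R) = finsum R"
  by (intro ext) (simp add: finsum_def finprod_def regular_algebra_def)

lemma (in cring) regular_assoc_algebra: "assoc_algebra R (regular_algebra R)"
proof -
  have ab: "abelian_group (regular_algebra R)"
    by (rule abelian_groupI) (auto simp: a_ac intro: bexI[of _ "\<ominus> x" for x] l_neg)
  have "ring (regular_algebra R)"
    by (rule ringI[OF ab])
      (auto intro!: monoidI simp: m_assoc l_distr r_distr)
  moreover have "module R (regular_algebra R)"
    by (rule moduleI[OF is_cring ab]) (auto simp: m_assoc l_distr r_distr)
  ultimately show ?thesis
    by (simp add: assoc_algebra_def assoc_algebra_axioms_def m_assoc m_lcomm)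
qed

definition monomial :: "('k, 'r) ring_scheme \<Rightarrow> 'x list \<Rightarrow> 'x list \<Rightarrow> 'k"
  where "monomial R w = (\<lambda>v. if v = w then \<one>\<^bsub>R\<^esub> else \<zero>\<^bsub>R\<^esub>)"

context cring
begin

lemma free_algebra_carrier:
  "f \<in> carrier (free_algebra R Y) \<longleftrightarrow>
    (\<forall>w. f w \<in> carrier R) \<and> finite {w. f w \<noteq> \<zero>} \<and> {w. f w \<noteq> \<zero>} \<subseteq> lists Y"
  by (simp add: free_algebra_def)

lemma free_algebra_ops:
  "f \<oplus>\<^bsub>free_algebra R Y\<^esub> g = (\<lambda>w. f w \<oplus> g w)" "\<zero>\<^bsub>free_algebra R Y\<^esub> = (\<lambda>w. \<zero>)"
  "a \<odot>\<^bsub>free_algebra R Y\<^esub> f = (\<lambda>w. a \<otimes> f w)" "\<one>\<^bsub>free_algebra R Y\<^esub> = monomial R []"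
  "f \<otimes>\<^bsub>free_algebra R Y\<^esub> g = (\<lambda>w. \<Oplus>i\<in>{..length w}. f (take i w) \<otimes> g (drop i w))"
  by (simp_all add: free_algebra_def monomial_def)

text \<open>The operations are those of the series with coefficients in \<open>R\<close>, where the
  algebra axioms are already known. It remains to see that finitely supported series on words in
  \<open>Y\<close> are closed under them.\<close>

lemma free_algebra_assoc_algebra: "assoc_algebra R (free_algebra R Y)"
proof -
  let ?A = "regular_algebra R" let ?F = "free_algebra R Y"
  interpret W: assoc_algebra R "word_series ?A :: ('a, 'c list \<Rightarrow> 'a) module"
    by (rule word_series_assoc_algebra[OF regular_assoc_algebra])
  have supp: "f \<in> carrier ?F"
    if "\<And>w. f w \<in> carrier R" "{w. f w \<noteq> \<zero>} \<subseteq> V" "finite V" "V \<subseteq> lists Y" for f V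
    using that finite_subset by (auto simp: free_algebra_carrier)
  have W: "carrier (word_series ?A) = {f. \<forall>w. f w \<in> carrier R}"
    "\<And>f g. f \<oplus>\<^bsub>word_series ?A\<^esub> g = f \<oplus>\<^bsub>?F\<^esub> g" "\<zero>\<^bsub>word_series ?A\<^esub> = \<zero>\<^bsub>?F\<^esub>"
    "\<And>a f. a \<odot>\<^bsub>word_series ?A\<^esub> f = a \<odot>\<^bsub>?F\<^esub> f"
    "\<And>f g. f \<otimes>\<^bsub>word_series ?A\<^esub> g = f \<otimes>\<^bsub>?F\<^esub> g"
    "\<one>\<^bsub>word_series ?A\<^esub> = \<one>\<^bsub>?F\<^esub>"
    by (simp_all add: word_series_def free_algebra_def regular_algebra_finsum fun_eq_iff)
  have add: "f \<oplus>\<^bsub>?F\<^esub> g \<in> carrier ?F" if "f \<in> carrier ?F" "g \<in> carrier ?F" for f g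
    using that by (intro supp[of _ "{w. f w \<noteq> \<zero>} \<union> {w. g w \<noteq> \<zero>}"])
      (auto simp: free_algebra_carrier free_algebra_ops)
  have smult: "a \<odot>\<^bsub>?F\<^esub> f \<in> carrier ?F" if "a \<in> carrier R" "f \<in> carrier ?F" for a f
    using that by (intro supp[of _ "{w. f w \<noteq> \<zero>}"]) (auto simp: free_algebra_carrier free_algebra_ops)
  show ?thesis
  proof (rule assoc_algebra_image[where f = "\<lambda>x. x", OF W.assoc_algebra_axioms])
    show "submodule (carrier ?F) R (word_series ?A)"
    proof (rule W.submoduleI)
      show "\<ominus>\<^bsub>word_series ?A\<^esub> f \<in> carrier ?F" if "f \<in> carrier ?F" for f
      proof -
        have "f \<in> carrier (word_series ?A)" using that by (auto simp: W free_algebra_carrier)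
        then have "\<ominus>\<^bsub>word_series ?A\<^esub> f = (\<ominus> \<one>) \<odot>\<^bsub>word_series ?A\<^esub> f"
          by (subst W.smult_l_minus) auto
        then show ?thesis using smult[OF _ that] by (simp add: W)
      qed
    qed (auto simp: W add smult, auto simp: free_algebra_carrier free_algebra_ops)
    show "f \<otimes>\<^bsub>word_series ?A\<^esub> g \<in> carrier ?F" if f: "f \<in> carrier ?F" and g: "g \<in> carrier ?F" for f g
      unfolding W
    \<comment> \<open>The support of a product consists of concatenations of a word from each
      support, which bounds it by a finite set of words in \<open>Y\<close>.\<close>
    proof (rule supp[of _ "(\<lambda>(u, v). u @ v) ` ({w. f w \<noteq> \<zero>} \<times> {w. g w \<noteq> \<zero>})"])
      have c: "f w \<in> carrier R" "g w \<in> carrier R" for w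
        using f g by (auto simp: free_algebra_carrier)
      show "(f \<otimes>\<^bsub>?F\<^esub> g) w \<in> carrier R" for w
        by (auto simp: free_algebra_ops c intro!: finsum_closed)
      show "{w. (f \<otimes>\<^bsub>?F\<^esub> g) w \<noteq> \<zero>} \<subseteq> (\<lambda>(u, v). u @ v) ` ({w. f w \<noteq> \<zero>} \<times> {w. g w \<noteq> \<zero>})"
      proof
        fix w assume "w \<in> {w. (f \<otimes>\<^bsub>?F\<^esub> g) w \<noteq> \<zero>}"
        then obtain i where "f (take i w) \<otimes> g (drop i w) \<noteq> \<zero>"
          using add.finprod_one_eqI[of "{..length w}" "\<lambda>i. f (take i w) \<otimes> g (drop i w)"]
          by (auto simp: free_algebra_ops)
        then have "f (take i w) \<noteq> \<zero>" "g (drop i w) \<noteq> \<zero>" using c by auto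
        then show "w \<in> (\<lambda>(u, v). u @ v) ` ({w. f w \<noteq> \<zero>} \<times> {w. g w \<noteq> \<zero>})"
          by (intro image_eqI[of _ _ "(take i w, drop i w)"]) auto
      qed
      have uv: "u @ v \<in> lists Y" if "f u \<noteq> \<zero>" "g v \<noteq> \<zero>" for u v
        using f g that by (simp only: append_in_lists_conv) (auto simp only: free_algebra_carrier)
      show "(\<lambda>(u, v). u @ v) ` ({w. f w \<noteq> \<zero>} \<times> {w. g w \<noteq> \<zero>}) \<subseteq> lists Y"
      proof (rule image_subsetI)
        fix p assume "p \<in> {w. f w \<noteq> \<zero>} \<times> {w. g w \<noteq> \<zero>}"
        then show "(case p of (u, v) \<Rightarrow> u @ v) \<in> lists Y"
          using uv[of "fst p" "snd p"] by (simp only: mem_Times_iff mem_Collect_eq case_prod_unfold simp_thms)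
      qed
      show "finite ((\<lambda>(u, v). u @ v) ` ({w. f w \<noteq> \<zero>} \<times> {w. g w \<noteq> \<zero>}))"
        using f g by (auto simp: free_algebra_carrier)
    qed
    show "\<one>\<^bsub>word_series ?A\<^esub> \<in> carrier ?F"
      unfolding W by (rule supp[of _ "{[]}"]) (auto simp: free_algebra_ops monomial_def)
  qed (auto simp: W)
qed

lemma monomial_closed: "w \<in> lists Y \<Longrightarrow> monomial R w \<in> carrier (free_algebra R Y)"
proof -
  have "{v. monomial R w v \<noteq> \<zero>} \<subseteq> {w}" by (auto simp: monomial_def)
  then show "w \<in> lists Y \<Longrightarrow> ?thesis"
    using finite_subset by (fastforce simp: free_algebra_carrier monomial_def)
qed

lemma monomial_mult: "monomial R u \<otimes>\<^bsub>free_algebra R Y\<^esub> monomial R v = monomial R (u @ v)"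
proof
  fix w
  have c: "monomial R x y \<in> carrier R" for x y :: "'c list" by (simp add: monomial_def)
  show "(monomial R u \<otimes>\<^bsub>free_algebra R Y\<^esub> monomial R v) w = monomial R (u @ v) w"
  proof (cases "w = u @ v")
    case True
    have "monomial R u (take i w) \<otimes> monomial R v (drop i w) = \<zero>" if "i \<le> length w" "i \<noteq> length u" for i
      using that c by (auto simp: monomial_def)
    then have "(monomial R u \<otimes>\<^bsub>free_algebra R Y\<^esub> monomial R v) w =
        monomial R u (take (length u) w) \<otimes> monomial R v (drop (length u) w)"
      unfolding free_algebra_ops using True c by (intro finsum_single) auto
    then show ?thesis using True by (simp add: monomial_def)
  next
    case False
    then have "monomial R u (take i w) \<otimes> monomial R v (drop i w) = \<zero>" for i
      using c by (auto simp: monomial_def)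
    then show ?thesis using False by (simp add: free_algebra_ops monomial_def)
  qed
qed

text \<open>Induction on the support: resetting the value of \<open>f\<close> at one word
  \<open>v\<close> to zero removes exactly the multiple \<open>f v\<close> of the monomial of
  \<open>v\<close>.\<close>

lemma free_algebra_span:
  "carrier (free_algebra R Y) = lspan R (free_algebra R Y) (monomial R ` lists Y)"
proof -
  let ?F = "free_algebra R Y"
  interpret F: assoc_algebra R ?F by (rule free_algebra_assoc_algebra)
  have mono: "monomial R ` lists Y \<subseteq> carrier ?F" by (intro image_subsetI monomial_closed)
  have sub: "submodule (lspan R ?F (monomial R ` lists Y)) R ?F"
    by (rule lspan_submodule[OF F.module_axioms mono])
  note subE = F.submoduleE[OF sub]
  have "f \<in> lspan R ?F (monomial R ` lists Y)"
    if "finite V" "{w. f w \<noteq> \<zero>} = V" "f \<in> carrier ?F" for f V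
    using that
  proof (induction V arbitrary: f rule: finite_induct)
    case empty
    then have "f = \<zero>\<^bsub>?F\<^esub>" by (auto simp: free_algebra_ops)
    then show ?case
      using sub by (auto intro: submodule_zero)
  next
    case (insert v V)
    have f: "f w \<in> carrier R" for w using insert.prems by (auto simp: free_algebra_carrier)
    have v: "v \<in> lists Y" using insert.prems by (auto simp: free_algebra_carrier)
    have supp: "{w. (f(v := \<zero>)) w \<noteq> \<zero>} = V" using insert by auto
    moreover have "f(v := \<zero>) \<in> carrier ?F"
      using insert supp f by (auto simp: free_algebra_carrier)
    ultimately have "f(v := \<zero>) \<in> lspan R ?F (monomial R ` lists Y)" by (rule insert.IH)
    moreover have "f v \<odot>\<^bsub>?F\<^esub> monomial R v \<in> lspan R ?F (monomial R ` lists Y)"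
      using v by (intro subE(4)[OF f] subsetD[OF lspan_superset]) (rule imageI)
    moreover have "f = f v \<odot>\<^bsub>?F\<^esub> monomial R v \<oplus>\<^bsub>?F\<^esub> f(v := \<zero>)"
      using f by (auto simp: free_algebra_ops monomial_def)
    ultimately show ?case using subE(5) by metis
  qed
  then show ?thesis using subE(1) by (auto simp: free_algebra_carrier)
qed

lemma free_algebra_lift:
  assumes A: "assoc_algebra R A" and g: "g \<in> Y \<rightarrow> carrier A"
  obtains h where "algebra_hom R (free_algebra R Y) A h"
    "\<And>w. w \<in> lists Y \<Longrightarrow> h (monomial R w) = word_prod A g w"
proof -
  let ?F = "free_algebra R Y"
  interpret A: assoc_algebra R A by fact
  interpret F: assoc_algebra R ?F by (rule free_algebra_assoc_algebra)
  have P: "word_prod A g w \<in> carrier A" if "w \<in> lists Y" for w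
    using that g by (intro A.A.word_prod_closed) auto
  define h where "h f = (\<Oplus>\<^bsub>A\<^esub>w\<in>{w. f w \<noteq> \<zero>}. f w \<odot>\<^bsub>A\<^esub> word_prod A g w)" for f
  have c: "f w \<odot>\<^bsub>A\<^esub> word_prod A g w \<in> carrier A" if "f \<in> carrier ?F" "w \<in> lists Y" for f w
    using that P by (auto simp: free_algebra_carrier)
  \<comment> \<open>The defining sum runs over the support, which varies with \<open>f\<close>.
    Additivity needs a common index set for two elements and their sum. That set must stay inside
    \<open>lists Y\<close>, because only there is \<open>word_prod\<close> known to lie in
    \<open>A\<close>.\<close>
  have h: "h f = (\<Oplus>\<^bsub>A\<^esub>w\<in>V. f w \<odot>\<^bsub>A\<^esub> word_prod A g w)"
    if "f \<in> carrier ?F" "finite V" "{w. f w \<noteq> \<zero>} \<subseteq> V" "V \<subseteq> lists Y" for f V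
    unfolding h_def
  proof (rule A.M.add.finprod_mono_neutral_cong_left)
    show "f w \<odot>\<^bsub>A\<^esub> word_prod A g w = \<zero>\<^bsub>A\<^esub>" if "w \<in> V - {w. f w \<noteq> \<zero>}" for w
    proof -
      have "w \<in> lists Y" "f w = \<zero>" using that \<open>V \<subseteq> lists Y\<close> by (blast, simp)
      then show ?thesis using P by simp
    qed
    show "(\<lambda>w. f w \<odot>\<^bsub>A\<^esub> word_prod A g w) \<in> V \<rightarrow> carrier A"
      using c[OF \<open>f \<in> carrier ?F\<close>] \<open>V \<subseteq> lists Y\<close> by blast
  qed (use that in auto)
  have cV: "(\<lambda>w. f w \<odot>\<^bsub>A\<^esub> word_prod A g w) \<in> V \<rightarrow> carrier A"
    if "f \<in> carrier ?F" "V \<subseteq> lists Y" for f V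
    using c[OF that(1)] that(2) by blast
  have fc: "f w \<in> carrier R" if "f \<in> carrier ?F" for f w
    using that by (simp add: free_algebra_carrier)
  have lin: "linear_map R ?F A h"
  proof (rule linear_mapI)
    fix f assume f: "f \<in> carrier ?F"
    then have Vf: "finite {w. f w \<noteq> \<zero>}" "{w. f w \<noteq> \<zero>} \<subseteq> lists Y"
      by (simp_all only: free_algebra_carrier)
    show "h f \<in> carrier A"
      unfolding h_def by (rule A.M.finsum_closed[OF cV[OF f Vf(2)]])
    show "h (a \<odot>\<^bsub>?F\<^esub> f) = a \<odot>\<^bsub>A\<^esub> h f" if a: "a \<in> carrier R" for a
    proof -
      have "h (a \<odot>\<^bsub>?F\<^esub> f) = (\<Oplus>\<^bsub>A\<^esub>w\<in>{w. f w \<noteq> \<zero>}. (a \<odot>\<^bsub>?F\<^esub> f) w \<odot>\<^bsub>A\<^esub> word_prod A g w)"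
        using a f by (intro h Vf F.smult_closed) (auto simp: free_algebra_ops)
      also have "\<dots> = (\<Oplus>\<^bsub>A\<^esub>w\<in>{w. f w \<noteq> \<zero>}. a \<odot>\<^bsub>A\<^esub> (f w \<odot>\<^bsub>A\<^esub> word_prod A g w))"
      proof (rule A.M.finsum_cong')
        show "(\<lambda>w. a \<odot>\<^bsub>A\<^esub> (f w \<odot>\<^bsub>A\<^esub> word_prod A g w)) \<in> {w. f w \<noteq> \<zero>} \<rightarrow> carrier A"
          using cV[OF f Vf(2)] a by blast
        show "(a \<odot>\<^bsub>?F\<^esub> f) w \<odot>\<^bsub>A\<^esub> word_prod A g w = a \<odot>\<^bsub>A\<^esub> (f w \<odot>\<^bsub>A\<^esub> word_prod A g w)"
          if "w \<in> {w. f w \<noteq> \<zero>}" for w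
          using P[OF subsetD[OF Vf(2) that]] a fc[OF f]
          by (simp add: free_algebra_ops A.smult_assoc1)
      qed simp
      also have "\<dots> = a \<odot>\<^bsub>A\<^esub> h f"
        unfolding h_def by (rule A.finsum_smult_ldistr[OF Vf(1) a cV[OF f Vf(2)], symmetric])
      finally show ?thesis .
    qed
    fix k assume k: "k \<in> carrier ?F"
    then have Vk: "finite {w. k w \<noteq> \<zero>}" "{w. k w \<noteq> \<zero>} \<subseteq> lists Y"
      by (simp_all only: free_algebra_carrier)
    define V where "V = {w. f w \<noteq> \<zero>} \<union> {w. k w \<noteq> \<zero>}"
    have V: "finite V" "V \<subseteq> lists Y" "{w. f w \<noteq> \<zero>} \<subseteq> V" "{w. k w \<noteq> \<zero>} \<subseteq> V"
      using Vf Vk by (simp_all only: V_def finite_Un Un_least Un_upper1 Un_upper2 simp_thms)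
    have "{w. (f \<oplus>\<^bsub>?F\<^esub> k) w \<noteq> \<zero>} \<subseteq> V"
      by (auto simp: V_def free_algebra_ops)
    then have "h (f \<oplus>\<^bsub>?F\<^esub> k) = (\<Oplus>\<^bsub>A\<^esub>w\<in>V. (f \<oplus>\<^bsub>?F\<^esub> k) w \<odot>\<^bsub>A\<^esub> word_prod A g w)"
      using f k V by (intro h) auto
    also have "\<dots> = (\<Oplus>\<^bsub>A\<^esub>w\<in>V. f w \<odot>\<^bsub>A\<^esub> word_prod A g w \<oplus>\<^bsub>A\<^esub> k w \<odot>\<^bsub>A\<^esub> word_prod A g w)"
    proof (rule A.M.finsum_cong')
      show "(\<lambda>w. f w \<odot>\<^bsub>A\<^esub> word_prod A g w \<oplus>\<^bsub>A\<^esub> k w \<odot>\<^bsub>A\<^esub> word_prod A g w) \<in> V \<rightarrow> carrier A"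
        using cV[OF f V(2)] cV[OF k V(2)] by blast
      show "(f \<oplus>\<^bsub>?F\<^esub> k) w \<odot>\<^bsub>A\<^esub> word_prod A g w =
          f w \<odot>\<^bsub>A\<^esub> word_prod A g w \<oplus>\<^bsub>A\<^esub> k w \<odot>\<^bsub>A\<^esub> word_prod A g w" if "w \<in> V" for w
        using P[OF subsetD[OF V(2) that]] fc[OF f] fc[OF k]
        by (simp add: free_algebra_ops A.smult_l_distr)
    qed simp
    also have "\<dots> = h f \<oplus>\<^bsub>A\<^esub> h k"
      using h[OF f V(1,3,2)] h[OF k V(1,4,2)] A.M.finsum_addf[OF cV[OF f V(2)] cV[OF k V(2)]]
      by simp
    finally show "h (f \<oplus>\<^bsub>?F\<^esub> k) = h f \<oplus>\<^bsub>A\<^esub> h k" .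
  qed
  have hm: "h (monomial R w) = word_prod A g w" if w: "w \<in> lists Y" for w
  proof -
    have "h (monomial R w) = (\<Oplus>\<^bsub>A\<^esub>v\<in>{w}. monomial R w v \<odot>\<^bsub>A\<^esub> word_prod A g v)"
      using w by (intro h monomial_closed) (auto simp: monomial_def)
    then show ?thesis using P[OF w] by (simp add: monomial_def)
  qed
  have "algebra_hom R ?F A h"
  \<comment> \<open>On monomials the product rule says that concatenation of words becomes
    multiplication of word products.\<close>
  proof (rule algebra_hom_multI[OF F.assoc_algebra_axioms A lin])
    show "h \<one>\<^bsub>?F\<^esub> = \<one>\<^bsub>A\<^esub>" using hm[of "[]"] by (simp add: free_algebra_ops)
    show "monomial R ` lists Y \<subseteq> carrier ?F" by (intro image_subsetI monomial_closed)
    show "h (x \<otimes>\<^bsub>?F\<^esub> y) = h x \<otimes>\<^bsub>A\<^esub> h y"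
      if xy: "x \<in> monomial R ` lists Y" "y \<in> monomial R ` lists Y" for x y
    proof -
      obtain u v where u: "x = monomial R u" "u \<in> lists Y" and v: "y = monomial R v" "v \<in> lists Y"
        using xy by blast
      have uv: "u @ v \<in> lists Y" using u v by simp
      have "word_prod A g (u @ v) = word_prod A g u \<otimes>\<^bsub>A\<^esub> word_prod A g v"
        using g u(2) v(2) by (intro A.A.word_prod_append) auto
      then show ?thesis by (simp only: monomial_mult hm u v uv)
    qed
  qed (rule free_algebra_span)
  then show thesis using hm that by blast
qed

end


section \<open>The tensor algebra\<close>

context module
begin

lemma free_gen_eq_monomial: "free_gen R x = monomial R [x]"
  by (simp add: free_gen_def monomial_def)

lemma free_gen_closed: "x \<in> carrier M \<Longrightarrow> free_gen R x \<in> carrier (free_algebra R (carrier M))"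
  unfolding free_gen_eq_monomial by (rule monomial_closed) simp

lemma linearity_ideal_algebra:
  "quotient_algebra R (free_algebra R (carrier M)) (linearity_ideal R M)"
proof -
  interpret F: assoc_algebra R "free_algebra R (carrier M)" by (rule free_algebra_assoc_algebra)
  have "ideal (linearity_ideal R M) (free_algebra R (carrier M))"
    unfolding linearity_ideal_def Let_def
    by (rule F.A.genideal_ideal) (auto simp: free_gen_closed)
  then show ?thesis by (simp add: quotient_algebra_def F.assoc_algebra_axioms)
qed

lemma tensor_algebra_assoc_algebra: "assoc_algebra R (tensor_algebra R M)"
  unfolding tensor_algebra_def
  by (rule quotient_algebra.quotient_assoc_algebra[OF linearity_ideal_algebra])

text \<open>The generators of the ideal are precisely the failures of \<open>free_gen\<close> to be
  linear, and they become zero in the quotient.\<close>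

lemma tensor_incl_linear: "linear_map R M (tensor_algebra R M) (tensor_incl R M)"
proof -
  let ?F = "free_algebra R (carrier M)" let ?J = "linearity_ideal R M"
  interpret Q: quotient_algebra R ?F ?J by (rule linearity_ideal_algebra)
  define D where "D = {free_gen R (x \<oplus>\<^bsub>M\<^esub> y) \<ominus>\<^bsub>?F\<^esub> (free_gen R x \<oplus>\<^bsub>?F\<^esub> free_gen R y) |
          x y. x \<in> carrier M \<and> y \<in> carrier M} \<union>
       {free_gen R (a \<odot>\<^bsub>M\<^esub> x) \<ominus>\<^bsub>?F\<^esub> a \<odot>\<^bsub>?F\<^esub> free_gen R x |
          a x. a \<in> carrier R \<and> x \<in> carrier M}"
  have "D \<subseteq> carrier ?F" by (auto simp: D_def free_gen_closed)
  then have J: "D \<subseteq> ?J"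
    unfolding linearity_ideal_def Let_def D_def by (rule Q.A.genideal_self)
  show ?thesis
    unfolding tensor_incl_def tensor_algebra_def
  proof (rule linear_mapI)
    fix x y assume x: "x \<in> carrier M" and y: "y \<in> carrier M"
    have "free_gen R (x \<oplus>\<^bsub>M\<^esub> y) \<ominus>\<^bsub>?F\<^esub> (free_gen R x \<oplus>\<^bsub>?F\<^esub> free_gen R y) \<in> ?J"
      using x y by (intro subsetD[OF J]) (auto simp: D_def)
    then have "?J +>\<^bsub>?F\<^esub> free_gen R (x \<oplus>\<^bsub>M\<^esub> y) = ?J +>\<^bsub>?F\<^esub> (free_gen R x \<oplus>\<^bsub>?F\<^esub> free_gen R y)"
      using x y by (subst Q.coset_eq_iff) (auto simp: free_gen_closed)
    then show "?J +>\<^bsub>?F\<^esub> free_gen R (x \<oplus>\<^bsub>M\<^esub> y) =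
        (?J +>\<^bsub>?F\<^esub> free_gen R x) \<oplus>\<^bsub>quotient ?F ?J\<^esub> (?J +>\<^bsub>?F\<^esub> free_gen R y)"
      using x y by (simp add: Q.quotient_add free_gen_closed)
  next
    fix a x assume a: "a \<in> carrier R" and x: "x \<in> carrier M"
    have "free_gen R (a \<odot>\<^bsub>M\<^esub> x) \<ominus>\<^bsub>?F\<^esub> a \<odot>\<^bsub>?F\<^esub> free_gen R x \<in> ?J"
      using a x by (intro subsetD[OF J]) (auto simp: D_def)
    then have "?J +>\<^bsub>?F\<^esub> free_gen R (a \<odot>\<^bsub>M\<^esub> x) = ?J +>\<^bsub>?F\<^esub> (a \<odot>\<^bsub>?F\<^esub> free_gen R x)"
      using a x by (subst Q.coset_eq_iff) (auto simp: free_gen_closed)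
    then show "?J +>\<^bsub>?F\<^esub> free_gen R (a \<odot>\<^bsub>M\<^esub> x) =
        a \<odot>\<^bsub>quotient ?F ?J\<^esub> (?J +>\<^bsub>?F\<^esub> free_gen R x)"
      using a x by (simp add: Q.quotient_smult free_gen_closed)
  qed (auto simp: Q.quotient_carrier free_gen_closed)
qed

lemma tensor_incl_closed:
  "x \<in> carrier M \<Longrightarrow> tensor_incl R M x \<in> carrier (tensor_algebra R M)"
  by (rule linear_mapD(1)[OF tensor_incl_linear])

lemma tensor_prod_eq_word_prod:
  "tensor_prod R M = word_prod (tensor_algebra R M) (tensor_incl R M)"
  by (simp add: tensor_prod_def word_prod_def fun_eq_iff)

lemma tensor_prod_simps [simp]:
  "tensor_prod R M [] = \<one>\<^bsub>tensor_algebra R M\<^esub>"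
  "tensor_prod R M (x # xs) = tensor_incl R M x \<otimes>\<^bsub>tensor_algebra R M\<^esub> tensor_prod R M xs"
  by (simp_all add: tensor_prod_eq_word_prod)

lemma tensor_prod_closed:
  assumes "xs \<in> lists (carrier M)"
  shows "tensor_prod R M xs \<in> carrier (tensor_algebra R M)"
proof -
  interpret T: assoc_algebra R "tensor_algebra R M" by (rule tensor_algebra_assoc_algebra)
  show ?thesis
    unfolding tensor_prod_eq_word_prod using assms tensor_incl_closed
    by (intro T.A.word_prod_closed) auto
qed

lemma tensor_prod_append:
  assumes "xs \<in> lists (carrier M)" "ys \<in> lists (carrier M)"
  shows "tensor_prod R M (xs @ ys) =
    tensor_prod R M xs \<otimes>\<^bsub>tensor_algebra R M\<^esub> tensor_prod R M ys"
proof -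
  interpret T: assoc_algebra R "tensor_algebra R M" by (rule tensor_algebra_assoc_algebra)
  show ?thesis
    unfolding tensor_prod_eq_word_prod using assms tensor_incl_closed
    by (intro T.A.word_prod_append) auto
qed

lemma tensor_prod_eq_coset:
  assumes "xs \<in> lists (carrier M)"
  shows "tensor_prod R M xs = linearity_ideal R M +>\<^bsub>free_algebra R (carrier M)\<^esub> monomial R xs"
proof -
  let ?F = "free_algebra R (carrier M)" let ?J = "linearity_ideal R M"
  interpret Q: quotient_algebra R ?F ?J by (rule linearity_ideal_algebra)
  show ?thesis using assms
  proof (induction xs rule: lists.induct)
    case Nil
    then show ?case
      by (simp add: tensor_algebra_def Q.quotient_one free_algebra_ops)
  next
    case (Cons x xs)
    have "[x] \<in> lists (carrier M)" using Cons by simp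
    then have "(?J +>\<^bsub>?F\<^esub> monomial R [x]) \<otimes>\<^bsub>quotient ?F ?J\<^esub> (?J +>\<^bsub>?F\<^esub> monomial R xs) =
        ?J +>\<^bsub>?F\<^esub> monomial R ([x] @ xs)"
      using Cons by (simp only: Q.quotient_mult monomial_closed monomial_mult)
    then show ?case
      using Cons by (simp add: tensor_algebra_def tensor_incl_def free_gen_eq_monomial)
  qed
qed

text \<open>The coset map is linear and onto, and it sends the monomial of a word to the
  corresponding \<open>tensor_prod\<close>; so it carries a spanning set of the free algebra to this
  one.\<close>

lemma tensor_algebra_span:
  "carrier (tensor_algebra R M) =
    lspan R (tensor_algebra R M) {tensor_prod R M xs | xs. xs \<in> lists (carrier M)}"
proof -
  let ?F = "free_algebra R (carrier M)" let ?J = "linearity_ideal R M" let ?T = "tensor_algebra R M"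
  interpret Q: quotient_algebra R ?F ?J by (rule linearity_ideal_algebra)
  interpret T: assoc_algebra R ?T by (rule tensor_algebra_assoc_algebra)
  let ?B = "{tensor_prod R M xs | xs. xs \<in> lists (carrier M)}"
  have B: "?B \<subseteq> carrier ?T" using tensor_prod_closed by blast
  have sub: "submodule (lspan R ?T ?B) R ?T" by (rule lspan_submodule[OF T.module_axioms B])
  have "(\<lambda>x. ?J +>\<^bsub>?F\<^esub> x) ` lspan R ?F (monomial R ` lists (carrier M)) \<subseteq> lspan R ?T ?B"
  proof (rule linear_map_lspan_subset[OF Q.module_axioms T.module_axioms _ _ sub])
    show "linear_map R ?F ?T (\<lambda>x. ?J +>\<^bsub>?F\<^esub> x)"
      unfolding tensor_algebra_def by (rule Q.coset_linear)
    show "monomial R ` lists (carrier M) \<subseteq> carrier ?F"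
      by (intro image_subsetI monomial_closed)
    have "?J +>\<^bsub>?F\<^esub> monomial R xs \<in> lspan R ?T ?B" if "xs \<in> lists (carrier M)" for xs
      using that unfolding tensor_prod_eq_coset[OF that, symmetric]
      by (intro subsetD[OF lspan_superset]) blast
    then show "(\<lambda>x. ?J +>\<^bsub>?F\<^esub> x) ` monomial R ` lists (carrier M) \<subseteq> lspan R ?T ?B"
      unfolding image_image by (rule image_subsetI)
  qed
  moreover have "carrier ?T = (\<lambda>x. ?J +>\<^bsub>?F\<^esub> x) ` carrier ?F"
    by (simp add: tensor_algebra_def Q.quotient_carrier)
  ultimately have "carrier ?T \<subseteq> lspan R ?T ?B"
    by (simp only: free_algebra_span[symmetric])
  then show ?thesis using T.submoduleE(1)[OF sub] by (rule subset_antisym)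
qed

text \<open>Universal property of the tensor algebra. The extension of \<open>g\<close> to the free
  algebra kills the generators of the linearity ideal because \<open>g\<close> is linear; its kernel
  is an ideal, hence contains all of it.\<close>

lemma tensor_algebra_lift:
  assumes A: "assoc_algebra R A" and g: "linear_map R M A g"
  obtains h where "algebra_hom R (tensor_algebra R M) A h"
    "\<And>x. x \<in> carrier M \<Longrightarrow> h (tensor_incl R M x) = g x"
proof -
  let ?F = "free_algebra R (carrier M)" let ?J = "linearity_ideal R M"
  interpret Q: quotient_algebra R ?F ?J by (rule linearity_ideal_algebra)
  interpret A: assoc_algebra R A by (rule A)
  have "g \<in> carrier M \<rightarrow> carrier A" using g by (simp add: linear_map_def)
  then obtain h where h: "algebra_hom R ?F A h"
    and hw: "\<And>w. w \<in> lists (carrier M) \<Longrightarrow> h (monomial R w) = word_prod A g w"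
    using free_algebra_lift[OF A] by blast
  have lin: "linear_map R ?F A h" using h by (simp add: algebra_hom_def)
  have gen: "h (free_gen R x) = g x" if "x \<in> carrier M" for x
    using hw[of "[x]"] that linear_mapD(1)[OF g that] by (simp add: free_gen_eq_monomial)
  note minus = linear_map_minus[OF Q.module_axioms A.module_axioms lin]
  have zero: "h x = \<zero>\<^bsub>A\<^esub>" if "x \<in> ?J" for x
  proof -
    have "?J \<subseteq> {x \<in> carrier ?F. h x = \<zero>\<^bsub>A\<^esub>}"
      unfolding linearity_ideal_def Let_def
    proof (rule Q.A.genideal_minimal[OF algebra_hom_kernel[OF h]])
      show "{free_gen R (x \<oplus>\<^bsub>M\<^esub> y) \<ominus>\<^bsub>?F\<^esub> (free_gen R x \<oplus>\<^bsub>?F\<^esub> free_gen R y) |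
          x y. x \<in> carrier M \<and> y \<in> carrier M} \<union>
       {free_gen R (a \<odot>\<^bsub>M\<^esub> x) \<ominus>\<^bsub>?F\<^esub> a \<odot>\<^bsub>?F\<^esub> free_gen R x |
          a x. a \<in> carrier R \<and> x \<in> carrier M} \<subseteq> {x \<in> carrier ?F. h x = \<zero>\<^bsub>A\<^esub>}"
        by (auto simp: free_gen_closed minus gen linear_mapD[OF lin] linear_mapD[OF g])
    qed
    then show ?thesis using that by blast
  qed
  obtain h' where "algebra_hom R (quotient ?F ?J) A h'"
    "\<And>x. x \<in> carrier ?F \<Longrightarrow> h' (?J +>\<^bsub>?F\<^esub> x) = h x"
    using Q.quotient_lift[OF h zero] by blast
  then show thesis
    using that gen free_gen_closed unfolding tensor_algebra_def tensor_incl_def by metis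
qed

end


section \<open>Direct decompositions\<close>

context module
begin

text \<open>Allowing any finite set that contains the support spares computing the exact support,
  which can shrink through cancellation.\<close>

lemma is_decompositionI:
  assumes "\<And>i. f i \<in> carrier M" "\<And>i. f i \<in> F i" "finite A" "\<And>i. i \<notin> A \<Longrightarrow> f i = \<zero>\<^bsub>M\<^esub>"
    and "x = finsum M f A"
  shows "is_decomposition M F x f"
proof -
  have sub: "{i. f i \<noteq> \<zero>\<^bsub>M\<^esub>} \<subseteq> A" using assms(4) by auto
  have "finsum M f {i. f i \<noteq> \<zero>\<^bsub>M\<^esub>} = finsum M f A"
    by (rule M.add.finprod_mono_neutral_cong_left[OF assms(3) sub]) (use assms(1) in auto)
  then show ?thesis
    using assms finite_subset[OF sub] by (auto simp: is_decomposition_def)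
qed

lemma is_decompositionD:
  assumes "is_decomposition M F x f" "\<And>i. F i \<subseteq> carrier M"
  shows "f i \<in> F i" "f i \<in> carrier M" "finite {i. f i \<noteq> \<zero>\<^bsub>M\<^esub>}"
    and "finite A \<Longrightarrow> {i. f i \<noteq> \<zero>\<^bsub>M\<^esub>} \<subseteq> A \<Longrightarrow> x = finsum M f A"
proof -
  show f: "f i \<in> F i" "f i \<in> carrier M" "finite {i. f i \<noteq> \<zero>\<^bsub>M\<^esub>}" for i
    using assms by (auto simp: is_decomposition_def)
  assume A: "finite A" "{i. f i \<noteq> \<zero>\<^bsub>M\<^esub>} \<subseteq> A"
  have "finsum M f {i. f i \<noteq> \<zero>\<^bsub>M\<^esub>} = finsum M f A"
    by (rule M.add.finprod_mono_neutral_cong_left[OF A]) (use f in auto)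
  then show "x = finsum M f A" using assms(1) by (simp add: is_decomposition_def)
qed

lemma is_decomposition_add:
  assumes sub: "\<And>i. submodule (F i) R M"
    and "is_decomposition M F x f" "is_decomposition M F y g"
  shows "is_decomposition M F (x \<oplus>\<^bsub>M\<^esub> y) (\<lambda>i. f i \<oplus>\<^bsub>M\<^esub> g i)"
proof -
  have F: "\<And>i. F i \<subseteq> carrier M" using submoduleE(1)[OF sub] by blast
  note f = is_decompositionD[OF assms(2) F] and g = is_decompositionD[OF assms(3) F]
  \<comment> \<open>Where \<open>f i\<close> and \<open>g i\<close> cancel, the support of the sum
    is smaller than this union.\<close>
  let ?A = "{i. f i \<noteq> \<zero>\<^bsub>M\<^esub>} \<union> {i. g i \<noteq> \<zero>\<^bsub>M\<^esub>}"
  show ?thesis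
  proof (rule is_decompositionI[of _ _ ?A])
    have "x = finsum M f ?A" "y = finsum M g ?A" using f(3) g(3) by (auto intro: f(4) g(4))
    then show "x \<oplus>\<^bsub>M\<^esub> y = (\<Oplus>\<^bsub>M\<^esub>i\<in>?A. f i \<oplus>\<^bsub>M\<^esub> g i)"
      using f(2) g(2) by (subst M.finsum_addf) auto
  qed (use f g submoduleE(5)[OF sub] in auto)
qed

lemma is_decomposition_smult:
  assumes sub: "\<And>i. submodule (F i) R M"
    and "is_decomposition M F x f" "a \<in> carrier R"
  shows "is_decomposition M F (a \<odot>\<^bsub>M\<^esub> x) (\<lambda>i. a \<odot>\<^bsub>M\<^esub> f i)"
proof -
  have F: "\<And>i. F i \<subseteq> carrier M" using submoduleE(1)[OF sub] by blast
  note f = is_decompositionD[OF assms(2) F]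
  show ?thesis
  proof (rule is_decompositionI[of _ _ "{i. f i \<noteq> \<zero>\<^bsub>M\<^esub>}"])
    show "a \<odot>\<^bsub>M\<^esub> x = (\<Oplus>\<^bsub>M\<^esub>i\<in>{i. f i \<noteq> \<zero>\<^bsub>M\<^esub>}. a \<odot>\<^bsub>M\<^esub> f i)"
      using f(4)[OF f(3)] f(2,3) assms(3) by (subst finsum_smult_ldistr[symmetric]) auto
  qed (use f assms(3) submoduleE(4)[OF sub] in auto)
qed

lemma is_decomposition_single:
  assumes sub: "\<And>i. submodule (F i) R M" and x: "x \<in> F n"
  shows "is_decomposition M F x (\<lambda>i. if i = n then x else \<zero>\<^bsub>M\<^esub>)"
proof -
  have z: "\<zero>\<^bsub>M\<^esub> \<in> F i" for i
    using sub[of i] by (auto intro: submodule_zero)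
  have c: "x \<in> carrier M" using submoduleE(1)[OF sub] x by blast
  show ?thesis
    by (rule is_decompositionI[of _ _ "{n}"]) (use x z c in auto)
qed

context
  fixes F
  assumes dd: "direct_decomposition R M F"
begin

lemma direct_decomposition_submodule: "submodule (F i) R M"
  using dd by (simp add: direct_decomposition_def)

lemma direct_decomposition_subset: "F i \<subseteq> carrier M"
  by (rule submoduleE(1)[OF direct_decomposition_submodule])

lemma components_eqI:
  assumes "x \<in> carrier M" "is_decomposition M F x f"
  shows "components M F x = f"
  unfolding components_def using dd assms
  by (intro the1_equality) (auto simp: direct_decomposition_def)

lemma components_decomposition:
  assumes "x \<in> carrier M"
  shows "is_decomposition M F x (components M F x)"
proof -
  obtain f where "is_decomposition M F x f"
    using dd assms by (auto simp: direct_decomposition_def)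
  then show ?thesis using components_eqI[OF assms] by simp
qed

lemma components_mem: "x \<in> carrier M \<Longrightarrow> components M F x i \<in> F i"
  using is_decompositionD(1)[OF components_decomposition direct_decomposition_subset] .

lemma components_closed: "x \<in> carrier M \<Longrightarrow> components M F x i \<in> carrier M"
  using components_mem direct_decomposition_subset by blast

text \<open>Sums and multiples of decompositions are decompositions again, so uniqueness identifies
  them with the components of the sum or multiple.\<close>

lemma components_linear: "linear_map R M M (\<lambda>x. components M F x i)"
proof (rule linear_mapI)
  note sub = direct_decomposition_submodule
  fix x assume x: "x \<in> carrier M"
  note dx = components_decomposition[OF x]
  show "components M F x i \<in> carrier M" by (rule components_closed[OF x])
  show "components M F (a \<odot>\<^bsub>M\<^esub> x) i = a \<odot>\<^bsub>M\<^esub> components M F x i" if "a \<in> carrier R" for a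
    using components_eqI[OF _ is_decomposition_smult[OF sub dx that]] that x by simp
  show "components M F (x \<oplus>\<^bsub>M\<^esub> y) i = components M F x i \<oplus>\<^bsub>M\<^esub> components M F y i"
    if y: "y \<in> carrier M" for y
    using components_eqI[OF _ is_decomposition_add[OF sub dx components_decomposition[OF y]]] x y
    by simp
qed

lemma components_single:
  assumes "x \<in> F n"
  shows "components M F x = (\<lambda>i. if i = n then x else \<zero>\<^bsub>M\<^esub>)"
  using assms direct_decomposition_subset direct_decomposition_submodule
  by (intro components_eqI is_decomposition_single) auto

end

end


section \<open>The grading of the tensor algebra\<close>

text \<open>In power series notation the factors are \<open>x X^m\<close> and \<open>y X^n\<close>.
  Among the cuts of a word of length \<open>m + n\<close> only the one at \<open>m\<close> gives
  both pieces the right length, and words of other lengths have no such cut.\<close>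

lemma word_series_single_mult:
  assumes "ring A" "x \<in> carrier A" "y \<in> carrier A"
  shows "(\<lambda>u :: 'x list. if length u = m then x else \<zero>\<^bsub>A\<^esub>) \<otimes>\<^bsub>word_series A\<^esub>
      (\<lambda>u. if length u = n then y else \<zero>\<^bsub>A\<^esub>)
    = (\<lambda>u. if length u = m + n then x \<otimes>\<^bsub>A\<^esub> y else \<zero>\<^bsub>A\<^esub>)" (is "?f \<otimes>\<^bsub>_\<^esub> ?g = ?h")
proof
  fix u :: "'x list"
  interpret ring A by fact
  have z: "?f (take i u) \<otimes>\<^bsub>A\<^esub> ?g (drop i u) = \<zero>\<^bsub>A\<^esub>" if "i \<le> length u" "\<not> (i = m \<and> length u = m + n)" for i
    using that assms by auto
  show "(?f \<otimes>\<^bsub>word_series A\<^esub> ?g) u = ?h u"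
  proof (cases "length u = m + n")
    case True
    have "(?f \<otimes>\<^bsub>word_series A\<^esub> ?g) u = ?f (take m u) \<otimes>\<^bsub>A\<^esub> ?g (drop m u)"
      unfolding word_series_def using True assms z
      by (simp only: partial_object.simps monoid.simps, intro finsum_single) auto
    then show ?thesis using True by simp
  next
    case False
    then have "(\<Oplus>\<^bsub>A\<^esub>i\<in>{..length u}. ?f (take i u) \<otimes>\<^bsub>A\<^esub> ?g (drop i u)) = \<zero>\<^bsub>A\<^esub>"
      using z by (intro add.finprod_one_eqI) auto
    then show ?thesis using False by (simp add: word_series_def)
  qed
qed

definition homogeneous_prods ::
  "('k, 'r) ring_scheme \<Rightarrow> ('k, 'a, 'm) module_scheme \<Rightarrow> (nat \<Rightarrow> 'a set) \<Rightarrow> nat \<Rightarrow>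
    ('k, 'a) tensor set"
  where "homogeneous_prods R L Lg m =
    {tensor_prod R L xs | xs. \<exists>ns. list_all2 (\<lambda>x n. x \<in> Lg n) xs ns \<and> sum_list ns = m}"

context module
begin

context
  fixes Lg
  assumes dd: "direct_decomposition R M Lg"
begin

lemma list_all2_lists:
  assumes "list_all2 (\<lambda>x n. x \<in> Lg n) xs ns"
  shows "xs \<in> lists (carrier M)"
proof -
  have "\<And>i. Lg i \<subseteq> carrier M" by (rule direct_decomposition_subset[OF dd])
  with assms show ?thesis by (induction rule: list_all2_induct) auto
qed

lemma homogeneous_prods_closed: "homogeneous_prods R M Lg m \<subseteq> carrier (tensor_algebra R M)"
  unfolding homogeneous_prods_def using tensor_prod_closed list_all2_lists by blast

lemma tensor_eq_submodule: "submodule (tensor_eq R M Lg m) R (tensor_algebra R M)"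
proof -
  interpret T: assoc_algebra R "tensor_algebra R M" by (rule tensor_algebra_assoc_algebra)
  show ?thesis
    using lspan_submodule[OF T.module_axioms homogeneous_prods_closed]
    by (simp add: tensor_eq_def homogeneous_prods_def)
qed

lemma homogeneous_prods_tensor_eq: "homogeneous_prods R M Lg m \<subseteq> tensor_eq R M Lg m"
  by (simp add: tensor_eq_def homogeneous_prods_def lspan_superset)

text \<open>Left multiplication by a homogeneous element of the module maps homogeneous products to
  homogeneous products. An arbitrary element is the finite sum of its components, so left
  multiplication by it preserves the span, and induction on the word reaches every product.\<close>

lemma tensor_algebra_homogeneous_span:
  "carrier (tensor_algebra R M) = lspan R (tensor_algebra R M) (\<Union>m. homogeneous_prods R M Lg m)"
proof -
  let ?T = "tensor_algebra R M" let ?H = "\<Union>m. homogeneous_prods R M Lg m"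
  interpret T: assoc_algebra R ?T by (rule tensor_algebra_assoc_algebra)
  note \<iota> = linear_mapD[OF tensor_incl_linear]
  have H: "?H \<subseteq> carrier ?T" using homogeneous_prods_closed by blast
  have sub: "submodule (lspan R ?T ?H) R ?T" by (rule lspan_submodule[OF T.module_axioms H])
  note sc = T.submoduleE(1)[OF sub]
  have hom: "tensor_incl R M y \<otimes>\<^bsub>?T\<^esub> t \<in> lspan R ?T ?H"
    if y: "y \<in> Lg i" and t: "t \<in> lspan R ?T ?H" for y i t
  proof -
    have yc: "tensor_incl R M y \<in> carrier ?T"
      using y direct_decomposition_subset[OF dd] \<iota>(1) by blast
    have lin: "linear_map R ?T ?T (\<lambda>t. tensor_incl R M y \<otimes>\<^bsub>?T\<^esub> t)"
      using yc by (auto intro!: linear_mapI simp: T.A.r_distr T.smult_mult_right)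
    have "(\<lambda>t. tensor_incl R M y \<otimes>\<^bsub>?T\<^esub> t) ` ?H \<subseteq> lspan R ?T ?H"
    proof
      fix s assume "s \<in> (\<lambda>t. tensor_incl R M y \<otimes>\<^bsub>?T\<^esub> t) ` ?H"
      then obtain xs ns where s: "s = tensor_prod R M (y # xs)"
        and xs: "list_all2 (\<lambda>x n. x \<in> Lg n) xs ns"
        by (auto simp: homogeneous_prods_def)
      have "list_all2 (\<lambda>x n. x \<in> Lg n) (y # xs) (i # ns)" using xs y by simp
      then have "s \<in> homogeneous_prods R M Lg (sum_list (i # ns))"
        unfolding homogeneous_prods_def s by blast
      then show "s \<in> lspan R ?T ?H" by (intro subsetD[OF lspan_superset]) blast
    qed
    then show ?thesis
      using linear_map_lspan_subset[OF T.module_axioms T.module_axioms lin H sub] t by blast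
  qed
  have step: "tensor_incl R M x \<otimes>\<^bsub>?T\<^esub> t \<in> lspan R ?T ?H"
    if x: "x \<in> carrier M" and t: "t \<in> lspan R ?T ?H" for x t
  proof -
    let ?c = "components M Lg x"
    note c = is_decompositionD[OF components_decomposition[OF dd x] direct_decomposition_subset[OF dd]]
    have tc: "t \<in> carrier ?T" using sc t by blast
    have lin: "linear_map R M ?T (\<lambda>x. tensor_incl R M x \<otimes>\<^bsub>?T\<^esub> t)"
      using tc \<iota> by (auto intro!: linear_mapI simp: T.A.l_distr T.smult_mult_left)
    have "tensor_incl R M x \<otimes>\<^bsub>?T\<^esub> t =
        tensor_incl R M (finsum M ?c {i. ?c i \<noteq> \<zero>\<^bsub>M\<^esub>}) \<otimes>\<^bsub>?T\<^esub> t"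
      using c(4)[OF c(3)] by simp
    also have "\<dots> = (\<Oplus>\<^bsub>?T\<^esub>i\<in>{i. ?c i \<noteq> \<zero>\<^bsub>M\<^esub>}. tensor_incl R M (?c i) \<otimes>\<^bsub>?T\<^esub> t)"
      by (rule linear_map_finsum[OF module_axioms T.module_axioms lin]) (use c(2) in auto)
    also have "\<dots> \<in> lspan R ?T ?H"
      by (rule submodule_finsum_closed[OF T.module_axioms sub]) (use hom[OF c(1) t] in auto)
    finally show ?thesis .
  qed
  have "tensor_prod R M xs \<in> lspan R ?T ?H" if "xs \<in> lists (carrier M)" for xs
    using that
  proof (induction xs rule: lists.induct)
    case Nil
    have "tensor_prod R M [] \<in> homogeneous_prods R M Lg 0"
      unfolding homogeneous_prods_def by (intro CollectI exI[of _ "[]"]) auto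
    then show ?case by (intro subsetD[OF lspan_superset]) blast
  next
    case (Cons x xs)
    then show ?case using step by simp
  qed
  then have "lspan R ?T {tensor_prod R M xs | xs. xs \<in> lists (carrier M)} \<subseteq> lspan R ?T ?H"
    by (intro lspan_minimal[OF sub]) blast
  then show ?thesis using sc unfolding tensor_algebra_span[symmetric] by (rule subset_antisym)
qed

text \<open>The series \<open>c t\<close> is the sum of the terms \<open>t_m X^m\<close> over the
  components of \<open>t\<close>. It is obtained together with the decomposition because its
  multiplicativity is exactly the convolution rule for components.\<close>

lemma tensor_algebra_grading:
  obtains c :: "('a, 'c) tensor \<Rightarrow> unit list \<Rightarrow> ('a, 'c) tensor"
  where "direct_decomposition R (tensor_algebra R M) (tensor_eq R M Lg)"
    and "algebra_hom R (tensor_algebra R M) (word_series (tensor_algebra R M)) c"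
    and "\<And>t u. t \<in> carrier (tensor_algebra R M) \<Longrightarrow>
      c t u = components (tensor_algebra R M) (tensor_eq R M Lg) t (length u)"
proof -
  let ?T = "tensor_algebra R M" let ?E = "tensor_eq R M Lg"
  let ?W = "word_series ?T :: ('a, unit list \<Rightarrow> ('a, 'c) tensor) module"
  let ?H = "\<Union>m. homogeneous_prods R M Lg m"
  interpret T: assoc_algebra R ?T by (rule tensor_algebra_assoc_algebra)
  interpret W: assoc_algebra R ?W by (rule word_series_assoc_algebra[OF T.assoc_algebra_axioms])
  have W: "carrier ?W = {f. \<forall>w. f w \<in> carrier ?T}" "\<And>f g. f \<oplus>\<^bsub>?W\<^esub> g = (\<lambda>w. f w \<oplus>\<^bsub>?T\<^esub> g w)"
    "\<And>a f. a \<odot>\<^bsub>?W\<^esub> f = (\<lambda>w. a \<odot>\<^bsub>?T\<^esub> f w)" "\<zero>\<^bsub>?W\<^esub> = (\<lambda>w. \<zero>\<^bsub>?T\<^esub>)"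
    "\<one>\<^bsub>?W\<^esub> = (\<lambda>w. if length w = 0 then \<one>\<^bsub>?T\<^esub> else \<zero>\<^bsub>?T\<^esub>)"
    by (simp_all add: word_series_def)
  \<comment> \<open>A word over \<open>unit\<close> is determined by its length, so \<open>u\<close>
    plays the role of the power of \<open>X\<close> with exponent \<open>length u\<close>.\<close>
  let ?g = "\<lambda>x u. tensor_incl R M (components M Lg x (length u))"
  have "linear_map R M ?W ?g"
  proof -
    have lin: "linear_map R M ?T (\<lambda>x. ?g x u)" for u :: "unit list"
      using linear_map_comp[OF components_linear[OF dd] tensor_incl_linear] by (simp add: comp_def)
    show ?thesis
      by (rule linear_mapI) (use linear_mapD[OF lin] in \<open>auto simp: W\<close>)
  qed
  then obtain c where c: "algebra_hom R ?T ?W c"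
    and c\<iota>: "\<And>x. x \<in> carrier M \<Longrightarrow> c (tensor_incl R M x) = ?g x"
    using tensor_algebra_lift[OF W.assoc_algebra_axioms] by blast
  have clin: "linear_map R ?T ?W c" using c by (simp add: algebra_hom_def)
  have cu: "linear_map R ?T ?T (\<lambda>t. c t u)" for u
    using linear_mapD[OF clin] by (intro linear_mapI) (auto simp: W)
  \<comment> \<open>For \<open>x\<close> in \<open>Lg n\<close> the series of \<open>x\<close> is
    concentrated in degree \<open>n\<close>; multiplicativity of \<open>c\<close> then adds the
    degrees along the word.\<close>
  have single: "c (tensor_prod R M xs) =
      (\<lambda>u. if length u = sum_list ns then tensor_prod R M xs else \<zero>\<^bsub>?T\<^esub>)"
    if "list_all2 (\<lambda>x n. x \<in> Lg n) xs ns" for xs ns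
    using that
  proof (induction rule: list_all2_induct)
    case Nil
    show ?case using c by (simp add: algebra_hom_def ring_hom_def W cong: if_cong)
  next
    case (Cons x xs n ns)
    have x: "x \<in> carrier M" using Cons direct_decomposition_subset[OF dd] by blast
    have xs: "tensor_prod R M xs \<in> carrier ?T"
      by (rule tensor_prod_closed[OF list_all2_lists[OF Cons(2)]])
    have "c (tensor_incl R M x) = (\<lambda>u. if length u = n then tensor_incl R M x else \<zero>\<^bsub>?T\<^esub>)"
      using components_single[OF dd Cons(1)] c\<iota>[OF x]
        linear_map_zero[OF module_axioms T.module_axioms tensor_incl_linear]
      by (auto simp: fun_eq_iff)
    moreover have "c (tensor_prod R M (x # xs)) =
        c (tensor_incl R M x) \<otimes>\<^bsub>?W\<^esub> c (tensor_prod R M xs)"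
      using c x xs tensor_incl_closed by (simp add: algebra_hom_def ring_hom_def)
    ultimately show ?case
      using Cons.IH word_series_single_mult[OF T.A.ring_axioms tensor_incl_closed[OF x] xs]
      by (simp cong: if_cong)
  qed
  \<comment> \<open>Both sides are linear in \<open>t\<close>, so agreement on the spanning products
    suffices.\<close>
  have homog: "c t u = (if length u = m then t else \<zero>\<^bsub>?T\<^esub>)" if "t \<in> ?E m" for t u m
  proof (rule linear_map_eq_on_lspan[OF T.module_axioms T.module_axioms cu _ homogeneous_prods_closed])
    show "linear_map R ?T ?T (\<lambda>t. if length u = m then t else \<zero>\<^bsub>?T\<^esub>)"
      by (auto intro!: linear_mapI)
    show "t \<in> lspan R ?T (homogeneous_prods R M Lg m)"
      using that by (simp add: tensor_eq_def homogeneous_prods_def)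
    show "c s u = (if length u = m then s else \<zero>\<^bsub>?T\<^esub>)" if "s \<in> homogeneous_prods R M Lg m" for s
      using that single by (auto simp: homogeneous_prods_def)
  qed
  have Esub: "\<And>i. ?E i \<subseteq> carrier ?T"
    using T.submoduleE(1)[OF tensor_eq_submodule] by blast
  \<comment> \<open>The coefficients of \<open>c t\<close> are the decomposition. The induction over
    the span also supplies their finite support, which series do not guarantee.\<close>
  have ex: "is_decomposition ?T ?E t (\<lambda>m. c t (replicate m ()))" if "t \<in> carrier ?T" for t
  proof -
    have H: "?H \<subseteq> carrier ?T" using homogeneous_prods_closed by blast
    have sc: "lspan R ?T ?H \<subseteq> carrier ?T" using tensor_algebra_homogeneous_span by blast
    from that have "t \<in> lspan R ?T ?H" using tensor_algebra_homogeneous_span by blast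
    from T.module_axioms H this show ?thesis
    proof (induction rule: lspan_induct)
      case (base t)
      then obtain m where m: "t \<in> ?E m" using homogeneous_prods_tensor_eq by blast
      then show ?case
        using T.is_decomposition_single[where F = ?E, OF tensor_eq_submodule m] by (simp add: homog[OF m])
    next
      case zero
      have z: "\<zero>\<^bsub>?T\<^esub> \<in> ?E 0"
        using tensor_eq_submodule[of 0] by (auto intro: submodule_zero)
      then show ?case
        using T.is_decomposition_single[where F = ?E, OF tensor_eq_submodule z] by (simp add: homog[OF z])
    next
      case (add x y)
      then show ?case
        using T.is_decomposition_add[where F = ?E, OF tensor_eq_submodule add(3,4)]
          linear_mapD(2)[OF cu subsetD[OF sc add(1)] subsetD[OF sc add(2)]] by simp
    next
      case (smult a x)
      then show ?case
        using T.is_decomposition_smult[where F = ?E, OF tensor_eq_submodule smult(3,1)]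
          linear_mapD(3)[OF cu smult(1) subsetD[OF sc smult(2)]] by simp
    qed
  qed
  have uniq: "f (length u) = c t u" if f: "is_decomposition ?T ?E t f" for t f u
  proof -
    note fD = T.is_decompositionD[OF f Esub]
    \<comment> \<open>Applying one coefficient of \<open>c\<close> to the sum isolates one summand.
      The index \<open>length u\<close> is inserted so that this summand is present even when
      \<open>f\<close> vanishes there.\<close>
    have "c t u = c (finsum ?T f (insert (length u) {i. f i \<noteq> \<zero>\<^bsub>?T\<^esub>})) u"
      using fD(3) fD(4)[of "insert (length u) {i. f i \<noteq> \<zero>\<^bsub>?T\<^esub>}"] by auto
    also have "\<dots> = (\<Oplus>\<^bsub>?T\<^esub>i\<in>insert (length u) {i. f i \<noteq> \<zero>\<^bsub>?T\<^esub>}. c (f i) u)"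
      by (rule linear_map_finsum[OF T.module_axioms T.module_axioms cu]) (use fD(2) in auto)
    also have "\<dots> = c (f (length u)) u"
      by (rule T.M.finsum_single) (use fD(2,3) homog[OF fD(1)] in auto)
    finally show ?thesis using homog[OF fD(1)] by simp
  qed
  have dT: "direct_decomposition R ?T ?E"
    unfolding direct_decomposition_def
  proof (intro conjI allI ballI)
    fix t assume t: "t \<in> carrier ?T"
    show "\<exists>!f. is_decomposition ?T ?E t f"
    proof (rule ex1I, rule ex[OF t])
      fix f assume "is_decomposition ?T ?E t f"
      then show "f = (\<lambda>m. c t (replicate m ()))"
        using uniq[of t f "replicate m ()" for m] by (simp add: fun_eq_iff)
    qed
  qed (rule tensor_eq_submodule)
  moreover have "c t u = components ?T ?E t (length u)" if "t \<in> carrier ?T" for t u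
    using uniq[OF T.components_decomposition[OF dT that]] by simp
  ultimately show thesis using c that by blast
qed

end

end


section \<open>The graded algebra associated with a filtered algebra\<close>

definition filtration_quotient ::
  "('k, 'a, 'm) module_scheme \<Rightarrow> (nat \<Rightarrow> 'a set) \<Rightarrow> nat \<Rightarrow> ('k, 'a set) module"
  where "filtration_quotient A F m = quotient (A\<lparr>carrier := F m\<rparr>) (pred_piece A F m)"

text \<open>The pattern of \<open>graded_algebra\<close> for an arbitrary family in an arbitrary
  algebra, so that the theory needs nothing about enveloping algebras;
  \<open>graded_algebra_eq\<close> specializes it.\<close>

definition associated_graded ::
  "('k, 'a, 'm) module_scheme \<Rightarrow> (nat \<Rightarrow> 'a set) \<Rightarrow> ('k, nat \<Rightarrow> 'a set) module"
  where "associated_graded A F =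
    \<lparr>carrier = {g. (\<forall>m. g m \<in> carrier (filtration_quotient A F m)) \<and>
                   finite {m. g m \<noteq> \<zero>\<^bsub>filtration_quotient A F m\<^esub>}},
     monoid.mult = (\<lambda>g h m. \<Oplus>\<^bsub>filtration_quotient A F m\<^esub>i\<in>{..m}.
       rcoset_mult A (pred_piece A F m) (g i) (h (m - i))),
     monoid.one = (\<lambda>m. if m = 0 then pred_piece A F 0 +>\<^bsub>A\<^esub> \<one>\<^bsub>A\<^esub>
       else \<zero>\<^bsub>filtration_quotient A F m\<^esub>),
     ring.zero = (\<lambda>m. \<zero>\<^bsub>filtration_quotient A F m\<^esub>),
     ring.add = (\<lambda>g h m. g m \<oplus>\<^bsub>filtration_quotient A F m\<^esub> h m),
     smult = (\<lambda>a g m. a \<odot>\<^bsub>filtration_quotient A F m\<^esub> g m)\<rparr>"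

text \<open>The Rees algebra: polynomials in \<open>X\<close> whose coefficient at
  \<open>X^m\<close> lies in \<open>F m\<close>, with the power \<open>X^m\<close> encoded as the
  one-letter word of length \<open>m\<close>.\<close>

definition rees :: "('k, 'a, 'm) module_scheme \<Rightarrow> (nat \<Rightarrow> 'a set) \<Rightarrow> (unit list \<Rightarrow> 'a) set"
  where "rees A F = {w. (\<forall>u. w u \<in> F (length u)) \<and> (\<exists>N. \<forall>u. N < length u \<longrightarrow> w u = \<zero>\<^bsub>A\<^esub>)}"

text \<open>Classically this is reduction of the Rees algebra modulo \<open>X\<close>, since
  multiples of \<open>X\<close> have their degree \<open>m\<close> coefficient in the preceding
  filtration step.\<close>

definition graded_class ::
  "('k, 'a, 'm) module_scheme \<Rightarrow> (nat \<Rightarrow> 'a set) \<Rightarrow> (unit list \<Rightarrow> 'a) \<Rightarrow> nat \<Rightarrow> 'a set"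
  where "graded_class A F w = (\<lambda>m. pred_piece A F m +>\<^bsub>A\<^esub> w (replicate m ()))"

locale filtered_algebra = assoc_algebra R A for R and A (structure) +
  fixes F :: "nat \<Rightarrow> 'c set"
  assumes filtration_submodule: "submodule (F m) R A"
    and filtration_mono: "F m \<subseteq> F (Suc m)"
    and filtration_one: "\<one>\<^bsub>A\<^esub> \<in> F 0"
    and filtration_mult: "x \<in> F i \<Longrightarrow> y \<in> F j \<Longrightarrow> x \<otimes>\<^bsub>A\<^esub> y \<in> F (i + j)"
begin

abbreviation "P \<equiv> pred_piece A F"

lemma filtration_closed: "x \<in> F m \<Longrightarrow> x \<in> carrier A"
  using submoduleE(1)[OF filtration_submodule] by blast

lemma filtration_zero: "\<zero>\<^bsub>A\<^esub> \<in> F m"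
  using filtration_submodule[of m] by (auto intro: submodule_zero)

lemma pred_submodule: "submodule (P m) R A"
  by (cases m) (auto simp: pred_piece_def filtration_submodule intro!: submoduleI)

lemma pred_subset: "P m \<subseteq> F m"
  using filtration_mono filtration_zero by (cases m) (auto simp: pred_piece_def)

text \<open>This inclusion and its mirror image \<open>pred_mult_right\<close> are what makes the
  product of classes independent of representatives. In degree zero the preceding piece is the zero
  module, and the product is zero.\<close>

lemma pred_mult_left: "x \<in> F i \<Longrightarrow> y \<in> P j \<Longrightarrow> x \<otimes>\<^bsub>A\<^esub> y \<in> P (i + j)"
  using filtration_mult[of x i y] filtration_closed
  by (cases j) (auto simp: pred_piece_def submodule_zero[OF pred_submodule, unfolded pred_piece_def])

lemma pred_mult_right: "x \<in> P i \<Longrightarrow> y \<in> F j \<Longrightarrow> x \<otimes>\<^bsub>A\<^esub> y \<in> P (i + j)"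
  using filtration_mult[of x _ y j] filtration_closed
  by (cases i) (auto simp: pred_piece_def submodule_zero[OF pred_submodule, unfolded pred_piece_def])

sublocale pred: quotient_module R A "P m" for m
  by (intro quotient_module.intro module_axioms pred_submodule)

sublocale piece: quotient_module R "A\<lparr>carrier := F m\<rparr>" "P m" for m
proof (intro quotient_module.intro submodule_restrict_module module_axioms filtration_submodule)
  interpret Fm: module R "A\<lparr>carrier := F m\<rparr>"
    by (rule submodule_restrict_module[OF module_axioms filtration_submodule])
  note sub = submoduleE[OF pred_submodule]
  \<comment> \<open>The additive inverse is defined relative to the carrier, so the inverses in
    \<open>F m\<close> and in \<open>A\<close> have to be identified.\<close>
  have "\<ominus>\<^bsub>A\<lparr>carrier := F m\<rparr>\<^esub> x = \<ominus>\<^bsub>A\<^esub> x" if "x \<in> P m" for x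
  proof -
    have "linear_map R (A\<lparr>carrier := F m\<rparr>) A (\<lambda>x. x)"
      by (intro linear_mapI) (auto simp: filtration_closed)
    then show ?thesis
      using linear_map_uminus[OF Fm.module_axioms module_axioms] that pred_subset by auto
  qed
  then show "submodule (P m) R (A\<lparr>carrier := F m\<rparr>)"
    using sub pred_subset pred.one_closed by (intro Fm.submoduleI) auto
qed

text \<open>The pieces are quotients of restricted structures, whereas the canonical map forms
  cosets in the whole algebra. A coset uses only the addition, which both share.\<close>

lemma piece_coset: "P m +>\<^bsub>A\<lparr>carrier := F m\<rparr>\<^esub> x = P m +>\<^bsub>A\<^esub> x"
  by (simp add: a_r_coset_def')

lemma filtration_quotient_carrier:
  "carrier (filtration_quotient A F m) = (\<lambda>x. P m +>\<^bsub>A\<^esub> x) ` F m"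
  using piece.quotient_carrier by (simp add: filtration_quotient_def piece_coset)

lemma filtration_quotient_zero: "\<zero>\<^bsub>filtration_quotient A F m\<^esub> = P m"
  using piece.quotient_zero by (simp add: filtration_quotient_def)

lemma filtration_quotient_linear:
  "linear_map R (A\<lparr>carrier := F m\<rparr>) (filtration_quotient A F m) (\<lambda>x. P m +>\<^bsub>A\<^esub> x)"
  using piece.coset_linear by (simp add: filtration_quotient_def piece_coset)

lemma filtration_quotient_finsum:
  assumes "f \<in> I \<rightarrow> F m"
  shows "(\<Oplus>\<^bsub>filtration_quotient A F m\<^esub>i\<in>I. P m +>\<^bsub>A\<^esub> f i) = P m +>\<^bsub>A\<^esub> finsum A f I"
proof -
  have "module R (filtration_quotient A F m)"
    using piece.quotient_module by (simp add: filtration_quotient_def)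
  from linear_map_finsum[OF piece.module_axioms this filtration_quotient_linear, of f I] assms
  show ?thesis using finsum_restrict[OF module_axioms filtration_submodule assms] by simp
qed

text \<open>For representatives \<open>a = p + x\<close> and \<open>b = q + y\<close>, the
  difference of \<open>a b\<close> and \<open>x y\<close> is \<open>p b + x q\<close>, and both
  terms lie in the preceding step. All cosets in the union forming \<open>rcoset_mult\<close> thus
  coincide.\<close>

lemma coset_mult:
  assumes x: "x \<in> F i" and y: "y \<in> F j"
  shows "rcoset_mult A (P (i + j)) (P i +>\<^bsub>A\<^esub> x) (P j +>\<^bsub>A\<^esub> y) = P (i + j) +>\<^bsub>A\<^esub> (x \<otimes>\<^bsub>A\<^esub> y)"
proof -
  have xc: "x \<in> carrier A" and yc: "y \<in> carrier A" using x y filtration_closed by auto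
  have eq: "P (i + j) +>\<^bsub>A\<^esub> (a \<otimes>\<^bsub>A\<^esub> b) = P (i + j) +>\<^bsub>A\<^esub> (x \<otimes>\<^bsub>A\<^esub> y)"
    if ab: "a \<in> P i +>\<^bsub>A\<^esub> x" "b \<in> P j +>\<^bsub>A\<^esub> y" for a b
  proof -
    obtain p where p: "p \<in> P i" "a = p \<oplus>\<^bsub>A\<^esub> x" using ab(1) by (auto simp: a_r_coset_def')
    obtain q where q: "q \<in> P j" "b = q \<oplus>\<^bsub>A\<^esub> y" using ab(2) by (auto simp: a_r_coset_def')
    have pc: "p \<in> carrier A" and qF: "q \<in> F j" and qc: "q \<in> carrier A"
      using p q pred_subset filtration_closed by blast+
    have bF: "b \<in> F j" using q qF y submoduleE(5)[OF filtration_submodule] by blast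
    then have bc: "b \<in> carrier A" by (rule filtration_closed)
    have "a \<otimes>\<^bsub>A\<^esub> b = p \<otimes>\<^bsub>A\<^esub> b \<oplus>\<^bsub>A\<^esub> x \<otimes>\<^bsub>A\<^esub> q \<oplus>\<^bsub>A\<^esub> x \<otimes>\<^bsub>A\<^esub> y"
      using p(2) q(2) pc qc xc yc bc by (simp add: A.l_distr A.r_distr M.a_ac)
    then have "a \<otimes>\<^bsub>A\<^esub> b \<ominus>\<^bsub>A\<^esub> x \<otimes>\<^bsub>A\<^esub> y = p \<otimes>\<^bsub>A\<^esub> b \<oplus>\<^bsub>A\<^esub> x \<otimes>\<^bsub>A\<^esub> q"
      using pc qc xc yc bc by (simp add: a_minus_def M.a_assoc M.r_neg)
    also have "\<dots> \<in> P (i + j)"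
      using pred_mult_right[OF p(1) bF] pred_mult_left[OF x q(1)] submoduleE(5)[OF pred_submodule]
      by blast
    finally show ?thesis
      using pc qc xc yc bc p(2) by (subst pred.coset_eq_iff) auto
  qed
  have "x \<in> P i +>\<^bsub>A\<^esub> x" "y \<in> P j +>\<^bsub>A\<^esub> y" by (simp_all add: pred.N.a_rcos_self xc yc)
  with eq show ?thesis unfolding rcoset_mult_def by blast
qed

section \<open>The Rees algebra and its map onto the associated graded algebra\<close>

lemma rees_submodule: "submodule (rees A F) R (word_series A)"
proof -
  interpret W: assoc_algebra R "word_series A :: ('a, unit list \<Rightarrow> 'c) module"
    by (rule word_series_assoc_algebra[OF assoc_algebra_axioms])
  note sub = submoduleE[OF filtration_submodule]
  have smult: "a \<odot>\<^bsub>word_series A\<^esub> w \<in> rees A F" if aw: "a \<in> carrier R" "w \<in> rees A F" for a w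
  proof -
    obtain N where "\<forall>u. N < length u \<longrightarrow> w u = \<zero>\<^bsub>A\<^esub>"
      using aw(2) by (auto simp: rees_def)
    then have "\<forall>u. N < length u \<longrightarrow> a \<odot>\<^bsub>A\<^esub> w u = \<zero>\<^bsub>A\<^esub>" using aw(1) by simp
    moreover have "a \<odot>\<^bsub>A\<^esub> w u \<in> F (length u)" for u
      using aw sub(4) by (auto simp: rees_def)
    ultimately show ?thesis unfolding rees_def word_series_def by auto
  qed
  have carr: "rees A F \<subseteq> carrier (word_series A)"
    using filtration_closed by (auto simp: rees_def word_series_def)
  show ?thesis
  proof (rule W.submoduleI)
    show "w \<oplus>\<^bsub>word_series A\<^esub> v \<in> rees A F" if "w \<in> rees A F" "v \<in> rees A F" for w v
    proof -
      obtain N K where "\<forall>u. N < length u \<longrightarrow> w u = \<zero>\<^bsub>A\<^esub>" "\<forall>u. K < length u \<longrightarrow> v u = \<zero>\<^bsub>A\<^esub>"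
        using \<open>w \<in> rees A F\<close> \<open>v \<in> rees A F\<close> by (auto simp: rees_def)
      then have "\<exists>N. \<forall>u. N < length u \<longrightarrow> w u \<oplus>\<^bsub>A\<^esub> v u = \<zero>\<^bsub>A\<^esub>"
        by (intro exI[of _ "max N K"]) simp
      moreover have "w u \<oplus>\<^bsub>A\<^esub> v u \<in> F (length u)" for u
        using that sub(5) by (auto simp: rees_def)
      ultimately show ?thesis unfolding rees_def word_series_def by auto
    qed
    show "\<ominus>\<^bsub>word_series A\<^esub> w \<in> rees A F" if "w \<in> rees A F" for w
    proof -
      have "\<ominus>\<^bsub>word_series A\<^esub> w = (\<ominus>\<^bsub>R\<^esub> \<one>\<^bsub>R\<^esub>) \<odot>\<^bsub>word_series A\<^esub> w"
        using that carr by (subst W.smult_l_minus) auto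
      then show ?thesis using smult[OF _ that] by simp
    qed
    show "\<zero>\<^bsub>word_series A\<^esub> \<in> rees A F" by (simp add: rees_def word_series_def filtration_zero)
  qed (use smult carr in auto)
qed

lemma rees_degree: "w \<in> rees A F \<Longrightarrow> w u \<in> F (length u)"
  by (simp add: rees_def)

lemma rees_closed: "w \<in> rees A F \<Longrightarrow> w u \<in> carrier A"
  using filtration_closed by (auto simp: rees_def)

lemma rees_one: "\<one>\<^bsub>word_series A\<^esub> \<in> rees A F"
  by (auto simp: rees_def word_series_def filtration_zero filtration_one)

lemma rees_mult:
  assumes w: "w \<in> rees A F" and v: "v \<in> rees A F"
  shows "w \<otimes>\<^bsub>word_series A\<^esub> v \<in> rees A F"
proof -
  obtain N K where N: "\<And>u. N < length u \<Longrightarrow> w u = \<zero>\<^bsub>A\<^esub>" and K: "\<And>u. K < length u \<Longrightarrow> v u = \<zero>\<^bsub>A\<^esub>"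
    using w v by (auto simp: rees_def)
  have F: "w (take i u) \<otimes>\<^bsub>A\<^esub> v (drop i u) \<in> F (length u)" if "i \<le> length u" for i u
  proof -
    have "w (take i u) \<in> F i" "v (drop i u) \<in> F (length u - i)"
      using rees_degree[OF w, of "take i u"] rees_degree[OF v, of "drop i u"] that by simp_all
    then show ?thesis using filtration_mult that by fastforce
  qed
  have sum: "(\<Oplus>\<^bsub>A\<^esub>i\<in>{..length u}. w (take i u) \<otimes>\<^bsub>A\<^esub> v (drop i u)) \<in> F (length u)" for u
    using F by (intro submodule_finsum_closed[OF module_axioms filtration_submodule]) auto
  \<comment> \<open>A cut of a word longer than \<open>N + K\<close> leaves a prefix longer than
    \<open>N\<close> or a suffix longer than \<open>K\<close>, so every summand vanishes.\<close>
  have zero: "(\<Oplus>\<^bsub>A\<^esub>i\<in>{..length u}. w (take i u) \<otimes>\<^bsub>A\<^esub> v (drop i u)) = \<zero>\<^bsub>A\<^esub>"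
    if u: "N + K < length u" for u
  proof (rule M.add.finprod_one_eqI)
    fix i assume "i \<in> {..length u}"
    then consider "N < length (take i u)" | "K < length (drop i u)" using u by fastforce
    then show "w (take i u) \<otimes>\<^bsub>A\<^esub> v (drop i u) = \<zero>\<^bsub>A\<^esub>"
      by cases (simp_all add: N K rees_closed[OF w] rees_closed[OF v])
  qed
  have "\<exists>N. \<forall>u. N < length u \<longrightarrow>
      (\<Oplus>\<^bsub>A\<^esub>i\<in>{..length u}. w (take i u) \<otimes>\<^bsub>A\<^esub> v (drop i u)) = \<zero>\<^bsub>A\<^esub>"
    using zero by blast
  then show ?thesis using sum unfolding rees_def word_series_def by simp
qed

lemma graded_class_carrier:
  "carrier (associated_graded A F) = graded_class A F ` rees A F"
proof (intro equalityI subsetI)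
  fix g assume "g \<in> carrier (associated_graded A F)"
  then have g: "\<And>m. \<exists>x\<in>F m. g m = P m +>\<^bsub>A\<^esub> x" and fin: "finite {m. g m \<noteq> P m}"
    by (auto simp: associated_graded_def filtration_quotient_carrier filtration_quotient_zero image_iff)
  \<comment> \<open>The zero class gets the representative zero, so that a family of classes with
    finite support lifts to a series with finite support.\<close>
  have "\<exists>x\<in>F m. g m = P m +>\<^bsub>A\<^esub> x \<and> (g m = P m \<longrightarrow> x = \<zero>\<^bsub>A\<^esub>)" for m
    using g[of m] filtration_zero[of m] pred.coset_zero[of m] by metis
  then obtain x where x: "\<And>m. x m \<in> F m" "\<And>m. g m = P m +>\<^bsub>A\<^esub> x m"
    "\<And>m. g m = P m \<Longrightarrow> x m = \<zero>\<^bsub>A\<^esub>"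
    by metis
  obtain N where "\<And>m. N < m \<Longrightarrow> g m = P m"
    using fin by (auto simp: finite_nat_set_iff_bounded_le) (metis leD)
  then have "\<forall>u :: unit list. N < length u \<longrightarrow> x (length u) = \<zero>\<^bsub>A\<^esub>" using x(3) by simp
  then have "(\<lambda>u. x (length u)) \<in> rees A F"
    unfolding rees_def using x(1) by blast
  moreover have "g = graded_class A F (\<lambda>u. x (length u))"
    using x(2) by (simp add: graded_class_def fun_eq_iff)
  ultimately show "g \<in> graded_class A F ` rees A F" by blast
next
  fix g assume "g \<in> graded_class A F ` rees A F"
  then obtain w where w: "w \<in> rees A F" and g: "g = graded_class A F w" by blast
  have wF: "w (replicate m ()) \<in> F m" for m
    using rees_degree[OF w, of "replicate m ()"] by simp
  obtain N where N: "\<And>u. N < length u \<Longrightarrow> w u = \<zero>\<^bsub>A\<^esub>" using w by (auto simp: rees_def)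
  have "{m. g m \<noteq> P m} \<subseteq> {..N}"
  proof
    fix m assume "m \<in> {m. g m \<noteq> P m}"
    then have "w (replicate m ()) \<noteq> \<zero>\<^bsub>A\<^esub>" by (auto simp: g graded_class_def pred.coset_zero)
    then show "m \<in> {..N}" using N[of "replicate m ()"] by force
  qed
  then have "finite {m. g m \<noteq> P m}" by (rule finite_subset) simp
  moreover have "g m \<in> (\<lambda>x. P m +>\<^bsub>A\<^esub> x) ` F m" for m using wF by (simp add: g graded_class_def)
  ultimately show "g \<in> carrier (associated_graded A F)"
    by (simp add: associated_graded_def filtration_quotient_carrier filtration_quotient_zero)
qed

lemma rees_component: "w \<in> rees A F \<Longrightarrow> w (replicate m ()) \<in> F m"
  using rees_degree[of w "replicate m ()"] by simp

lemma graded_class_zero: "graded_class A F \<zero>\<^bsub>word_series A\<^esub> = \<zero>\<^bsub>associated_graded A F\<^esub>"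
  by (simp add: graded_class_def word_series_def associated_graded_def filtration_quotient_zero
      pred.coset_zero)

lemma graded_class_one: "graded_class A F \<one>\<^bsub>word_series A\<^esub> = \<one>\<^bsub>associated_graded A F\<^esub>"
  by (simp add: graded_class_def word_series_def associated_graded_def filtration_quotient_zero
      pred.coset_zero fun_eq_iff)

lemma graded_class_add:
  assumes "w \<in> rees A F" "v \<in> rees A F"
  shows "graded_class A F (w \<oplus>\<^bsub>word_series A\<^esub> v) =
    graded_class A F w \<oplus>\<^bsub>associated_graded A F\<^esub> graded_class A F v"
  using linear_mapD(2)[OF filtration_quotient_linear] rees_component[OF assms(1)]
    rees_component[OF assms(2)]
  by (simp add: graded_class_def word_series_def associated_graded_def)

lemma graded_class_smult:
  assumes "a \<in> carrier R" "w \<in> rees A F"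
  shows "graded_class A F (a \<odot>\<^bsub>word_series A\<^esub> w) = a \<odot>\<^bsub>associated_graded A F\<^esub> graded_class A F w"
  using linear_mapD(3)[OF filtration_quotient_linear assms(1)] rees_component[OF assms(2)]
  by (simp add: graded_class_def word_series_def associated_graded_def)

lemma graded_class_mult:
  assumes w: "w \<in> rees A F" and v: "v \<in> rees A F"
  shows "graded_class A F (w \<otimes>\<^bsub>word_series A\<^esub> v) =
    graded_class A F w \<otimes>\<^bsub>associated_graded A F\<^esub> graded_class A F v"
proof
  fix m
  let ?w = "\<lambda>i. w (replicate i ())" and ?v = "\<lambda>i. v (replicate i ())"
  note wF = rees_component[OF w] and vF = rees_component[OF v]
  have F: "?w i \<otimes>\<^bsub>A\<^esub> ?v (m - i) \<in> F m" if "i \<le> m" for i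
    using filtration_mult[OF wF[of i] vF[of "m - i"]] that by simp
  have "(graded_class A F w \<otimes>\<^bsub>associated_graded A F\<^esub> graded_class A F v) m =
      (\<Oplus>\<^bsub>filtration_quotient A F m\<^esub>i\<in>{..m}. rcoset_mult A (P m) (P i +>\<^bsub>A\<^esub> ?w i) (P (m - i) +>\<^bsub>A\<^esub> ?v (m - i)))"
    by (simp add: associated_graded_def graded_class_def)
  also have "\<dots> = (\<Oplus>\<^bsub>filtration_quotient A F m\<^esub>i\<in>{..m}. P m +>\<^bsub>A\<^esub> (?w i \<otimes>\<^bsub>A\<^esub> ?v (m - i)))"
  proof -
    interpret Q: module R "filtration_quotient A F m"
      using piece.quotient_module by (simp add: filtration_quotient_def)
    show ?thesis
    proof (rule Q.M.finsum_cong')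
      show "rcoset_mult A (P m) (P i +>\<^bsub>A\<^esub> ?w i) (P (m - i) +>\<^bsub>A\<^esub> ?v (m - i)) =
          P m +>\<^bsub>A\<^esub> (?w i \<otimes>\<^bsub>A\<^esub> ?v (m - i))" if "i \<in> {..m}" for i
        using coset_mult[OF wF[of i] vF[of "m - i"]] that by simp
    qed (use F in \<open>auto simp: filtration_quotient_carrier\<close>)
  qed
  also have "\<dots> = P m +>\<^bsub>A\<^esub> (\<Oplus>\<^bsub>A\<^esub>i\<in>{..m}. ?w i \<otimes>\<^bsub>A\<^esub> ?v (m - i))"
    using F by (intro filtration_quotient_finsum) auto
  \<comment> \<open>Cutting the word of length \<open>m\<close> at \<open>i\<close> leaves the words
    of lengths \<open>i\<close> and \<open>m - i\<close>, which turns word convolution into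
    convolution of degrees.\<close>
  also have "(\<Oplus>\<^bsub>A\<^esub>i\<in>{..m}. ?w i \<otimes>\<^bsub>A\<^esub> ?v (m - i)) = (w \<otimes>\<^bsub>word_series A\<^esub> v) (replicate m ())"
    using rees_closed[OF w] rees_closed[OF v]
    by (auto simp: word_series_def min_def intro!: M.finsum_cong')
  finally show "graded_class A F (w \<otimes>\<^bsub>word_series A\<^esub> v) m =
      (graded_class A F w \<otimes>\<^bsub>associated_graded A F\<^esub> graded_class A F v) m"
    by (simp add: graded_class_def)
qed

lemma associated_graded_assoc_algebra: "assoc_algebra R (associated_graded A F)"
  by (rule assoc_algebra_image[where f = "graded_class A F",
        OF word_series_assoc_algebra[OF assoc_algebra_axioms] rees_submodule])
    (auto simp: rees_one rees_mult graded_class_carrier graded_class_zero graded_class_one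
      graded_class_add graded_class_mult graded_class_smult)

lemma graded_class_hom:
  assumes h: "algebra_hom R B (word_series A) h" and sub: "h ` carrier B \<subseteq> rees A F"
  shows "algebra_hom R B (associated_graded A F) (\<lambda>x. graded_class A F (h x))"
proof -
  have "h x \<in> rees A F" if "x \<in> carrier B" for x using that sub by blast
  then show ?thesis
    using h associated_graded_assoc_algebra
    by (auto simp: algebra_hom_def ring_hom_def linear_map_def Pi_def graded_class_carrier
        graded_class_one graded_class_add graded_class_mult graded_class_smult)
qed

end

lemma filtered_algebra_image:
  assumes "filtered_algebra R A F" and h: "algebra_hom R A B h"
  shows "filtered_algebra R B (\<lambda>m. h ` F m)"
proof -
  interpret filtered_algebra R A F by fact
  interpret B: assoc_algebra R B using h by (simp add: algebra_hom_def)
  have lin: "linear_map R A B h" and one: "h \<one>\<^bsub>A\<^esub> = \<one>\<^bsub>B\<^esub>"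
    and mult: "\<And>x y. x \<in> carrier A \<Longrightarrow> y \<in> carrier A \<Longrightarrow> h (x \<otimes>\<^bsub>A\<^esub> y) = h x \<otimes>\<^bsub>B\<^esub> h y"
    using h by (auto simp: algebra_hom_def ring_hom_def)
  show ?thesis
  proof (intro filtered_algebra.intro filtered_algebra_axioms.intro B.assoc_algebra_axioms)
    show "submodule (h ` F m) R B" for m
      by (rule submodule_image[OF module_axioms B.module_axioms lin filtration_submodule])
    show "h ` F m \<subseteq> h ` F (Suc m)" for m using filtration_mono by (rule image_mono)
    show "\<one>\<^bsub>B\<^esub> \<in> h ` F 0"
      using imageI[OF filtration_one, of h] one by simp
    show "x \<otimes>\<^bsub>B\<^esub> y \<in> h ` F (i + j)" if xy: "x \<in> h ` F i" "y \<in> h ` F j" for x y i j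
    proof -
      obtain a b where "x = h a" "a \<in> F i" "y = h b" "b \<in> F j" using xy by blast
      then show ?thesis
        using imageI[OF filtration_mult[of a i b j], of h] by (simp add: mult filtration_closed)
    qed
  qed
qed

lemma word_series_hom:
  fixes A :: "('k, 'a, 'm) module_scheme"
  assumes h: "algebra_hom R A B h"
  shows "algebra_hom R (word_series A) (word_series B) (\<lambda>f (u :: 'x list). h (f u))"
proof -
  interpret A: assoc_algebra R A using h by (simp add: algebra_hom_def)
  interpret B: assoc_algebra R B using h by (simp add: algebra_hom_def)
  have lin: "linear_map R A B h" and mult: "\<And>x y. x \<in> carrier A \<Longrightarrow> y \<in> carrier A \<Longrightarrow> h (x \<otimes>\<^bsub>A\<^esub> y) = h x \<otimes>\<^bsub>B\<^esub> h y"
    and one: "h \<one>\<^bsub>A\<^esub> = \<one>\<^bsub>B\<^esub>" using h by (auto simp: algebra_hom_def ring_hom_def)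
  note hl = linear_mapD[OF lin] linear_map_zero[OF A.module_axioms B.module_axioms lin]
  have "(\<lambda>u. h ((f \<otimes>\<^bsub>word_series A\<^esub> g) u)) = (\<lambda>u. h (f u)) \<otimes>\<^bsub>word_series B\<^esub> (\<lambda>u. h (g u))"
    if "f \<in> carrier (word_series A)" "g \<in> carrier (word_series A)" for f g :: "'x list \<Rightarrow> 'a"
    using that hl(1)
    by (auto simp: word_series_def mult linear_map_finsum[OF A.module_axioms B.module_axioms lin]
        intro!: B.M.finsum_cong')
  moreover have "linear_map R (word_series A) (word_series B) (\<lambda>f (u :: 'x list). h (f u))"
    by (rule linear_mapI) (auto simp: word_series_def hl)
  moreover have "(\<lambda>u :: 'x list. h (\<one>\<^bsub>word_series A\<^esub> u)) = \<one>\<^bsub>word_series B\<^esub>"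
    by (auto simp: word_series_def hl one)
  ultimately show ?thesis
    using linear_mapD(1,2)[of R "word_series A" "word_series B"]
    by (auto simp: algebra_hom_def ring_hom_def word_series_assoc_algebra A.assoc_algebra_axioms
        B.assoc_algebra_axioms)
qed


section \<open>The filtration of the tensor algebra\<close>

context module
begin

section \<open>Tensor powers and the products of two elements\<close>

lemma tensor_power_submodule: "submodule (tensor_power R M n) R (tensor_algebra R M)"
proof -
  interpret T: assoc_algebra R "tensor_algebra R M" by (rule tensor_algebra_assoc_algebra)
  show ?thesis
    unfolding tensor_power_def
    by (rule lspan_submodule[OF T.module_axioms]) (auto intro: tensor_prod_closed)
qed

lemma tensor_prod2_mem:
  assumes "x \<in> carrier M" "y \<in> carrier M"
  shows "tensor_prod R M [x, y] \<in> tensor_power R M 2"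
  unfolding tensor_power_def
  by (rule subsetD[OF lspan_superset], intro CollectI exI[of _ "[x, y]"]) (use assms in auto)

lemma tensor_prod2_linear:
  assumes "x \<in> carrier M"
  shows "linear_map R M (tensor_power_module R M 2) (\<lambda>y. tensor_prod R M [x, y])"
    "linear_map R M (tensor_power_module R M 2) (\<lambda>y. tensor_prod R M [y, x])"
proof -
  interpret T: assoc_algebra R "tensor_algebra R M" by (rule tensor_algebra_assoc_algebra)
  note \<iota> = linear_mapD[OF tensor_incl_linear]
  show "linear_map R M (tensor_power_module R M 2) (\<lambda>y. tensor_prod R M [x, y])"
    using assms tensor_prod2_mem
    by (intro linear_mapI)
      (auto simp: tensor_power_module_def \<iota> T.A.r_distr T.smult_mult_right simp del: One_nat_def)
  show "linear_map R M (tensor_power_module R M 2) (\<lambda>y. tensor_prod R M [y, x])"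
    using assms tensor_prod2_mem
    by (intro linear_mapI)
      (auto simp: tensor_power_module_def \<iota> T.A.l_distr T.smult_mult_left simp del: One_nat_def)
qed

context
  fixes Lg
  assumes dd: "direct_decomposition R M Lg"
begin

text \<open>The equalizer of \<open>f\<close> and \<open>g\<close> is a submodule and contains every
  component of \<open>x\<close>, hence also their sum.\<close>

lemma linear_map_eq_homogeneous:
  assumes "module R N" "linear_map R M N f" "linear_map R M N g"
    and "\<And>i x. x \<in> Lg i \<Longrightarrow> f x = g x" "x \<in> carrier M"
  shows "f x = g x"
proof -
  let ?c = "components M Lg x"
  note c = is_decompositionD[OF components_decomposition[OF dd assms(5)] direct_decomposition_subset[OF dd]]
  have "\<And>i. ?c i \<in> {x \<in> carrier M. f x = g x}" using assms(4) c(1,2) by blast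
  then have "finsum M ?c {i. ?c i \<noteq> \<zero>\<^bsub>M\<^esub>} \<in> {x \<in> carrier M. f x = g x}"
    by (intro submodule_finsum_closed[OF module_axioms
          submodule_equalizer[OF module_axioms assms(1-3)]]) blast
  then show ?thesis using c(4)[OF c(3)] by simp
qed

lemma tensor_le_eq_lspan:
  "tensor_le R M Lg m = lspan R (tensor_algebra R M) (\<Union>i\<in>{..m}. homogeneous_prods R M Lg i)"
proof -
  have "{tensor_prod R M xs | xs. \<exists>ns. list_all2 (\<lambda>x n. x \<in> Lg n) xs ns \<and> sum_list ns \<le> m} =
      (\<Union>i\<in>{..m}. homogeneous_prods R M Lg i)"
    unfolding homogeneous_prods_def by blast
  then show ?thesis by (simp add: tensor_le_def)
qed

lemma homogeneous_prods_mult: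
  assumes "s \<in> homogeneous_prods R M Lg i" "t \<in> homogeneous_prods R M Lg j"
  shows "s \<otimes>\<^bsub>tensor_algebra R M\<^esub> t \<in> homogeneous_prods R M Lg (i + j)"
proof -
  obtain xs ns ys ks where s: "s = tensor_prod R M xs" "list_all2 (\<lambda>x n. x \<in> Lg n) xs ns" "sum_list ns = i"
    and t: "t = tensor_prod R M ys" "list_all2 (\<lambda>x n. x \<in> Lg n) ys ks" "sum_list ks = j"
    using assms by (auto simp: homogeneous_prods_def)
  have "s \<otimes>\<^bsub>tensor_algebra R M\<^esub> t = tensor_prod R M (xs @ ys)"
    using s t list_all2_lists[OF dd] by (simp only: tensor_prod_append)
  moreover have "list_all2 (\<lambda>x n. x \<in> Lg n) (xs @ ys) (ns @ ks)" "sum_list (ns @ ks) = i + j"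
    using s t by (auto intro: list_all2_appendI)
  ultimately show ?thesis unfolding homogeneous_prods_def by blast
qed

lemma tensor_filtered_algebra: "filtered_algebra R (tensor_algebra R M) (tensor_le R M Lg)"
proof -
  let ?T = "tensor_algebra R M" let ?F = "tensor_le R M Lg"
  let ?H = "\<lambda>m. \<Union>i\<in>{..m}. homogeneous_prods R M Lg i"
  interpret T: assoc_algebra R ?T by (rule tensor_algebra_assoc_algebra)
  have H: "?H m \<subseteq> carrier ?T" for m using homogeneous_prods_closed[OF dd] by blast
  have sub: "submodule (?F m) R ?T" for m
    unfolding tensor_le_eq_lspan by (rule lspan_submodule[OF T.module_axioms H])
  have HF: "?H m \<subseteq> ?F m" for m unfolding tensor_le_eq_lspan by (rule lspan_superset)
  have HH: "s \<otimes>\<^bsub>?T\<^esub> t \<in> ?F (i + j)" if st: "s \<in> ?H i" "t \<in> ?H j" for s t i j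
  proof -
    obtain i' j' where ij: "i' \<le> i" "s \<in> homogeneous_prods R M Lg i'" "j' \<le> j" "t \<in> homogeneous_prods R M Lg j'"
      using st by blast
    then have "i' + j' \<in> {..i + j}" by simp
    then have "s \<otimes>\<^bsub>?T\<^esub> t \<in> ?H (i + j)"
      using homogeneous_prods_mult[OF ij(2,4)] by blast
    then show ?thesis using HF by blast
  qed
  show ?thesis
  proof (intro filtered_algebra.intro filtered_algebra_axioms.intro T.assoc_algebra_axioms sub)
    show "?F m \<subseteq> ?F (Suc m)" for m
      unfolding tensor_le_eq_lspan[of m]
      by (rule lspan_minimal[OF sub]) (use HF[of "Suc m"] in \<open>auto intro: le_SucI\<close>)
    have "tensor_prod R M [] \<in> homogeneous_prods R M Lg 0"
      unfolding homogeneous_prods_def by (intro CollectI exI[of _ "[]"]) auto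
    then show "\<one>\<^bsub>?T\<^esub> \<in> ?F 0" using HF[of 0] by auto
    fix x i y j assume x: "x \<in> ?F i" and y: "y \<in> ?F j"
    have yc: "y \<in> carrier ?T" using y T.submoduleE(1)[OF sub] by blast
    \<comment> \<open>Extension in two stages: the right factor ranges over its whole span while the
      left one is still a spanning product, and then the left factor is extended as well.\<close>
    have "s \<otimes>\<^bsub>?T\<^esub> y \<in> ?F (i + j)" if s: "s \<in> ?H i" for s
    proof -
      have "s \<in> carrier ?T" using s H by blast
      then have lin: "linear_map R ?T ?T (\<lambda>t. s \<otimes>\<^bsub>?T\<^esub> t)"
        by (intro linear_mapI) (auto simp: T.A.r_distr T.smult_mult_right)
      show ?thesis
        using linear_map_lspan_subset[OF T.module_axioms T.module_axioms lin H sub, of j "i + j"]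
          HH[OF s] y unfolding tensor_le_eq_lspan[of j] by blast
    qed
    moreover have lin: "linear_map R ?T ?T (\<lambda>s. s \<otimes>\<^bsub>?T\<^esub> y)"
      using yc by (intro linear_mapI) (auto simp: T.A.l_distr T.smult_mult_left)
    ultimately show "x \<otimes>\<^bsub>?T\<^esub> y \<in> ?F (i + j)"
      using linear_map_lspan_subset[OF T.module_axioms T.module_axioms lin H sub, of i "i + j"]
        x unfolding tensor_le_eq_lspan[of i] by blast
  qed
qed

lemma tensor_eq_subset_le: "tensor_eq R M Lg m \<subseteq> tensor_le R M Lg m"
proof -
  interpret T: filtered_algebra R "tensor_algebra R M" "tensor_le R M Lg" by (rule tensor_filtered_algebra)
  have "homogeneous_prods R M Lg m \<subseteq> tensor_le R M Lg m"
    unfolding tensor_le_eq_lspan by (rule subset_trans[OF _ lspan_superset]) blast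
  then show ?thesis
    using lspan_minimal[OF T.filtration_submodule] by (simp add: tensor_eq_def homogeneous_prods_def)
qed

text \<open>A spanning product of degree \<open>m\<close> is its own homogeneous part, and one of
  smaller degree can take \<open>r = 0\<close>. Both choices add up linearly. This gives every class
  in degree \<open>m\<close> a homogeneous representative.\<close>

lemma tensor_le_split:
  assumes "t \<in> tensor_le R M Lg m"
  shows "\<exists>r\<in>tensor_eq R M Lg m. t \<ominus>\<^bsub>tensor_algebra R M\<^esub> r \<in> pred_piece (tensor_algebra R M) (tensor_le R M Lg) m"
proof -
  let ?T = "tensor_algebra R M" let ?F = "tensor_le R M Lg" let ?E = "tensor_eq R M Lg"
  let ?H = "\<lambda>m. \<Union>i\<in>{..m}. homogeneous_prods R M Lg i"
  interpret T: filtered_algebra R ?T ?F by (rule tensor_filtered_algebra)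
  have H: "?H m \<subseteq> carrier ?T" for m using homogeneous_prods_closed[OF dd] by blast
  note E = T.submoduleE[OF tensor_eq_submodule[OF dd]] and P = T.submoduleE[OF T.pred_submodule]
  have Ec: "r \<in> carrier ?T" if "r \<in> ?E m" for r using E(1) that by blast
  have Pz: "\<zero>\<^bsub>?T\<^esub> \<in> T.P m"
    using T.pred_submodule[of m] by (auto intro: submodule_zero)
  have Ez: "\<zero>\<^bsub>?T\<^esub> \<in> ?E m"
    using tensor_eq_submodule[OF dd, of m] by (auto intro: submodule_zero)
  from assms have "t \<in> lspan R ?T (?H m)" by (simp add: tensor_le_eq_lspan)
  from T.module_axioms H this show ?thesis
  proof (induction rule: lspan_induct)
    case (base t)
    then obtain i where i: "i \<le> m" "t \<in> homogeneous_prods R M Lg i" by blast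
    have tc: "t \<in> carrier ?T" using base H by blast
    show ?case
    proof (cases "i = m")
      case True
      then have "t \<in> ?E m" using i homogeneous_prods_tensor_eq[OF dd] by blast
      then show ?thesis using tc Pz by (intro bexI[of _ t]) (simp_all add: a_minus_def T.M.r_neg)
    next
      case False
      \<comment> \<open>A product of degree below \<open>m\<close> forces \<open>m > 0\<close>, so
        the preceding piece is a genuine filtration step and not the conventional zero
        module.\<close>
      then obtain k where k: "m = Suc k" "i \<le> k" using i(1) by (cases m) auto
      then have "t \<in> ?H k" using i by blast
      then have "t \<in> T.P m"
        using lspan_superset[of "?H k" R ?T] by (auto simp: pred_piece_def k tensor_le_eq_lspan)
      then show ?thesis using tc Ez by (intro bexI[of _ "\<zero>\<^bsub>?T\<^esub>"]) (simp_all add: a_minus_def)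
    qed
  next
    case zero
    then show ?case using Ez Pz by (intro bexI[of _ "\<zero>\<^bsub>?T\<^esub>"]) (simp_all add: a_minus_def)
  next
    case (add x y)
    then obtain r s where r: "r \<in> ?E m" "x \<ominus>\<^bsub>?T\<^esub> r \<in> T.P m" and s: "s \<in> ?E m" "y \<ominus>\<^bsub>?T\<^esub> s \<in> T.P m"
      by blast
    have c: "x \<in> carrier ?T" "y \<in> carrier ?T" "r \<in> carrier ?T" "s \<in> carrier ?T"
      using add(1,2) r s Ec T.submoduleE(1)[OF lspan_submodule[OF T.module_axioms H]] by blast+
    then have "(x \<oplus>\<^bsub>?T\<^esub> y) \<ominus>\<^bsub>?T\<^esub> (r \<oplus>\<^bsub>?T\<^esub> s) = (x \<ominus>\<^bsub>?T\<^esub> r) \<oplus>\<^bsub>?T\<^esub> (y \<ominus>\<^bsub>?T\<^esub> s)"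
      by (simp add: a_minus_def T.M.minus_add T.M.a_ac)
    then have "(x \<oplus>\<^bsub>?T\<^esub> y) \<ominus>\<^bsub>?T\<^esub> (r \<oplus>\<^bsub>?T\<^esub> s) \<in> T.P m" using P(5)[OF r(2) s(2)] by simp
    then show ?case using E(5)[OF r(1) s(1)] by blast
  next
    case (smult a x)
    then obtain r where r: "r \<in> ?E m" "x \<ominus>\<^bsub>?T\<^esub> r \<in> T.P m" by blast
    have c: "x \<in> carrier ?T" "r \<in> carrier ?T"
      using smult(2) r Ec T.submoduleE(1)[OF lspan_submodule[OF T.module_axioms H]] by blast+
    then have "a \<odot>\<^bsub>?T\<^esub> x \<ominus>\<^bsub>?T\<^esub> a \<odot>\<^bsub>?T\<^esub> r = a \<odot>\<^bsub>?T\<^esub> (x \<ominus>\<^bsub>?T\<^esub> r)"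
      using smult(1) by (simp add: a_minus_def T.smult_r_distr T.smult_r_minus)
    then have "a \<odot>\<^bsub>?T\<^esub> x \<ominus>\<^bsub>?T\<^esub> a \<odot>\<^bsub>?T\<^esub> r \<in> T.P m" using P(4)[OF smult(1) r(2)] by simp
    then show ?case using E(4)[OF smult(1) r(1)] by blast
  qed
qed

lemma tensor2_eq_subset: "tensor2_eq R M Lg n \<subseteq> tensor_eq R M Lg n"
  unfolding tensor2_eq_def
proof (rule lspan_minimal[OF tensor_eq_submodule[OF dd]], safe)
  fix x y i j assume "x \<in> Lg i" "y \<in> Lg j" "n = i + j"
  then have "list_all2 (\<lambda>x n. x \<in> Lg n) [x, y] [i, j] \<and> sum_list [i, j] = n" by simp
  then have "tensor_prod R M [x, y] \<in> homogeneous_prods R M Lg n"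
    unfolding homogeneous_prods_def by blast
  then show "tensor_prod R M [x, y] \<in> tensor_eq R M Lg (i + j)"
    using homogeneous_prods_tensor_eq[OF dd] \<open>n = i + j\<close> by blast
qed

lemma tensor2_le_subset: "tensor2_le R M Lg n \<subseteq> tensor_le R M Lg n"
proof -
  interpret T: filtered_algebra R "tensor_algebra R M" "tensor_le R M Lg" by (rule tensor_filtered_algebra)
  show ?thesis
    unfolding tensor2_le_def
  proof (rule lspan_minimal[OF T.filtration_submodule], safe)
    fix x y i j assume "x \<in> Lg i" "y \<in> Lg j" "i + j \<le> n"
    then have "list_all2 (\<lambda>x n. x \<in> Lg n) [x, y] [i, j] \<and> sum_list [i, j] \<le> n" by simp
    then show "tensor_prod R M [x, y] \<in> tensor_le R M Lg n"
      unfolding tensor_le_def by (intro subsetD[OF lspan_superset]) blast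
  qed
qed

lemma tensor_incl_le:
  assumes "x \<in> Lg n"
  shows "tensor_incl R M x \<in> tensor_le R M Lg n"
proof -
  interpret T: assoc_algebra R "tensor_algebra R M" by (rule tensor_algebra_assoc_algebra)
  have "tensor_prod R M [x] = tensor_incl R M x"
    using assms direct_decomposition_subset[OF dd, of n] tensor_incl_closed by auto
  moreover have "list_all2 (\<lambda>x n. x \<in> Lg n) [x] [n] \<and> sum_list [n] \<le> n" using assms by simp
  ultimately show ?thesis
    unfolding tensor_le_def by (intro subsetD[OF lspan_superset]) (blast intro: sym)
qed

end

end


section \<open>The graded algebra of the enveloping algebra\<close>

context t_lie_algebra
begin

lemma presymmetry_closed: "t \<in> tensor_power R L 2 \<Longrightarrow> S t \<in> tensor_power R L 2"
  using linear_mapD(1)[OF presymmetry_linear] by (simp add: tensor_power_module_def)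

lemma tensor_power2_closed: "t \<in> tensor_power R L 2 \<Longrightarrow> t \<in> carrier (tensor_algebra R L)"
proof -
  interpret T: assoc_algebra R "tensor_algebra R L" by (rule tensor_algebra_assoc_algebra)
  show "t \<in> tensor_power R L 2 \<Longrightarrow> ?thesis"
    using T.submoduleE(1)[OF tensor_power_submodule] by blast
qed

lemma envelope_generators_closed:
  assumes "x \<in> carrier L" "y \<in> carrier L"
  shows "tensor_prod R L [x, y] \<in> carrier (tensor_algebra R L)"
    "S (tensor_prod R L [x, y]) \<in> carrier (tensor_algebra R L)"
    "pb (tensor_prod R L [x, y]) \<in> carrier (tensor_algebra R L)"
    "tensor_incl R L (br (tensor_prod R L [x, y])) \<in> carrier (tensor_algebra R L)"
proof -
  note t = tensor_prod2_mem[OF assms]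
  show "tensor_prod R L [x, y] \<in> carrier (tensor_algebra R L)"
    "S (tensor_prod R L [x, y]) \<in> carrier (tensor_algebra R L)"
    by (intro tensor_power2_closed presymmetry_closed t)+
  show "pb (tensor_prod R L [x, y]) \<in> carrier (tensor_algebra R L)"
    using linear_mapD(1)[OF pseudobracket_linear] t
    by (simp add: tensor_power_module_def tensor_power2_closed)
  show "tensor_incl R L (br (tensor_prod R L [x, y])) \<in> carrier (tensor_algebra R L)"
    using linear_mapD(1)[OF bracket_linear] t
    by (intro tensor_incl_closed) (simp add: tensor_power_module_def)
qed

lemma envelope_quotient_algebra:
  "quotient_algebra R (tensor_algebra R L) (envelope_ideal R L br S pb)"
proof -
  interpret T: assoc_algebra R "tensor_algebra R L" by (rule tensor_algebra_assoc_algebra)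
  have "ideal (envelope_ideal R L br S pb) (tensor_algebra R L)"
    unfolding envelope_ideal_def Let_def
    by (rule T.A.genideal_ideal) (auto simp: envelope_generators_closed simp del: tensor_prod_simps)
  then show ?thesis by (simp add: quotient_algebra_def T.assoc_algebra_axioms)
qed

lemma envelope_proj_hom:
  "algebra_hom R (tensor_algebra R L) (envelope R L br S pb) (envelope_proj R L br S pb)"
  using quotient_algebra.coset_algebra_hom[OF envelope_quotient_algebra]
  by (simp add: envelope_def envelope_proj_def[abs_def])

lemma envelope_filtered_algebra:
  "filtered_algebra R (envelope R L br S pb) (envelope_filtration R L Lg br S pb)"
  using filtered_algebra_image[OF tensor_filtered_algebra[OF gradation] envelope_proj_hom]
  by (simp add: envelope_filtration_def[abs_def])

lemma graded_algebra_eq: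
  "graded_algebra R L Lg br S pb =
    associated_graded (envelope R L br S pb) (envelope_filtration R L Lg br S pb)"
  by (simp add: graded_algebra_def associated_graded_def graded_piece_def[abs_def]
      filtration_quotient_def[abs_def] filtration_pred_def Let_def cong: if_cong)

lemma envelope_proj_pred:
  "envelope_proj R L br S pb ` pred_piece (tensor_algebra R L) (tensor_le R L Lg) m =
    pred_piece (envelope R L br S pb) (envelope_filtration R L Lg br S pb) m"
proof -
  interpret T: assoc_algebra R "tensor_algebra R L" by (rule tensor_algebra_assoc_algebra)
  interpret U: assoc_algebra R "envelope R L br S pb"
    using envelope_proj_hom by (simp add: algebra_hom_def)
  have "envelope_proj R L br S pb \<zero>\<^bsub>tensor_algebra R L\<^esub> = \<zero>\<^bsub>envelope R L br S pb\<^esub>"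
    using envelope_proj_hom
    by (intro linear_map_zero[OF T.module_axioms U.module_axioms]) (simp add: algebra_hom_def)
  then show ?thesis by (cases m) (auto simp: pred_piece_def envelope_filtration_def)
qed

section \<open>The canonical map to the graded algebra\<close>

lemma graded_map_hom:
  "algebra_hom R (tensor_algebra R L) (graded_algebra R L Lg br S pb) (graded_map R L Lg br S pb)"
proof -
  let ?T = "tensor_algebra R L" let ?U = "envelope R L br S pb"
  let ?F = "envelope_filtration R L Lg br S pb" let ?\<pi> = "envelope_proj R L br S pb"
  let ?E = "tensor_eq R L Lg"
  interpret T: assoc_algebra R ?T by (rule tensor_algebra_assoc_algebra)
  interpret U: filtered_algebra R ?U ?F by (rule envelope_filtered_algebra)
  obtain c :: "('a, 'c) tensor \<Rightarrow> unit list \<Rightarrow> ('a, 'c) tensor"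
    where dT: "direct_decomposition R ?T ?E" and c: "algebra_hom R ?T (word_series ?T) c"
      and cc: "\<And>t u. t \<in> carrier ?T \<Longrightarrow> c t u = components ?T ?E t (length u)"
    using tensor_algebra_grading[OF gradation] by blast
  \<comment> \<open>Projecting each component to the enveloping algebra yields a morphism into the
    series over it. Only its image still has to be placed in the Rees algebra.\<close>
  have h: "algebra_hom R ?T (word_series ?U) (\<lambda>t u. ?\<pi> (c t u))"
    using algebra_hom_comp[OF c word_series_hom[OF envelope_proj_hom]] by (simp add: comp_def)
  have \<pi>0: "?\<pi> \<zero>\<^bsub>?T\<^esub> = \<zero>\<^bsub>?U\<^esub>"
    using envelope_proj_hom
    by (intro linear_map_zero[OF T.module_axioms U.module_axioms]) (simp add: algebra_hom_def)
  have "(\<lambda>t u. ?\<pi> (c t u)) ` carrier ?T \<subseteq> rees ?U ?F"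
  proof (rule image_subsetI)
    fix t assume t: "t \<in> carrier ?T"
    have "?\<pi> (c t u) \<in> ?F (length u)" for u
      using T.components_mem[OF dT t] tensor_eq_subset_le[OF gradation]
      by (auto simp: cc[OF t] envelope_filtration_def)
    \<comment> \<open>A bound for the finitely many degrees in which \<open>t\<close> has a nonzero
      component; beyond it the projected series is zero.\<close>
    moreover obtain N where "\<And>i. components ?T ?E t i \<noteq> \<zero>\<^bsub>?T\<^esub> \<Longrightarrow> i \<le> N"
      using T.components_decomposition[OF dT t]
      by (auto simp: is_decomposition_def finite_nat_set_iff_bounded_le)
    then have "\<forall>u. N < length u \<longrightarrow> ?\<pi> (c t u) = \<zero>\<^bsub>?U\<^esub>"
      using \<pi>0 by (metis cc[OF t] leD)
    ultimately show "(\<lambda>u. ?\<pi> (c t u)) \<in> rees ?U ?F" unfolding rees_def by blast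
  qed
  from U.graded_class_hom[OF h this] show ?thesis
    unfolding graded_algebra_eq
    by (rule algebra_hom_cong)
      (simp add: graded_map_def graded_class_def filtration_pred_def cc)
qed

lemma graded_map_surj:
  "graded_map R L Lg br S pb ` carrier (tensor_algebra R L) =
    carrier (graded_algebra R L Lg br S pb)"
proof (intro equalityI subsetI)
  let ?T = "tensor_algebra R L" let ?U = "envelope R L br S pb"
  let ?F = "envelope_filtration R L Lg br S pb" let ?\<pi> = "envelope_proj R L br S pb"
  let ?E = "tensor_eq R L Lg" let ?P = "pred_piece ?T (tensor_le R L Lg)"
  interpret T: filtered_algebra R ?T "tensor_le R L Lg" by (rule tensor_filtered_algebra[OF gradation])
  interpret U: filtered_algebra R ?U ?F by (rule envelope_filtered_algebra)
  have \<pi>: "linear_map R ?T ?U ?\<pi>" using envelope_proj_hom by (simp add: algebra_hom_def)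
  have dT: "direct_decomposition R ?T ?E"
    using tensor_algebra_grading[OF gradation] by metis
  fix g assume "g \<in> carrier (graded_algebra R L Lg br S pb)"
  then obtain w where w: "w \<in> rees ?U ?F" and g: "g = graded_class ?U ?F w"
    by (auto simp: graded_algebra_eq U.graded_class_carrier)
  \<comment> \<open>Homogeneous representatives are chosen degree by degree. Choosing zero wherever
    \<open>w\<close> is zero lets these choices be summed to a single tensor.\<close>
  have ex: "\<exists>r\<in>?E m. U.P m +>\<^bsub>?U\<^esub> ?\<pi> r = U.P m +>\<^bsub>?U\<^esub> w (replicate m ()) \<and>
      (w (replicate m ()) = \<zero>\<^bsub>?U\<^esub> \<longrightarrow> r = \<zero>\<^bsub>?T\<^esub>)" for m
  proof (cases "w (replicate m ()) = \<zero>\<^bsub>?U\<^esub>")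
    case True
    have "\<zero>\<^bsub>?T\<^esub> \<in> ?E m"
      using T.direct_decomposition_submodule[OF dT, of m] by (auto intro: submodule_zero)
    then show ?thesis
      using True linear_map_zero[OF T.module_axioms U.module_axioms \<pi>]
      by (intro bexI[of _ "\<zero>\<^bsub>?T\<^esub>"]) auto
  next
    case False
    obtain t where t: "t \<in> tensor_le R L Lg m" "w (replicate m ()) = ?\<pi> t"
      using U.rees_component[OF w, of m] by (auto simp: envelope_filtration_def)
    obtain r where r: "r \<in> ?E m" "t \<ominus>\<^bsub>?T\<^esub> r \<in> ?P m"
      using tensor_le_split[OF gradation t(1)] by blast
    have c: "t \<in> carrier ?T" "r \<in> carrier ?T"
      using t(1) r(1) T.filtration_closed T.direct_decomposition_subset[OF dT] by blast+
    have "?\<pi> (t \<ominus>\<^bsub>?T\<^esub> r) \<in> U.P m" using r(2) envelope_proj_pred by blast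
    then have "U.P m +>\<^bsub>?U\<^esub> ?\<pi> t = U.P m +>\<^bsub>?U\<^esub> ?\<pi> r"
      using c linear_map_minus[OF T.module_axioms U.module_axioms \<pi> c]
      by (subst U.pred.coset_eq_iff) (auto intro: linear_mapD(1)[OF \<pi>])
    then show ?thesis using False r(1) t(2) by auto
  qed
  then obtain r where rE: "\<And>m. r m \<in> ?E m"
    and r: "\<And>m. U.P m +>\<^bsub>?U\<^esub> ?\<pi> (r m) = U.P m +>\<^bsub>?U\<^esub> w (replicate m ())"
    and r0: "\<And>m. w (replicate m ()) = \<zero>\<^bsub>?U\<^esub> \<Longrightarrow> r m = \<zero>\<^bsub>?T\<^esub>"
    by metis
  obtain N where N: "\<And>u. N < length u \<Longrightarrow> w u = \<zero>\<^bsub>?U\<^esub>" using w by (auto simp: rees_def)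
  have rc: "r m \<in> carrier ?T" for m using rE T.direct_decomposition_subset[OF dT] by blast
  define t where "t = finsum ?T r {..N}"
  have t: "t \<in> carrier ?T" unfolding t_def using rc by (intro T.M.finsum_closed) auto
  \<comment> \<open>The chosen \<open>r m\<close> already lie in the homogeneous pieces, so by
    uniqueness they are the components of their sum.\<close>
  have "is_decomposition ?T ?E t r"
    by (rule T.is_decompositionI[of _ _ "{..N}"]) (use rc rE r0 N t_def in auto)
  then have "components ?T ?E t = r" by (rule T.components_eqI[OF dT t])
  then have "graded_map R L Lg br S pb t = g"
    by (simp add: graded_map_def g graded_class_def filtration_pred_def r)
  then show "g \<in> graded_map R L Lg br S pb ` carrier ?T" using t by blast
next
  fix g assume "g \<in> graded_map R L Lg br S pb ` carrier (tensor_algebra R L)"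
  then show "g \<in> carrier (graded_algebra R L Lg br S pb)"
    using graded_map_hom by (auto simp: algebra_hom_def linear_map_def)
qed

lemma graded_map_presymmetry:
  assumes hS: "homogeneous_presymmetry R L Lg S" and x: "x \<in> carrier L" and y: "y \<in> carrier L"
  shows "graded_map R L Lg br S pb (tensor_prod R L [x, y]) =
    graded_map R L Lg br S pb (S (tensor_prod R L [x, y]))"
proof -
  let ?T = "tensor_algebra R L" let ?U = "envelope R L br S pb"
  let ?G = "graded_algebra R L Lg br S pb" let ?\<phi> = "graded_map R L Lg br S pb"
  let ?F = "envelope_filtration R L Lg br S pb" let ?\<pi> = "envelope_proj R L br S pb"
  let ?E = "tensor_eq R L Lg" let ?P = "pred_piece ?T (tensor_le R L Lg)"
  interpret T: filtered_algebra R ?T "tensor_le R L Lg" by (rule tensor_filtered_algebra[OF gradation])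
  interpret U: filtered_algebra R ?U ?F by (rule envelope_filtered_algebra)
  interpret G: assoc_algebra R ?G using graded_map_hom by (simp add: algebra_hom_def)
  interpret Q: quotient_algebra R ?T "envelope_ideal R L br S pb" by (rule envelope_quotient_algebra)
  note L = direct_decomposition_subset[OF gradation]
  have dT: "direct_decomposition R ?T ?E"
    using tensor_algebra_grading[OF gradation] by metis
  have \<phi>: "linear_map R ?T ?G ?\<phi>" using graded_map_hom by (simp add: algebra_hom_def)
  have homog: "?\<phi> (tensor_prod R L [x, y]) = ?\<phi> (S (tensor_prod R L [x, y]))"
    if xi: "x \<in> Lg i" and yj: "y \<in> Lg j" for x y i j
  proof -
    let ?t = "tensor_prod R L [x, y]" let ?n = "i + j"
    have xy: "x \<in> carrier L" "y \<in> carrier L" using xi yj L by auto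
    note gc = envelope_generators_closed[OF xy]
    define d where "d = ?t \<ominus>\<^bsub>?T\<^esub> S ?t"
    have dc: "d \<in> carrier ?T" using gc by (simp add: d_def del: tensor_prod_simps)
    have "?t \<in> tensor2_eq R L Lg ?n"
      unfolding tensor2_eq_def using xi yj by (intro subsetD[OF lspan_superset]) blast
    then have tE: "?t \<in> ?E ?n" using tensor2_eq_subset[OF gradation] by blast
    have SE: "S ?t \<in> ?E ?n"
      using hS xi yj tensor2_eq_subset[OF gradation] unfolding homogeneous_presymmetry_def by blast
    note E = T.submoduleE[OF T.direct_decomposition_submodule[OF dT]]
    \<comment> \<open>Here homogeneity of \<open>S\<close> enters: \<open>d\<close> is its own
      component in degree \<open>i + j\<close> and has no other, so its image is governed by a
      single class.\<close>
    have dE: "d \<in> ?E ?n" using E(5)[OF tE E(3)[OF SE]] by (simp add: d_def a_minus_def)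
    note P = T.submoduleE[OF T.pred_submodule]
    \<comment> \<open>For \<open>i + j = 0\<close> the preceding piece is zero, and the degree
      condition then makes the pseudobracket vanish; the bracket below behaves in the same
      way.\<close>
    have pb: "pb ?t \<in> ?P ?n"
      using pseudobracket_degree[OF xi yj] tensor2_le_subset[OF gradation]
      by (cases ?n) (auto simp: pred_piece_def simp del: tensor_prod_simps)
    have br: "tensor_incl R L (br ?t) \<in> ?P ?n"
      using bracket_degree[OF xi yj] tensor_incl_le[OF gradation]
        linear_map_zero[OF module_axioms T.module_axioms tensor_incl_linear]
      by (cases ?n) (auto simp: pred_piece_def simp del: tensor_prod_simps)
    have "d \<ominus>\<^bsub>?T\<^esub> pb ?t \<ominus>\<^bsub>?T\<^esub> tensor_incl R L (br ?t) \<in> envelope_ideal R L br S pb"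
      unfolding envelope_ideal_def Let_def d_def
    proof (rule subsetD[OF T.A.genideal_self])
      show "{tensor_prod R L [x, y] \<ominus>\<^bsub>?T\<^esub> S (tensor_prod R L [x, y])
              \<ominus>\<^bsub>?T\<^esub> pb (tensor_prod R L [x, y])
              \<ominus>\<^bsub>?T\<^esub> tensor_incl R L (br (tensor_prod R L [x, y])) |
            x y. x \<in> carrier L \<and> y \<in> carrier L} \<subseteq> carrier ?T"
        by (auto simp: envelope_generators_closed simp del: tensor_prod_simps)
    qed (use xy in blast)
    moreover have "d \<ominus>\<^bsub>?T\<^esub> pb ?t \<ominus>\<^bsub>?T\<^esub> tensor_incl R L (br ?t) =
        d \<ominus>\<^bsub>?T\<^esub> (pb ?t \<oplus>\<^bsub>?T\<^esub> tensor_incl R L (br ?t))"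
      using dc gc by (simp add: a_minus_def T.M.minus_add T.M.a_ac del: tensor_prod_simps)
    ultimately have "?\<pi> d = ?\<pi> (pb ?t \<oplus>\<^bsub>?T\<^esub> tensor_incl R L (br ?t))"
      unfolding envelope_proj_def using dc gc by (subst Q.coset_eq_iff) (auto simp del: tensor_prod_simps)
    moreover have "pb ?t \<oplus>\<^bsub>?T\<^esub> tensor_incl R L (br ?t) \<in> ?P ?n" by (rule P(5)[OF pb br])
    ultimately have \<pi>d: "?\<pi> d \<in> U.P ?n" using envelope_proj_pred by blast
    have \<pi>0: "?\<pi> \<zero>\<^bsub>?T\<^esub> = \<zero>\<^bsub>?U\<^esub>"
      using envelope_proj_hom
      by (intro linear_map_zero[OF T.module_axioms U.module_axioms]) (simp add: algebra_hom_def)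
    \<comment> \<open>In degree \<open>i + j\<close> the coset is trivial because the projection of
      \<open>d\<close> lies in the preceding step; in any other degree the component is zero. The
      set \<open>U.P m\<close> is itself the zero class.\<close>
    have "?\<phi> d m = U.P m" for m
      using U.pred.N.a_rcos_const[OF \<pi>d]
      by (simp add: graded_map_def T.components_single[OF dT dE] filtration_pred_def \<pi>0
          U.pred.coset_zero)
    then have "?\<phi> d = \<zero>\<^bsub>?G\<^esub>"
      by (simp add: fun_eq_iff graded_algebra_eq associated_graded_def U.filtration_quotient_zero)
    then have "?\<phi> ?t \<ominus>\<^bsub>?G\<^esub> ?\<phi> (S ?t) = \<zero>\<^bsub>?G\<^esub>"
      using linear_map_minus[OF T.module_axioms G.module_axioms \<phi> gc(1,2)] by (simp add: d_def)
    then show ?thesis using linear_mapD(1)[OF \<phi>] gc(1,2) by simp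
  qed
  let ?T2 = "tensor_power_module R L 2"
  \<comment> \<open>Linearity of \<open>S\<close> is given only on the tensor square, so the
    canonical map is restricted to it before the two are composed.\<close>
  have \<phi>2: "linear_map R ?T2 ?G ?\<phi>"
    unfolding tensor_power_module_def
    by (rule linear_map_restrict[OF \<phi>]) (use tensor_power2_closed in blast)
  have \<phi>S: "linear_map R ?T2 ?G (\<lambda>t. ?\<phi> (S t))"
    using linear_map_comp[OF presymmetry_linear \<phi>2] by (simp add: comp_def)
  have left: "linear_map R L ?G (\<lambda>x. ?\<phi> (tensor_prod R L [x, y]))"
    "linear_map R L ?G (\<lambda>x. ?\<phi> (S (tensor_prod R L [x, y])))" if "y \<in> carrier L" for y
    using linear_map_comp[OF tensor_prod2_linear(2)[OF that] \<phi>2]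
      linear_map_comp[OF tensor_prod2_linear(2)[OF that] \<phi>S]
    by (simp_all only: comp_def)
  have right: "linear_map R L ?G (\<lambda>y. ?\<phi> (tensor_prod R L [x, y]))"
    "linear_map R L ?G (\<lambda>y. ?\<phi> (S (tensor_prod R L [x, y])))" if "x \<in> carrier L" for x
    using linear_map_comp[OF tensor_prod2_linear(1)[OF that] \<phi>2]
      linear_map_comp[OF tensor_prod2_linear(1)[OF that] \<phi>S]
    by (simp_all only: comp_def)
  show ?thesis
  \<comment> \<open>Reduction to homogeneous arguments one variable at a time: \<open>x\<close> with
    \<open>y\<close> arbitrary, and then \<open>y\<close> with \<open>x\<close> homogeneous.\<close>
  proof (rule linear_map_eq_homogeneous[OF gradation G.module_axioms left[OF y] _ x])
    fix i x assume xi: "x \<in> Lg i"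
    then have xc: "x \<in> carrier L" using L by blast
    show "?\<phi> (tensor_prod R L [x, y]) = ?\<phi> (S (tensor_prod R L [x, y]))"
      by (rule linear_map_eq_homogeneous[OF gradation G.module_axioms right[OF xc] homog[OF xi] y])
  qed
qed

section \<open>The presymmetry ideal and the q-symmetric algebra\<close>

lemma presymmetry_quotient_algebra:
  "quotient_algebra R (tensor_algebra R L) (presymmetry_ideal R L S)"
proof -
  interpret T: assoc_algebra R "tensor_algebra R L" by (rule tensor_algebra_assoc_algebra)
  have "ideal (presymmetry_ideal R L S) (tensor_algebra R L)"
    unfolding presymmetry_ideal_def Let_def
    by (rule T.A.genideal_ideal) (auto simp: envelope_generators_closed simp del: tensor_prod_simps)
  then show ?thesis by (simp add: quotient_algebra_def T.assoc_algebra_axioms)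
qed

text \<open>Since the canonical map is multiplicative, its kernel is a two-sided ideal, and
  vanishing on the generators suffices.\<close>

lemma graded_map_presymmetry_ideal:
  assumes "homogeneous_presymmetry R L Lg S" "t \<in> presymmetry_ideal R L S"
  shows "graded_map R L Lg br S pb t = \<zero>\<^bsub>graded_algebra R L Lg br S pb\<^esub>"
proof -
  let ?T = "tensor_algebra R L" let ?G = "graded_algebra R L Lg br S pb"
  let ?\<phi> = "graded_map R L Lg br S pb"
  interpret T: assoc_algebra R ?T by (rule tensor_algebra_assoc_algebra)
  interpret G: assoc_algebra R ?G using graded_map_hom by (simp add: algebra_hom_def)
  have \<phi>: "linear_map R ?T ?G ?\<phi>" using graded_map_hom by (simp add: algebra_hom_def)
  have gen: "?\<phi> (tensor_prod R L [x, y] \<ominus>\<^bsub>?T\<^esub> S (tensor_prod R L [x, y])) = \<zero>\<^bsub>?G\<^esub>"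
    if xy: "x \<in> carrier L" "y \<in> carrier L" for x y
    using linear_map_minus[OF T.module_axioms G.module_axioms \<phi> envelope_generators_closed(1,2)[OF xy]]
      graded_map_presymmetry[OF assms(1) xy] linear_mapD(1)[OF \<phi> envelope_generators_closed(2)[OF xy]]
    by simp
  have "presymmetry_ideal R L S \<subseteq> {t \<in> carrier ?T. ?\<phi> t = \<zero>\<^bsub>?G\<^esub>}"
    unfolding presymmetry_ideal_def Let_def
    by (rule T.A.genideal_minimal[OF algebra_hom_kernel[OF graded_map_hom]])
      (auto simp: envelope_generators_closed gen simp del: tensor_prod_simps)
  then show ?thesis using assms(2) by blast
qed

text \<open>The inclusion sends the zero bracket to the zero tensor, so the generators of the two
  ideals agree for each pair \<open>x\<close>, \<open>y\<close>.\<close>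

lemma q_symmetric_ideal:
  "envelope_ideal R L (\<lambda>_. \<zero>\<^bsub>L\<^esub>) S (\<lambda>_. \<zero>\<^bsub>tensor_algebra R L\<^esub>) = presymmetry_ideal R L S"
proof -
  let ?T = "tensor_algebra R L"
  interpret T: assoc_algebra R ?T by (rule tensor_algebra_assoc_algebra)
  have "tensor_prod R L [x, y] \<ominus>\<^bsub>?T\<^esub> S (tensor_prod R L [x, y]) \<ominus>\<^bsub>?T\<^esub> \<zero>\<^bsub>?T\<^esub> \<ominus>\<^bsub>?T\<^esub> tensor_incl R L \<zero>\<^bsub>L\<^esub>
      = tensor_prod R L [x, y] \<ominus>\<^bsub>?T\<^esub> S (tensor_prod R L [x, y])"
    if "x \<in> carrier L" "y \<in> carrier L" for x y
    using envelope_generators_closed[OF that]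
      linear_map_zero[OF module_axioms T.module_axioms tensor_incl_linear]
    by (simp add: a_minus_def del: tensor_prod_simps)
  then show ?thesis
    unfolding envelope_ideal_def presymmetry_ideal_def Let_def
    by (intro arg_cong[of _ _ "genideal ?T"] Collect_cong ex_cong1) (metis (no_types))
qed

lemma graded_map_factors:
  assumes hS: "homogeneous_presymmetry R L Lg S"
  shows "\<exists>\<omega>. algebra_hom R (q_symmetric_algebra R L S) (graded_algebra R L Lg br S pb) \<omega> \<and>
    \<omega> ` carrier (q_symmetric_algebra R L S) = carrier (graded_algebra R L Lg br S pb) \<and>
    (\<forall>t\<in>carrier (tensor_algebra R L).
      \<omega> (q_symmetric_proj R L S t) = graded_map R L Lg br S pb t)"
proof -
  let ?T = "tensor_algebra R L" let ?I = "presymmetry_ideal R L S"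
  interpret Q: quotient_algebra R ?T ?I by (rule presymmetry_quotient_algebra)
  have q: "q_symmetric_algebra R L S = quotient ?T ?I"
    by (simp add: q_symmetric_algebra_def envelope_def q_symmetric_ideal)
  have p: "q_symmetric_proj R L S t = ?I +>\<^bsub>?T\<^esub> t" for t
    by (simp add: q_symmetric_proj_def envelope_proj_def q_symmetric_ideal)
  obtain \<omega> where \<omega>: "algebra_hom R (quotient ?T ?I) (graded_algebra R L Lg br S pb) \<omega>"
    "\<And>t. t \<in> carrier ?T \<Longrightarrow> \<omega> (?I +>\<^bsub>?T\<^esub> t) = graded_map R L Lg br S pb t"
    using Q.quotient_lift[OF graded_map_hom graded_map_presymmetry_ideal[OF hS]] by blast
  \<comment> \<open>Every element of the quotient is a coset, so \<omega> has the same image as the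
    canonical map and inherits its surjectivity.\<close>
  have "\<omega> ` carrier (quotient ?T ?I) = graded_map R L Lg br S pb ` carrier ?T"
    by (auto simp: Q.quotient_carrier image_image \<omega>(2))
  then show ?thesis using \<omega> unfolding q p graded_map_surj by blast
qed

end

text \<open>The claims about the ideal are conditional on homogeneity of \<open>S\<close>, because
  they fail without it: the example preceding \<open>homogeneous_presymmetry\<close> is a
  counterexample. The last clause expresses that \<omega> is induced by the canonical map.\<close>

theorem proposition4:
  fixes R :: "('k, 'r) ring_scheme"
    and L :: "('k, 'a, 'm) module_scheme"
    and Lg :: "nat \<Rightarrow> 'a set"
    and br :: "('k, 'a) tensor \<Rightarrow> 'a"
    and S pb :: "('k, 'a) tensor \<Rightarrow> ('k, 'a) tensor"
  assumes "t_lie_algebra R L Lg br S pb"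
  shows "algebra_hom R (tensor_algebra R L) (graded_algebra R L Lg br S pb)
           (graded_map R L Lg br S pb) \<and>
         (homogeneous_presymmetry R L Lg S \<longrightarrow>
           graded_map R L Lg br S pb ` presymmetry_ideal R L S
             = {\<zero>\<^bsub>graded_algebra R L Lg br S pb\<^esub>} \<and>
           (\<exists>\<omega>. algebra_hom R (q_symmetric_algebra R L S) (graded_algebra R L Lg br S pb) \<omega> \<and>
                \<omega> ` carrier (q_symmetric_algebra R L S)
                  = carrier (graded_algebra R L Lg br S pb) \<and>
                (\<forall>t\<in>carrier (tensor_algebra R L).
                  \<omega> (q_symmetric_proj R L S t) = graded_map R L Lg br S pb t)))"
proof -
  interpret t_lie_algebra R L Lg br S pb by fact
  interpret Q: quotient_algebra R "tensor_algebra R L" "presymmetry_ideal R L S"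
    by (rule presymmetry_quotient_algebra)
  have "graded_map R L Lg br S pb ` presymmetry_ideal R L S = {\<zero>\<^bsub>graded_algebra R L Lg br S pb\<^esub>}"
    if "homogeneous_presymmetry R L Lg S"
  proof -
    \<comment> \<open>The image equals the singleton of zero and is not merely contained in it,
      because the ideal is nonempty.\<close>
    have "presymmetry_ideal R L S \<noteq> {}"
      using additive_subgroup.zero_closed[OF Q.is_additive_subgroup] by blast
    then show ?thesis using graded_map_presymmetry_ideal[OF that] by (auto simp: image_iff)
  qed
  then show ?thesis using graded_map_hom graded_map_factors by blast
qed

end
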